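(* Let $(\overline{M},g)$ be a compact surface with interior $M$ and boundary $\partial M$, and let $(u_0,\phi)$ be an admissible Cauchy-Dirichlet pair. Assume in addition that there exists $T_3>0$ such that $\phi$ depends only on $t$ for $t\ge T_3$, i.e. $\phi=\phi(t)$ for $t\ge T_3$, and that $\phi'(t)\to0$ as $t\to\infty$. Let $u$ be the solution of the Cauchy-Dirichlet problem $$u_t=e^{-2u}(\Delta_g u-K_g)-1\ \text{ in } M\times[0,\infty),\qquad u=\phi\ \text{ on }\partial M\times[0,\infty),\qquad u|_{t=0}=u_0\ \text{ in } M$$ (which exists for all time, is unique, and converges locally uniformly in $C^2$ in $M$ to $u_{LN}$). Then the geodesic curvature of $\partial M$ with respect to $e^{2u}g$ satisfies $$k_{e^{2u}g}=e^{-u}\Big(\frac{\partial u}{\partial n_g}+k_g\Big)\to1$$ uniformly on $\partial M$ as $t\to\infty$.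
   Context: $(\overline{M},g)$ is a smooth compact Riemannian surface with boundary $\partial M$ (possibly with several components) and interior $M$; $K_g$ is its Gauss curvature, $n_g$ the outward unit normal along $\partial M$, $k_g$ the geodesic curvature of $\partial M$ (sign convention: the Euclidean unit disk has $k=1$); $\alpha\in(0,1)$ is fixed. $C^{k+\alpha,\frac{k+\alpha}{2}}$ denotes the usual parabolic Hölder spaces. Low-speed increasing function: $\xi\in C^1([0,\infty))$ with $\xi>0$, $\lim_{t\to\infty}\xi(t)=\infty$, and such that there are constants $T>0$ and $0<\tau<1$ with $\xi'(t)\le\tau$ for all $t\ge T$. Admissible Cauchy-Dirichlet pair $(u_0,\phi)$: $u_0\in C^{2+\alpha}(\overline{M})$; $\phi\in C^{2+\alpha,1+\frac{\alpha}{2}}(\partial M\times[0,T'])$ for all $T'>0$; for $x\in\partial M$, $u_0(x)=\phi(x,0)$ and $\phi_t(x,0)=e^{-2u_0(x)}(\Delta_g u_0(x)-K_g(x))-1$; $\phi_t\ge0$ on $\partial M\times[T,\infty)$ for some $T>0$; and there are $T_1>0$ and a low-speed increasing function $\xi$ with $\phi(x,t)\ge\log(\xi(t))$ on $\partial M\times[T_1,\infty)$. For such a pair the Cauchy-Dirichlet problem has a unique solution $u$ that lies in $C^{2+\alpha,1+\frac{\alpha}{2}}(\overline{M}\times[0,T'])$ for all $T'>0$, and $u(\cdot,t)\to u_{LN}$ locally uniformly in $C^2$ in $M$. The Loewner-Nirenberg solution $u_{LN}$ is the unique solution of $\Delta_g u-K_g=e^{2u}$ in $M$ with $u(p)\to+\infty$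 as $p\to\partial M$. *)

theory Defs
  imports "HOL-Analysis.Analysis"
begin

section \<open>Calculus on coordinate domains\<close>

text \<open>
  Coordinate domains are either open subsets of a Euclidean space or relatively open subsets of a
  closed half plane. Partial derivatives are taken within the domain, so that they
  are one-sided at boundary points of the half plane in the direction transversal to the boundary.
\<close>

definition has_pd :: "'e::euclidean_space set \<Rightarrow> 'e \<Rightarrow> ('e \<Rightarrow> real) \<Rightarrow> 'e \<Rightarrow> bool" where
  "has_pd V b f x \<longleftrightarrow>
     (\<lambda>s. f (x + s *\<^sub>R b)) differentiable (at 0 within {s. x + s *\<^sub>R b \<in> V})"

definition pd :: "'e::euclidean_space set \<Rightarrow> 'e \<Rightarrow> ('e \<Rightarrow> real) \<Rightarrow> 'e \<Rightarrow> real" where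
  "pd V b f x =
     vector_derivative (\<lambda>s. f (x + s *\<^sub>R b)) (at 0 within {s. x + s *\<^sub>R b \<in> V})"

primrec Ck_on :: "nat \<Rightarrow> 'e::euclidean_space set \<Rightarrow> ('e \<Rightarrow> real) \<Rightarrow> bool" where
  "Ck_on 0 V f \<longleftrightarrow> continuous_on V f"
| "Ck_on (Suc k) V f \<longleftrightarrow> continuous_on V f \<and>
     (\<forall>b\<in>Basis. (\<forall>x\<in>V. has_pd V b f x) \<and> Ck_on k V (pd V b f))"

definition smooth_on :: "'e::euclidean_space set \<Rightarrow> ('e \<Rightarrow> real) \<Rightarrow> bool" where
  "smooth_on V f \<longleftrightarrow> (\<forall>k. Ck_on k V f)"

definition dt :: "real set \<Rightarrow> (real \<Rightarrow> real) \<Rightarrow> real \<Rightarrow> real" where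
  "dt I f t = vector_derivative f (at t within I)"

text \<open>Only the top-order seminorm is required: the lower-order derivatives are
  \<open>C\<^sup>1\<close>, hence Lipschitz on compact sets.\<close>

definition C2_holder :: "real \<Rightarrow> 'e::euclidean_space set \<Rightarrow> ('e \<Rightarrow> real) \<Rightarrow> bool" where
  "C2_holder \<alpha> V f \<longleftrightarrow> Ck_on 2 V f \<and>
     (\<forall>K. compact K \<and> K \<subseteq> V \<longrightarrow> (\<forall>b\<in>Basis. \<forall>b'\<in>Basis. \<exists>C. \<forall>x\<in>K. \<forall>y\<in>K.
        \<bar>pd V b' (pd V b f) x - pd V b' (pd V b f) y\<bar> \<le> C * dist x y powr \<alpha>))"

definition parabolic_holder_seminorm_finite ::
    "real \<Rightarrow> 'e::euclidean_space set \<Rightarrow> real set \<Rightarrow> ('e \<Rightarrow> real \<Rightarrow> real) \<Rightarrow> bool" where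
  "parabolic_holder_seminorm_finite \<alpha> K I w \<longleftrightarrow>
     (\<exists>C. \<forall>x\<in>K. \<forall>y\<in>K. \<forall>s\<in>I. \<forall>t\<in>I.
        \<bar>w x s - w y t\<bar> \<le> C * (dist x y powr \<alpha> + \<bar>s - t\<bar> powr (\<alpha> / 2)))"

text \<open>
  The space \<open>C\<^sup>2\<^sup>+\<^sup>\<alpha>\<^sup>,\<^sup>1\<^sup>+\<^sup>\<alpha>\<^sup>/\<^sup>2\<close> on \<open>V \<times> [0,T]\<close>, local in space: \<open>D\<^sup>2v\<close> and \<open>v\<^sub>t\<close> are
  Hoelder of exponent \<open>\<alpha>\<close> in space and \<open>\<alpha>/2\<close> in time, and \<open>Dv\<close> is Hoelder of exponent
  \<open>(1+\<alpha>)/2\<close> in time.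
\<close>

definition parabolic_C2_holder ::
    "real \<Rightarrow> 'e::euclidean_space set \<Rightarrow> real \<Rightarrow> ('e \<Rightarrow> real \<Rightarrow> real) \<Rightarrow> bool" where
  "parabolic_C2_holder \<alpha> V T v \<longleftrightarrow>
     (\<forall>t\<in>{0..T}. Ck_on 2 V (\<lambda>y. v y t)) \<and>
     (\<forall>x\<in>V. \<forall>t\<in>{0..T}. v x differentiable (at t within {0..T})) \<and>
     continuous_on (V \<times> {0..T}) (\<lambda>(x, t). v x t) \<and>
     continuous_on (V \<times> {0..T}) (\<lambda>(x, t). dt {0..T} (v x) t) \<and>
     (\<forall>b\<in>Basis. continuous_on (V \<times> {0..T}) (\<lambda>(x, t). pd V b (\<lambda>y. v y t) x) \<and>
        (\<forall>b'\<in>Basis. continuous_on (V \<times> {0..T})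
           (\<lambda>(x, t). pd V b' (pd V b (\<lambda>y. v y t)) x))) \<and>
     (\<forall>K. compact K \<and> K \<subseteq> V \<longrightarrow>
        parabolic_holder_seminorm_finite \<alpha> K {0..T} (\<lambda>x t. dt {0..T} (v x) t) \<and>
        (\<forall>b\<in>Basis.
           (\<exists>C. \<forall>x\<in>K. \<forall>s\<in>{0..T}. \<forall>t\<in>{0..T}.
              \<bar>pd V b (\<lambda>y. v y s) x - pd V b (\<lambda>y. v y t) x\<bar>
                \<le> C * \<bar>s - t\<bar> powr ((1 + \<alpha>) / 2)) \<and>
           (\<forall>b'\<in>Basis. parabolic_holder_seminorm_finite \<alpha> K {0..T}
              (\<lambda>x t. pd V b' (pd V b (\<lambda>y. v y t)) x))))"

section \<open>Compact Riemannian surfaces with boundary\<close>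

text \<open>
  A chart is a pair of a coordinate neighbourhood and a coordinate map into the closed half plane
  \<open>{x. x $ 2 \<ge> 0}\<close>. A Riemannian metric is given by its component matrix in every chart, as a
  function of the coordinates.
\<close>

type_synonym 'a chart = "'a set \<times> ('a \<Rightarrow> real^2)"

record 'a surface =
  surf_top :: "'a topology"
  surf_atlas :: "'a chart set"
  surf_metric :: "'a chart \<Rightarrow> real^2 \<Rightarrow> real^2^2"

definition half_plane :: "(real^2) set" where
  "half_plane = {x. 0 \<le> x $ 2}"

abbreviation chart_dom :: "'a chart \<Rightarrow> 'a set" where
  "chart_dom c \<equiv> fst c"

abbreviation chart_map :: "'a chart \<Rightarrow> 'a \<Rightarrow> real^2" where
  "chart_map c \<equiv> snd c"

definition chart_img :: "'a chart \<Rightarrow> (real^2) set" where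
  "chart_img c = chart_map c ` chart_dom c"

definition chart_inv :: "'a chart \<Rightarrow> real^2 \<Rightarrow> 'a" where
  "chart_inv c = inv_into (chart_dom c) (chart_map c)"

definition is_chart :: "'a topology \<Rightarrow> 'a chart \<Rightarrow> bool" where
  "is_chart X c \<longleftrightarrow> openin X (chart_dom c) \<and>
     openin (top_of_set half_plane) (chart_img c) \<and>
     homeomorphic_map (subtopology X (chart_dom c)) (top_of_set (chart_img c)) (chart_map c)"

definition overlap :: "'a chart \<Rightarrow> 'a chart \<Rightarrow> (real^2) set" where
  "overlap c c' = chart_map c ` (chart_dom c \<inter> chart_dom c')"

definition transition :: "'a chart \<Rightarrow> 'a chart \<Rightarrow> real^2 \<Rightarrow> real^2" where
  "transition c c' x = chart_map c' (chart_inv c x)"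

definition jacobian :: "'a chart \<Rightarrow> 'a chart \<Rightarrow> real^2 \<Rightarrow> real^2^2" where
  "jacobian c c' x = (\<chi> k i. pd (overlap c c') (axis i 1) (\<lambda>y. transition c c' y $ k) x)"

definition compact_riemannian_surface :: "'a surface \<Rightarrow> bool" where
  "compact_riemannian_surface S \<longleftrightarrow>
     compact_space (surf_top S) \<and> Hausdorff_space (surf_top S) \<and>
     (\<forall>c\<in>surf_atlas S. is_chart (surf_top S) c) \<and>
     (\<Union>c\<in>surf_atlas S. chart_dom c) = topspace (surf_top S) \<and>
     (\<forall>c\<in>surf_atlas S. \<forall>c'\<in>surf_atlas S. \<forall>k. smooth_on (overlap c c') (\<lambda>x. transition c c' x $ k)) \<and>
     (\<forall>c\<in>surf_atlas S. \<forall>i j. smooth_on (chart_img c) (\<lambda>x. surf_metric S c x $ i $ j)) \<and>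
     (\<forall>c\<in>surf_atlas S. \<forall>x\<in>chart_img c. transpose (surf_metric S c x) = surf_metric S c x \<and>
        (\<forall>v. v \<noteq> 0 \<longrightarrow> 0 < v \<bullet> (surf_metric S c x *v v))) \<and>
     (\<forall>c\<in>surf_atlas S. \<forall>c'\<in>surf_atlas S. \<forall>x\<in>overlap c c'.
        surf_metric S c x =
          transpose (jacobian c c' x) ** surf_metric S c' (transition c c' x) ** jacobian c c' x)"

definition bdry :: "'a surface \<Rightarrow> 'a set" where
  "bdry S = {p \<in> topspace (surf_top S).
     \<exists>c\<in>surf_atlas S. p \<in> chart_dom c \<and> chart_map c p $ 2 = 0}"

definition inter :: "'a surface \<Rightarrow> 'a set" where
  "inter S = topspace (surf_top S) - bdry S"

section \<open>Geometric operators\<close>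

text \<open>
  The operators below are first given by their expressions in a chart \<open>c\<close> at the coordinate point
  \<open>x\<close>, and then evaluated at a point \<open>p\<close> of the surface in an arbitrarily selected chart around
  \<open>p\<close>; their values do not depend on this selection.
\<close>

definition chart_at :: "'a surface \<Rightarrow> 'a \<Rightarrow> 'a chart" where
  "chart_at S p = (SOME c. c \<in> surf_atlas S \<and> p \<in> chart_dom c)"

abbreviation cpd :: "'a chart \<Rightarrow> 2 \<Rightarrow> (real^2 \<Rightarrow> real) \<Rightarrow> real^2 \<Rightarrow> real" where
  "cpd c i \<equiv> pd (chart_img c) (axis i 1)"

definition metric_inv :: "'a surface \<Rightarrow> 'a chart \<Rightarrow> real^2 \<Rightarrow> real^2^2" where
  "metric_inv S c x = matrix_inv (surf_metric S c x)"

definition christoffel :: "'a surface \<Rightarrow> 'a chart \<Rightarrow> 2 \<Rightarrow> 2 \<Rightarrow> 2 \<Rightarrow> real^2 \<Rightarrow> real" where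
  "christoffel S c k i j x = (1 / 2) * (\<Sum>l\<in>UNIV. metric_inv S c x $ k $ l *
     (cpd c i (\<lambda>y. surf_metric S c y $ j $ l) x + cpd c j (\<lambda>y. surf_metric S c y $ i $ l) x
        - cpd c l (\<lambda>y. surf_metric S c y $ i $ j) x))"

text \<open>\<open>R(\<partial>\<^sub>i, \<partial>\<^sub>j) \<partial>\<^sub>k = \<Sum>l. riemann S c l k i j * \<partial>\<^sub>l\<close> with
  \<open>R(X, Y) Z = \<nabla>\<^sub>X \<nabla>\<^sub>Y Z - \<nabla>\<^sub>Y \<nabla>\<^sub>X Z - \<nabla>\<^bsub>[X,Y]\<^esub> Z\<close>.\<close>

definition riemann :: "'a surface \<Rightarrow> 'a chart \<Rightarrow> 2 \<Rightarrow> 2 \<Rightarrow> 2 \<Rightarrow> 2 \<Rightarrow> real^2 \<Rightarrow> real" where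
  "riemann S c l k i j x =
     cpd c i (christoffel S c l j k) x - cpd c j (christoffel S c l i k) x +
     (\<Sum>m\<in>UNIV. christoffel S c l i m x * christoffel S c m j k x
             - christoffel S c l j m x * christoffel S c m i k x)"

text \<open>The sectional curvature \<open>g(R(\<partial>\<^sub>1, \<partial>\<^sub>2) \<partial>\<^sub>2, \<partial>\<^sub>1) / det g\<close>.\<close>

definition gauss_curvature :: "'a surface \<Rightarrow> 'a \<Rightarrow> real" where
  "gauss_curvature S p = (let c = chart_at S p; x = chart_map c p in
     (\<Sum>l\<in>UNIV. surf_metric S c x $ l $ 1 * riemann S c l 2 1 2 x) / det (surf_metric S c x))"

definition laplacian :: "'a surface \<Rightarrow> ('a \<Rightarrow> real) \<Rightarrow> 'a \<Rightarrow> real" where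
  "laplacian S f p = (let c = chart_at S p; x = chart_map c p in
     (\<Sum>i\<in>UNIV. cpd c i (\<lambda>y. sqrt (det (surf_metric S c y)) *
         (\<Sum>j\<in>UNIV. metric_inv S c y $ i $ j * cpd c j (f \<circ> chart_inv c) y)) x)
       / sqrt (det (surf_metric S c x)))"

text \<open>At a boundary point, \<open>\<partial>\<^sub>1\<close> is tangent to the boundary and the vectors with
  negative second component are the outward pointing ones.\<close>

definition outward_normal :: "'a surface \<Rightarrow> 'a chart \<Rightarrow> real^2 \<Rightarrow> real^2" where
  "outward_normal S c x = (THE n. n \<bullet> (surf_metric S c x *v axis 1 1) = 0 \<and>
     n \<bullet> (surf_metric S c x *v n) = 1 \<and> n $ 2 < 0)"

definition normal_derivative :: "'a surface \<Rightarrow> ('a \<Rightarrow> real) \<Rightarrow> 'a \<Rightarrow> real" where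
  "normal_derivative S f p = (let c = chart_at S p; x = chart_map c p in
     (\<Sum>i\<in>UNIV. outward_normal S c x $ i * cpd c i (f \<circ> chart_inv c) x))"

definition unit_tangent :: "'a surface \<Rightarrow> 'a chart \<Rightarrow> real^2 \<Rightarrow> real^2" where
  "unit_tangent S c x = (1 / sqrt (surf_metric S c x $ 1 $ 1)) *\<^sub>R axis 1 1"

text \<open>The covariant derivative \<open>\<nabla>\<^sub>\<tau> \<tau>\<close> of the unit tangent field \<open>\<tau>\<close> along the boundary.\<close>

definition tangent_acceleration :: "'a surface \<Rightarrow> 'a chart \<Rightarrow> real^2 \<Rightarrow> real^2" where
  "tangent_acceleration S c x = (\<chi> k.
     (\<Sum>i\<in>UNIV. unit_tangent S c x $ i * cpd c i (\<lambda>y. unit_tangent S c y $ k) x) +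
     (\<Sum>i\<in>UNIV. \<Sum>j\<in>UNIV.
        christoffel S c k i j x * unit_tangent S c x $ i * unit_tangent S c x $ j))"

text \<open>The sign is such that the Euclidean unit disk has boundary curvature \<open>1\<close>
  (there \<open>\<nabla>\<^sub>\<tau> \<tau> = - n\<close>).\<close>

definition geodesic_curvature :: "'a surface \<Rightarrow> 'a \<Rightarrow> real" where
  "geodesic_curvature S p = (let c = chart_at S p; x = chart_map c p in
     - (tangent_acceleration S c x \<bullet> (surf_metric S c x *v outward_normal S c x)))"

definition conformal :: "'a surface \<Rightarrow> ('a \<Rightarrow> real) \<Rightarrow> 'a surface" where
  "conformal S w =
     S\<lparr>surf_metric := \<lambda>c x. exp (2 * w (chart_inv c x)) *\<^sub>R surf_metric S c x\<rparr>"

section \<open>The Cauchy-Dirichlet problem\<close>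

definition holder_C2_surface :: "'a surface \<Rightarrow> real \<Rightarrow> ('a \<Rightarrow> real) \<Rightarrow> bool" where
  "holder_C2_surface S \<alpha> f \<longleftrightarrow>
     (\<forall>c\<in>surf_atlas S. C2_holder \<alpha> (chart_img c) (f \<circ> chart_inv c))"

definition parabolic_C2_surface ::
    "'a surface \<Rightarrow> real \<Rightarrow> real \<Rightarrow> ('a \<Rightarrow> real \<Rightarrow> real) \<Rightarrow> bool" where
  "parabolic_C2_surface S \<alpha> T u \<longleftrightarrow>
     (\<forall>c\<in>surf_atlas S. parabolic_C2_holder \<alpha> (chart_img c) T (u \<circ> chart_inv c))"

text \<open>The charts of the boundary curve are the restrictions of the charts of the surface, with the
  first coordinate as parameter.\<close>

definition parabolic_C2_bdry ::
    "'a surface \<Rightarrow> real \<Rightarrow> real \<Rightarrow> ('a \<Rightarrow> real \<Rightarrow> real) \<Rightarrow> bool" where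
  "parabolic_C2_bdry S \<alpha> T \<phi> \<longleftrightarrow>
     (\<forall>c\<in>surf_atlas S. parabolic_C2_holder \<alpha> {s::real. vector [s, 0] \<in> chart_img c} T
        (\<lambda>s. \<phi> (chart_inv c (vector [s, 0]))))"

definition low_speed :: "(real \<Rightarrow> real) \<Rightarrow> bool" where
  "low_speed \<xi> \<longleftrightarrow> (\<exists>\<xi>'.
     (\<forall>t\<ge>0. (\<xi> has_real_derivative \<xi>' t) (at t within {0..})) \<and> continuous_on {0..} \<xi>' \<and>
     (\<forall>t\<ge>0. 0 < \<xi> t) \<and> filterlim \<xi> at_top at_top \<and>
     (\<exists>T>0. \<exists>\<tau>. 0 < \<tau> \<and> \<tau> < 1 \<and> (\<forall>t\<ge>T. \<xi>' t \<le> \<tau>)))"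

definition flow_rhs :: "'a surface \<Rightarrow> ('a \<Rightarrow> real) \<Rightarrow> 'a \<Rightarrow> real" where
  "flow_rhs S w p = exp (- 2 * w p) * (laplacian S w p - gauss_curvature S p) - 1"

definition admissible_pair ::
    "'a surface \<Rightarrow> real \<Rightarrow> ('a \<Rightarrow> real) \<Rightarrow> ('a \<Rightarrow> real \<Rightarrow> real) \<Rightarrow> bool" where
  "admissible_pair S \<alpha> u0 \<phi> \<longleftrightarrow>
     holder_C2_surface S \<alpha> u0 \<and>
     (\<forall>T>0. parabolic_C2_bdry S \<alpha> T \<phi>) \<and>
     (\<forall>p\<in>bdry S. u0 p = \<phi> p 0 \<and> dt {0..} (\<phi> p) 0 = flow_rhs S u0 p) \<and>
     (\<exists>T>0. \<forall>p\<in>bdry S. \<forall>t\<ge>T. 0 \<le> dt {0..} (\<phi> p) t) \<and>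
     (\<exists>T1>0. \<exists>\<xi>. low_speed \<xi> \<and> (\<forall>p\<in>bdry S. \<forall>t\<ge>T1. ln (\<xi> t) \<le> \<phi> p t))"

definition cauchy_dirichlet_solution ::
    "'a surface \<Rightarrow> real \<Rightarrow> ('a \<Rightarrow> real) \<Rightarrow> ('a \<Rightarrow> real \<Rightarrow> real) \<Rightarrow> ('a \<Rightarrow> real \<Rightarrow> real) \<Rightarrow> bool" where
  "cauchy_dirichlet_solution S \<alpha> u0 \<phi> u \<longleftrightarrow>
     (\<forall>T>0. parabolic_C2_surface S \<alpha> T u) \<and>
     (\<forall>p\<in>inter S. \<forall>t\<ge>0. dt {0..} (u p) t = flow_rhs S (\<lambda>q. u q t) p) \<and>
     (\<forall>p\<in>bdry S. \<forall>t\<ge>0. u p t = \<phi> p t) \<and>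
     (\<forall>p\<in>inter S. u p 0 = u0 p)"

end

theory Submission
  imports Defs
begin

text \<open>
  Near a boundary point \<open>p\<close> the solution is squeezed between two barriers
  \<open>- ln (e\<^sup>-\<^sup>\<psi> + (1 \<plusminus> \<eta>) (l \<plusminus> Q / \<delta>)) \<plusminus> B F\<close>, where in a chart \<open>l\<close> is the distance to the boundary
      line
  and \<open>Q\<close> the squared distance to \<open>p\<close> for the metric frozen at \<open>p\<close>. Without the last term and for a
  constant metric, \<open>\<psi> = \<infinity>\<close> and \<open>\<eta> = 0\<close> these are the hyperbolic metrics of a
  disc inside and of the complement of a disc outside the half plane, both tangent to its
  boundary at \<open>p\<close>; the factor \<open>1 \<plusminus> \<eta>\<close> absorbs \<open>\<psi>'\<close> and the errors for small \<open>\<delta>\<close> and large \<open>t\<close>.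
  The subharmonic function \<open>F \<le> 0\<close> with \<open>F p = 0\<close> provides the ordering at the initial time and far
  from \<open>p\<close>, and contributes only \<open>O (B e\<^sup>-\<^sup>\<psi>)\<close> to \<open>e\<^sup>-\<^sup>u \<partial>u/\<partial>n\<close>. Both barriers agree with \<open>u = \<psi>\<close> at
      \<open>p\<close>, so they
  bound the normal derivative of \<open>u\<close> there. The comparison needs \<open>u \<le> \<psi>\<close> for large \<open>t\<close> and a lower
  bound for \<open>u\<close> uniform in time; the latter comes from a globally defined function with
  positive Laplacian.
\<close>

section \<open>Calculus on relatively open subsets of the half plane\<close>

text \<open>Since e^(-\<psi>) k_g tends to 0, the claim amounts to e^(-\<psi>) du/dn -> 1, a
  statement about a layer of width about e^(-\<psi>). Write s for the argument of the logarithm in a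
  barrier and h for s - e^(-\<psi>). The Laplacian of -ln s is (|grad h|^2 - s Lap h) / s^2, and for
  frozen coefficients |grad h|^2 - h Lap h is exactly (1 + \<sigma> \<eta>)^2, with \<sigma> = 1 for
  the lower and -1 for the upper barrier. The flow equation compares this with 1 plus the time
  derivative \<psi>' e^(-\<psi>) / s, which lies between 0 and \<psi>'; so the lower barrier needs
  \<psi>' < \<eta> and the upper one \<psi>' >= 0. Barriers that touch at one point only replace a
  smooth distance function and adapted coordinates; uniformity comes from constants shared by all p
  near a given boundary point. The lower bound for u can fail on components without boundary: on a
  flat closed one u = const - t solves the equation. The function with positive Laplacian is
  therefore sought on the components that meet the boundary, and is pieced together from local bumps
  by an open and closed argument.\<close>

abbreviation hp_open :: "(real^2) set \<Rightarrow> bool" where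
  "hp_open V \<equiv> openin (top_of_set half_plane) V"

lemma hp_openD:
  assumes "hp_open V" "x \<in> V"
  obtains r where "r > 0" "\<And>y. 0 \<le> y $ 2 \<Longrightarrow> dist y x < r \<Longrightarrow> y \<in> V"
  using assms unfolding openin_euclidean_subtopology_iff half_plane_def by fastforce

lemma hp_open_nonneg: "hp_open V \<Longrightarrow> x \<in> V \<Longrightarrow> 0 \<le> x $ 2"
  unfolding openin_euclidean_subtopology_iff half_plane_def by auto

lemma inner_real2: "(x::real^2) \<bullet> y = x $ 1 * y $ 1 + x $ 2 * y $ 2"
  by (simp add: inner_vec_def sum_2)

lemma axis_real2 [simp]:
  "(axis 1 1 :: real^2) $ 1 = 1" "(axis 1 1 :: real^2) $ 2 = 0"
  "(axis 2 1 :: real^2) $ 1 = 0" "(axis 2 1 :: real^2) $ 2 = 1"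
  by (simp_all add: axis_def)

lemma Basis_real2: "(Basis :: (real^2) set) = {axis 1 1, axis 2 1}"
  by (auto simp: Basis_vec_def UNIV_2)

lemma axis_nonneg: "0 \<le> (axis i (1::real)) $ (j::2)"
  by (simp add: axis_def)

text \<open>At a boundary point the line in direction 2 meets \<open>V\<close> on one side only. A
  non-trivial filter is what makes the derivative unique, so that \<open>pd\<close> has the expected
  value there; the half interval \<open>{0..<r}\<close> serves both directions because basis vectors
  have non-negative components.\<close>

lemma line_nontrivial:
  assumes "hp_open V" "x \<in> V"
  shows "at 0 within {s. x + s *\<^sub>R axis i 1 \<in> V} \<noteq> bot"
proof -
  obtain r where r: "r > 0" "\<And>y. 0 \<le> y $ 2 \<Longrightarrow> dist y x < r \<Longrightarrow> y \<in> V"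
    using hp_openD[OF assms] by blast
  have "0 \<le> x $ 2" using hp_open_nonneg assms by blast
  then have sub: "{0..<r} \<subseteq> {s. x + s *\<^sub>R axis i 1 \<in> V}"
    by (auto intro!: r(2) simp: dist_norm axis_nonneg)
  have "(0::real) islimpt {0<..<r}" using r(1) by (simp add: islimpt_greaterThanLessThan1)
  then have "(0::real) islimpt {s. x + s *\<^sub>R axis i 1 \<in> V}"
    by (rule islimpt_subset) (use sub in \<open>auto intro!: order_trans[OF _ sub]\<close>)
  then show ?thesis by (simp add: trivial_limit_within)
qed

lemma has_derivative_pd:
  assumes V: "hp_open V" "x \<in> V" and d: "(f has_derivative D) (at x within V)"
  shows "has_pd V (axis i 1) f x" "pd V (axis i 1) f x = D (axis i 1)"
proof -
  let ?b = "axis i 1 :: real^2" and ?A = "{s. x + s *\<^sub>R axis i 1 \<in> V}"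
  have 1: "((\<lambda>s. x + s *\<^sub>R ?b) has_derivative (\<lambda>s. s *\<^sub>R ?b)) (at 0 within ?A)"
    by (auto intro!: derivative_eq_intros)
  have 2: "(f has_derivative D) (at (x + 0 *\<^sub>R ?b) within (\<lambda>s. x + s *\<^sub>R ?b) ` ?A)"
    using d by (auto intro: has_derivative_subset)
  have "((\<lambda>s. f (x + s *\<^sub>R ?b)) has_derivative (\<lambda>s. D (s *\<^sub>R ?b))) (at 0 within ?A)"
    using has_derivative_in_compose[OF 1 2] .
  moreover have "(\<lambda>s. D (s *\<^sub>R ?b)) = (\<lambda>s. s *\<^sub>R D ?b)"
    using has_derivative_linear[OF d] by (simp add: linear_cmul)
  ultimately have v: "((\<lambda>s. f (x + s *\<^sub>R ?b)) has_vector_derivative D ?b) (at 0 within ?A)"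
    by (simp add: has_vector_derivative_def)
  then show "has_pd V ?b f x" unfolding has_pd_def
    by (auto simp: has_vector_derivative_def differentiable_def)
  show "pd V ?b f x = D ?b" unfolding pd_def
    using v vector_derivative_within line_nontrivial[OF V] by blast
qed

lemma vector2_eta: "vector [x $ 1, x $ 2] = (x :: real^2)"
  by (simp add: vec_eq_iff forall_2)

text \<open>\<open>has_derivative_partialsI\<close> wants one partial derivative at the point itself
  and the other one continuous nearby, hence continuity of the second partial only. It works on a
  product \<open>X \<times> Y\<close> with \<open>Y\<close> convex; cutting \<open>Y\<close> off at
  0 makes the same argument cover boundary points.\<close>

lemma C1_imp_has_derivative:
  assumes V: "hp_open V" and x: "x \<in> V"
    and pd: "\<And>i y. y \<in> V \<Longrightarrow> has_pd V (axis i 1) f y"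
    and cont: "continuous_on V (pd V (axis 2 1) f)"
  shows "(f has_derivative (\<lambda>h. (\<chi> i. pd V (axis i 1) f x) \<bullet> h)) (at x within V)"
proof -
  obtain r where r: "r > 0" "\<And>y. 0 \<le> y $ 2 \<Longrightarrow> dist y x < r \<Longrightarrow> y \<in> V"
    using hp_openD[OF V x] by blast
  define X where "X = {x $ 1 - r/2 <..< x $ 1 + r/2}"
  define Y where "Y = {0..} \<inter> {x $ 2 - r/2 <..< x $ 2 + r/2}"
  have inV: "vector [a, b] \<in> V" if "a \<in> X" "b \<in> Y" for a b
  proof (rule r(2))
    show "0 \<le> (vector [a, b] :: real^2) $ 2" using that by (simp add: Y_def)
    have "dist (vector [a, b]) x \<le> \<bar>a - x $ 1\<bar> + \<bar>b - x $ 2\<bar>"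
      using norm_le_l1_cart[of "vector [a, b] - x"] by (simp add: dist_norm sum_2)
    also have "\<dots> < r/2 + r/2" 
      by (rule add_strict_mono) (use that in \<open>auto simp: X_def Y_def abs_if\<close>)
    finally show "dist (vector [a, b]) x < r" by simp
  qed
  define F where "F = (\<lambda>a b. f (vector [a, b]))"
  define P where "P = (\<lambda>i. pd V (axis i 1) f)"
  have shift1: "vector [a, b] + s *\<^sub>R axis 1 1 = (vector [a + s, b] :: real^2)"
   and shift2: "vector [a, b] + s *\<^sub>R axis 2 1 = (vector [a, b + s] :: real^2)" for a b s :: real
    by (simp_all add: vec_eq_iff forall_2)
  have vd: "((\<lambda>s. f (y + s *\<^sub>R axis i 1)) has_derivative (\<lambda>s. s * P i y))
              (at 0 within {s. y + s *\<^sub>R axis i 1 \<in> V})" if "y \<in> V" for y i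
    using pd[OF that, of i] vector_derivative_works[of "\<lambda>s. f (y + s *\<^sub>R axis i 1)"]
    unfolding has_pd_def P_def pd_def has_vector_derivative_def by simp
  have x12: "x $ 1 \<in> X" "x $ 2 \<in> Y" using r hp_open_nonneg[OF V x] by (auto simp: X_def Y_def)
  have fx: "((\<lambda>a. F a (x $ 2)) has_derivative (\<lambda>h. h * P 1 x)) (at (x $ 1) within X)"
  proof -
    have 1: "((\<lambda>a. a - x $ 1) has_derivative (\<lambda>h. h)) (at (x $ 1) within X)"
      by (auto intro!: derivative_eq_intros)
    have "((\<lambda>s. f (x + s *\<^sub>R axis 1 1)) has_derivative (\<lambda>s. s * P 1 x))
              (at (x $ 1 - x $ 1) within (\<lambda>a. a - x $ 1) ` X)"
      apply (simp, rule has_derivative_subset[OF vd[OF x]])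
      using inV[OF _ x12(2)] shift1[of "x $ 1" "x $ 2"] by (auto simp: vector2_eta)
    from has_derivative_in_compose[OF 1 this]
    show ?thesis using shift1[of "x $ 1" "x $ 2"] by (simp add: F_def vector2_eta)
  qed
  have fy: "((\<lambda>b. F a b) has_derivative blinfun_apply (blinfun_mult_left (P 2 (vector [a, b])))) (at
      b within Y)"
    if "a \<in> X" "b \<in> Y" for a b
  proof -
    have 1: "((\<lambda>c. c - b) has_derivative (\<lambda>h. h)) (at b within Y)"
      by (auto intro!: derivative_eq_intros)
    have "((\<lambda>s. f (vector [a, b] + s *\<^sub>R axis 2 1)) has_derivative (\<lambda>s. s * P 2 (vector [a, b])))
              (at (b - b) within (\<lambda>c. c - b) ` Y)"
      apply (simp, rule has_derivative_subset[OF vd[OF inV[OF that]]])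
      using inV[OF that(1)] by (auto simp: shift2)
    from has_derivative_in_compose[OF 1 this]
    show ?thesis by (simp add: F_def shift2 mult.commute)
  qed
  have "((\<lambda>z. P 2 (vector [fst z, snd z])) \<longlongrightarrow> P 2 (vector [x $ 1, x $ 2])) (at (x $ 1, x $ 2) within
      X \<times> Y)"
  proof -
    have "continuous_on (X \<times> Y) (\<lambda>z. P 2 (vector [fst z, snd z]))"
    proof (rule continuous_on_compose2[of V "P 2"])
      have "vector [a, b] = (a *\<^sub>R axis 1 1 + b *\<^sub>R axis 2 1 :: real^2)" for a b
        by (simp add: vec_eq_iff forall_2)
      then show "continuous_on (X \<times> Y) (\<lambda>z. vector [fst z, snd z] :: real^2)"
        by (auto intro!: continuous_intros)
    qed (use inV cont in \<open>auto simp: P_def\<close>)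
    then show ?thesis using x12 unfolding continuous_on_def by auto
  qed
  then have fyc: "continuous (at (x $ 1, x $ 2) within X \<times> Y) (\<lambda>(a, b). blinfun_mult_left (P 2
      (vector [a, b])))"
    unfolding continuous_within
    using bounded_linear.tendsto[OF bounded_linear_blinfun_mult_left] by (simp add:
        case_prod_unfold)
  have cvx: "convex Y" unfolding Y_def by (intro convex_Int) auto
  note D = has_derivative_partialsI[OF fx fy fyc x12(2) cvx]
  define W where "W = {z::real^2. z $ 1 \<in> X \<and> z $ 2 \<in> Y}"
  have 1: "((\<lambda>z. (z $ 1, z $ 2)) has_derivative (\<lambda>h. (h $ 1, h $ 2))) (at x within W)"
    by (intro has_derivative_Pair bounded_linear.has_derivative[OF bounded_linear_vec_nth]
        has_derivative_ident)
  have "((\<lambda>z. F (z $ 1) (z $ 2)) has_derivative (\<lambda>h. h $ 1 * P 1 x + P 2 x * h $ 2)) (at x within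
      W)"
    using has_derivative_in_compose[OF 1 has_derivative_subset[OF D]]
    by (force simp: W_def vector2_eta mult.commute)
  then have "(f has_derivative (\<lambda>h. (\<chi> i. P i x) \<bullet> h)) (at x within W)"
    by (simp add: F_def vector2_eta inner_real2 mult.commute)
  moreover have "at x within W = at x within V"
  proof (rule at_within_nhd[of _ "ball x (r/2)"])
    have c1: "\<bar>z $ i - x $ i\<bar> < r/2" if "dist x z < r/2" for z i
      using component_le_norm_cart[of "z - x" i] that by (simp add: dist_norm norm_minus_commute)
    have c2: "z $ 1 \<in> X \<and> z $ 2 \<in> Y" if "dist x z < r/2" "z \<in> V" for z
      using c1[OF that(1), of 1] c1[OF that(1), of 2] hp_open_nonneg[OF V that(2)]
      by (auto simp: X_def Y_def abs_if split: if_splits)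
    have c3: "z \<in> V" if "z \<in> W" for z
      using inV[of "z $ 1" "z $ 2"] that by (simp add: W_def vector2_eta)
    show "W \<inter> ball x (r / 2) - {x} = V \<inter> ball x (r / 2) - {x}"
    proof (intro equalityI subsetI)
      fix z assume z: "z \<in> W \<inter> ball x (r / 2) - {x}"
      then show "z \<in> V \<inter> ball x (r / 2) - {x}" using c3[of z] by blast
    next
      fix z assume z: "z \<in> V \<inter> ball x (r / 2) - {x}"
      then show "z \<in> W \<inter> ball x (r / 2) - {x}" using c2[of z] unfolding W_def by simp
    qed
  qed (use r in auto)
  ultimately show ?thesis by (simp add: P_def)
qed

section \<open>Closure properties of \<open>Ck_on\<close>\<close>

lemma Ck_on_imp_continuous: "Ck_on k V f \<Longrightarrow> continuous_on V f"
  by (cases k) auto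

lemma Ball_Basis_real2: "(\<forall>b\<in>(Basis :: (real^2) set). P b) \<longleftrightarrow> (\<forall>i. P (axis i 1))"
  by (simp add: Basis_real2 forall_2)

lemma has_pd_cong:
  assumes "x \<in> V" "\<And>y. y \<in> V \<Longrightarrow> f y = g y"
  shows "has_pd V b f x \<longleftrightarrow> has_pd V b g x" "pd V b f x = pd V b g x"
proof -
  have *: "((\<lambda>s. f (x + s *\<^sub>R b)) has_vector_derivative D) (at 0 within {s. x + s *\<^sub>R b \<in> V}) \<longleftrightarrow>
        ((\<lambda>s. g (x + s *\<^sub>R b)) has_vector_derivative D) (at 0 within {s. x + s *\<^sub>R b \<in> V})" for D
    unfolding has_vector_derivative_def
    by (rule iffI; erule has_derivative_transform[rotated 2]) (use assms in auto)
  show "has_pd V b f x \<longleftrightarrow> has_pd V b g x"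
    unfolding has_pd_def vector_derivative_works
    by (metis * differentiableI_vector vector_derivative_works)
  show "pd V b f x = pd V b g x"
    unfolding pd_def vector_derivative_def by (simp add: *)
qed

lemma Ck_on_cong:
  assumes "\<And>y. y \<in> V \<Longrightarrow> f y = g y"
  shows "Ck_on k V f \<longleftrightarrow> Ck_on k V g"
  using assms
proof (induction k arbitrary: f g)
  case 0
  then show ?case by (simp cong: continuous_on_cong)
next
  case (Suc k)
  have "Ck_on k V (pd V b f) \<longleftrightarrow> Ck_on k V (pd V b g)" for b
    by (rule Suc.IH) (simp add: has_pd_cong(2)[OF _ Suc.prems])
  moreover have "has_pd V b f x \<longleftrightarrow> has_pd V b g x" if "x \<in> V" for b x
    by (rule has_pd_cong(1)[OF that Suc.prems])
  moreover have "continuous_on V f \<longleftrightarrow> continuous_on V g"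
    by (rule continuous_on_cong) (use Suc.prems in auto)
  ultimately show ?case by auto
qed

lemma Ck_on_mono: "Ck_on k V f \<Longrightarrow> j \<le> k \<Longrightarrow> Ck_on j V f"
proof (induction k arbitrary: f j)
  case (Suc k)
  show ?case
  proof (cases j)
    case 0 with Suc.prems show ?thesis by simp
  next
    case (Suc i) with Suc.prems Suc.IH show ?thesis by auto
  qed
qed simp

lemma Ck_on_SucD: "Ck_on (Suc k) V f \<Longrightarrow> Ck_on k V f"
  by (erule Ck_on_mono) simp

lemma Ck_on_has_derivative:
  assumes V: "hp_open V" "x \<in> V" and f: "Ck_on (Suc k) V f"
  shows "(f has_derivative (\<lambda>h. (\<chi> i. pd V (axis i 1) f x) \<bullet> h)) (at x within V)"
  by (rule C1_imp_has_derivative[OF V])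
    (use f Ck_on_imp_continuous in \<open>auto simp: Ball_Basis_real2\<close>)

text \<open>With the elimination form \<open>Ck_on_SucE\<close>, closure properties go by induction
  on \<open>k\<close> using any pair of components of the total derivative, instead of
  \<open>pd\<close> terms that would have to be rewritten under \<open>Ck_on\<close>.\<close>

lemma Ck_on_SucI:
  assumes V: "hp_open V"
    and d: "\<And>x. x \<in> V \<Longrightarrow> (f has_derivative (\<lambda>h. f1 x * h $ 1 + f2 x * h $ 2)) (at x within V)"
    and c: "Ck_on k V f1" "Ck_on k V f2"
  shows "Ck_on (Suc k) V f"
proof -
  have "Ck_on k V (pd V (axis i 1) f) \<longleftrightarrow> Ck_on k V (if i = 1 then f1 else f2)" for i
    by (rule Ck_on_cong) (use exhaust_2[of i] in \<open>auto simp: has_derivative_pd(2)[OF V _ d]\<close>)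
  then have "Ck_on k V (pd V (axis i 1) f)" for i using c by simp
  moreover have "continuous_on V f"
    using d by (auto intro!: has_derivative_continuous simp: continuous_on_eq_continuous_within)
  ultimately show ?thesis
    by (auto simp: Ball_Basis_real2 intro: has_derivative_pd(1)[OF V _ d])
qed

lemma Ck_on_SucE:
  assumes "hp_open V" and "Ck_on (Suc k) V f"
  obtains f1 f2 where
    "\<And>x. x \<in> V \<Longrightarrow> (f has_derivative (\<lambda>h. f1 x * h $ 1 + f2 x * h $ 2)) (at x within V)"
    "Ck_on k V f1" "Ck_on k V f2"
proof (rule that)
  show "(f has_derivative (\<lambda>h. pd V (axis 1 1) f x * h $ 1 + pd V (axis 2 1) f x * h $ 2)) (at x
      within V)"
    if "x \<in> V" for x
    using Ck_on_has_derivative[OF assms(1) that assms(2)] by (simp add: inner_real2)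
qed (use assms(2) in \<open>auto simp: Ball_Basis_real2\<close>)

lemma Ck_on_const [simp]: "hp_open V \<Longrightarrow> Ck_on k V (\<lambda>x. c)"
proof (induction k arbitrary: c)
  case (Suc k)
  show ?case
    by (rule Ck_on_SucI[of V _ "\<lambda>x. 0" "\<lambda>x. 0"]) (use Suc in auto)
qed simp

lemma Ck_on_nth [simp]: "hp_open V \<Longrightarrow> Ck_on k V (\<lambda>x. x $ i)"
proof (cases k)
  case 0 then show ?thesis by (auto intro!: continuous_intros)
next
  case (Suc j)
  assume V: "hp_open V"
  have "((\<lambda>x. x $ i) has_derivative (\<lambda>h. (if i = 1 then 1 else 0) * h $ 1 + (if i = 2 then 1 else 0)
      * h $ 2)) (at x within V)" for x
    using exhaust_2[of i]
    by (auto intro!: bounded_linear_imp_has_derivative bounded_linear_vec_nth)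
  from Ck_on_SucI[OF V this] V show ?thesis unfolding Suc by simp
qed

lemma Ck_on_add:
  "hp_open V \<Longrightarrow> Ck_on k V f \<Longrightarrow> Ck_on k V g \<Longrightarrow> Ck_on k V (\<lambda>x. f x + g x)"
proof (induction k arbitrary: f g)
  case 0 then show ?case by (auto intro: continuous_intros)
next
  case (Suc k)
  obtain f1 f2 where f: "\<And>x. x \<in> V \<Longrightarrow> (f has_derivative (\<lambda>h. f1 x * h $ 1 + f2 x * h $ 2)) (at x
      within V)"
    "Ck_on k V f1" "Ck_on k V f2" by (rule Ck_on_SucE[OF Suc.prems(1,2)]) (rule that, assumption+)
  obtain g1 g2 where g: "\<And>x. x \<in> V \<Longrightarrow> (g has_derivative (\<lambda>h. g1 x * h $ 1 + g2 x * h $ 2)) (at x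
      within V)"
    "Ck_on k V g1" "Ck_on k V g2" by (rule Ck_on_SucE[OF Suc.prems(1,3)]) (rule that, assumption+)
  show ?case
  proof (rule Ck_on_SucI[OF Suc.prems(1)])
    show "((\<lambda>x. f x + g x) has_derivative (\<lambda>h. (f1 x + g1 x) * h $ 1 + (f2 x + g2 x) * h $ 2)) (at x
        within V)"
      if "x \<in> V" for x
      by (rule has_derivative_eq_rhs[OF has_derivative_add[OF f(1) g(1)]]) (use that in \<open>auto simp:
          algebra_simps\<close>)
  qed (use Suc f g in auto)
qed

lemma Ck_on_mult:
  "hp_open V \<Longrightarrow> Ck_on k V f \<Longrightarrow> Ck_on k V g \<Longrightarrow> Ck_on k V (\<lambda>x. f x * g x)"
proof (induction k arbitrary: f g)
  case 0 then show ?case by (auto intro: continuous_intros)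
next
  case (Suc k)
  obtain f1 f2 where f: "\<And>x. x \<in> V \<Longrightarrow> (f has_derivative (\<lambda>h. f1 x * h $ 1 + f2 x * h $ 2)) (at x
      within V)"
    "Ck_on k V f1" "Ck_on k V f2" by (rule Ck_on_SucE[OF Suc.prems(1,2)]) (rule that, assumption+)
  obtain g1 g2 where g: "\<And>x. x \<in> V \<Longrightarrow> (g has_derivative (\<lambda>h. g1 x * h $ 1 + g2 x * h $ 2)) (at x
      within V)"
    "Ck_on k V g1" "Ck_on k V g2" by (rule Ck_on_SucE[OF Suc.prems(1,3)]) (rule that, assumption+)
  have fg: "Ck_on k V f" "Ck_on k V g" using Suc.prems by (auto intro: Ck_on_SucD simp del:
      Ck_on.simps)
  show ?case
  proof (rule Ck_on_SucI[OF Suc.prems(1)])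
    show "((\<lambda>x. f x * g x) has_derivative (\<lambda>h. (f x * g1 x + f1 x * g x) * h $ 1 + (f x * g2 x + f2
        x * g x) * h $ 2)) (at x within V)"
      if "x \<in> V" for x
      by (rule has_derivative_eq_rhs[OF has_derivative_mult[OF f(1) g(1)]]) (use that in \<open>auto simp:
          algebra_simps\<close>)
  qed (use Suc f g fg Ck_on_add in auto)
qed

lemma Ck_on_cmult: "hp_open V \<Longrightarrow> Ck_on k V f \<Longrightarrow> Ck_on k V (\<lambda>x. c * f x)"
  by (intro Ck_on_mult Ck_on_const)

lemma Ck_on_diff:
  "hp_open V \<Longrightarrow> Ck_on k V f \<Longrightarrow> Ck_on k V g \<Longrightarrow> Ck_on k V (\<lambda>x. f x - g x)"
  using Ck_on_add[of V k f "\<lambda>x. (-1) * g x"] Ck_on_cmult[of V k g "-1"] by simp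

lemma Ck_on_minus: "hp_open V \<Longrightarrow> Ck_on k V f \<Longrightarrow> Ck_on k V (\<lambda>x. - f x)"
  using Ck_on_cmult[of V k f "-1"] by simp

lemma Ck_on_inverse:
  assumes "hp_open V" "Ck_on k V f" "\<And>x. x \<in> V \<Longrightarrow> f x \<noteq> 0"
  shows "Ck_on k V (\<lambda>x. inverse (f x))"
  using assms
proof (induction k)
  case 0 then show ?case by (auto intro!: continuous_intros)
next
  case (Suc k)
  obtain f1 f2 where f: "\<And>x. x \<in> V \<Longrightarrow> (f has_derivative (\<lambda>h. f1 x * h $ 1 + f2 x * h $ 2)) (at x
      within V)"
    "Ck_on k V f1" "Ck_on k V f2" by (rule Ck_on_SucE[OF Suc.prems(1,2)]) (rule that, assumption+)
  have fk: "Ck_on k V (\<lambda>x. inverse (f x))" by (rule Suc.IH[OF Suc.prems(1) Ck_on_SucD[OF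
      Suc.prems(2)]]) (use Suc.prems in auto)
  show ?case
  proof (rule Ck_on_SucI[OF Suc.prems(1)])
    show "((\<lambda>x. inverse (f x)) has_derivative (\<lambda>h. (- (inverse (f x) * inverse (f x)) * f1 x) * h $
        1 + (- (inverse (f x) * inverse (f x)) * f2 x) * h $ 2)) (at x within V)"
      if "x \<in> V" for x
      by (rule has_derivative_eq_rhs[OF Deriv.has_derivative_inverse[OF _ f(1)]]) (use that
          Suc.prems in \<open>auto simp: algebra_simps\<close>)
  qed (use Suc f fk in \<open>auto intro!: Ck_on_mult Ck_on_minus\<close>)
qed

lemma Ck_on_divide:
  assumes "hp_open V" "Ck_on k V f" "Ck_on k V g" "\<And>x. x \<in> V \<Longrightarrow> g x \<noteq> 0"
  shows "Ck_on k V (\<lambda>x. f x / g x)"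
  unfolding divide_inverse by (intro Ck_on_mult Ck_on_inverse assms)

lemma Ck_on_sqrt:
  assumes "hp_open V" "Ck_on k V f" "\<And>x. x \<in> V \<Longrightarrow> 0 < f x"
  shows "Ck_on k V (\<lambda>x. sqrt (f x))"
  using assms
proof (induction k)
  case 0 then show ?case by (auto intro!: continuous_intros)
next
  case (Suc k)
  obtain f1 f2 where f: "\<And>x. x \<in> V \<Longrightarrow> (f has_derivative (\<lambda>h. f1 x * h $ 1 + f2 x * h $ 2)) (at x
      within V)"
    "Ck_on k V f1" "Ck_on k V f2" by (rule Ck_on_SucE[OF Suc.prems(1,2)]) (rule that, assumption+)
  have "Ck_on k V (\<lambda>x. sqrt (f x))" by (rule Suc.IH[OF Suc.prems(1) Ck_on_SucD[OF Suc.prems(2)]])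
      (use Suc.prems in auto)
  then have fk: "Ck_on k V (\<lambda>x. inverse (sqrt (f x)))"
    by (rule Ck_on_inverse[OF Suc.prems(1)]) (use Suc.prems in force)
  show ?case
  proof (rule Ck_on_SucI[OF Suc.prems(1)])
    show "((\<lambda>x. sqrt (f x)) has_derivative (\<lambda>h. (1/2 * inverse (sqrt (f x)) * f1 x) * h $ 1 + (1/2 *
        inverse (sqrt (f x)) * f2 x) * h $ 2)) (at x within V)"
      if "x \<in> V" for x
      by (rule has_derivative_eq_rhs[OF has_derivative_real_sqrt[OF _ f(1)]])
        (use that Suc.prems in \<open>auto simp: algebra_simps add_divide_distrib\<close>)
  qed (intro Ck_on_mult Ck_on_const f fk Suc.prems)+
qed

section \<open>Locality of differentiability, and composition\<close>

lemma hp_open_at_within: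
  assumes "hp_open U" "hp_open V" "x \<in> U" "x \<in> V"
  shows "at x within U = at x within V"
proof -
  obtain r where r: "r > 0" "\<And>y. 0 \<le> y $ 2 \<Longrightarrow> dist y x < r \<Longrightarrow> y \<in> U" using hp_openD[OF assms(1)
      assms(3)] by blast
  obtain q where q: "q > 0" "\<And>y. 0 \<le> y $ 2 \<Longrightarrow> dist y x < q \<Longrightarrow> y \<in> V" using hp_openD[OF assms(2)
      assms(4)] by blast
  show ?thesis
  proof (rule at_within_nhd[of _ "ball x (min r q)"])
    show "U \<inter> ball x (min r q) - {x} = V \<inter> ball x (min r q) - {x}"
    proof (intro equalityI subsetI)
      fix z assume "z \<in> U \<inter> ball x (min r q) - {x}"
      then show "z \<in> V \<inter> ball x (min r q) - {x}"
        using q(2)[of z] hp_open_nonneg[OF assms(1), of z] by (simp add: dist_commute)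
    next
      fix z assume "z \<in> V \<inter> ball x (min r q) - {x}"
      then show "z \<in> U \<inter> ball x (min r q) - {x}"
        using r(2)[of z] hp_open_nonneg[OF assms(2), of z] by (simp add: dist_commute)
    qed
  qed (use r q in auto)
qed

lemma pd_hp_open:
  assumes "hp_open U" "hp_open V" "U \<subseteq> V" "x \<in> U" 
  shows "has_pd U (axis i 1) f x \<longleftrightarrow> has_pd V (axis i 1) f x"
    "pd U (axis i 1) f x = pd V (axis i 1) f x"
proof -
  obtain r where r: "r > 0" "\<And>y. 0 \<le> y $ 2 \<Longrightarrow> dist y x < r \<Longrightarrow> y \<in> U" using hp_openD[OF assms(1)
      assms(4)] by blast
  have "x + s *\<^sub>R axis i 1 \<in> U" if "x + s *\<^sub>R axis i 1 \<in> V" "\<bar>s\<bar> < r" for s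
    by (rule r(2)) (use that hp_open_nonneg[OF assms(2) that(1)] in \<open>simp_all add: dist_norm\<close>)
  then have "{s. x + s *\<^sub>R axis i 1 \<in> U} \<inter> ball 0 r - {0} = {s. x + s *\<^sub>R axis i 1 \<in> V} \<inter> ball 0 r -
      {0}"
    using assms(3) by (auto simp: dist_real_def)
  then have "at 0 within {s. x + s *\<^sub>R axis i 1 \<in> U} = at 0 within {s. x + s *\<^sub>R axis i 1 \<in> V}"
    using r(1) by (intro at_within_nhd[of _ "ball 0 r"]) auto
  then show "has_pd U (axis i 1) f x \<longleftrightarrow> has_pd V (axis i 1) f x"
    "pd U (axis i 1) f x = pd V (axis i 1) f x"
    by (simp_all add: has_pd_def pd_def)
qed

lemma Ck_on_subset:
  assumes "hp_open U" "hp_open V" "U \<subseteq> V" "Ck_on k V f"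
  shows "Ck_on k U f"
  using assms(4)
proof (induction k arbitrary: f)
  case 0 then show ?case using assms continuous_on_subset by auto
next
  case (Suc k)
  have "Ck_on k U (pd U (axis i 1) f)" for i
    using Suc Ck_on_cong[of U "pd U (axis i 1) f" "pd V (axis i 1) f"] pd_hp_open(2)[OF assms(1-3)]
    by (auto simp: Ball_Basis_real2)
  then show ?case using Suc assms continuous_on_subset pd_hp_open(1)[OF assms(1-3)]
    by (auto simp: Ball_Basis_real2)
qed

text \<open>Needed for gluing: a function given by different formulas on different relatively open
  pieces, such as a bump extended by zero, is handled piece by piece.\<close>

lemma Ck_on_local:
  assumes "hp_open V" "\<And>x. x \<in> V \<Longrightarrow> \<exists>U. hp_open U \<and> U \<subseteq> V \<and> x \<in> U \<and> Ck_on k U f"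
  shows "Ck_on k V f"
  using assms(2)
proof (induction k arbitrary: f)
  case 0
  show ?case unfolding Ck_on.simps continuous_on_eq_continuous_within
  proof
    fix x assume x: "x \<in> V"
    then obtain U where "hp_open U" "U \<subseteq> V" "x \<in> U" "continuous_on U f" using 0[OF x] by auto
    then show "continuous (at x within V) f"
      using hp_open_at_within[OF _ assms(1) _ x] by (metis continuous_on_eq_continuous_within)
  qed
next
  case (Suc k)
  have "continuous_on V f" unfolding continuous_on_eq_continuous_within
  proof
    fix x assume x: "x \<in> V"
    then obtain U where "hp_open U" "U \<subseteq> V" "x \<in> U" "continuous_on U f" using Suc.prems[OF x] by
        auto
    then show "continuous (at x within V) f"
      using hp_open_at_within[OF _ assms(1) _ x] by (metis continuous_on_eq_continuous_within)
  qed
  moreover have "has_pd V (axis i 1) f x" if x: "x \<in> V" for i x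
  proof -
    obtain U where "hp_open U" "U \<subseteq> V" "x \<in> U" "Ck_on (Suc k) U f" using Suc.prems x by blast
    then show ?thesis using pd_hp_open(1)[OF _ assms(1)] by (auto simp: Ball_Basis_real2)
  qed
  moreover have "Ck_on k V (pd V (axis i 1) f)" for i
  proof (rule Suc.IH)
    fix x assume x: "x \<in> V"
    obtain U where U: "hp_open U" "U \<subseteq> V" "x \<in> U" "Ck_on (Suc k) U f" using Suc.prems x by blast
    have "Ck_on k U (pd U (axis i 1) f)" using U(4) by (simp add: Ball_Basis_real2)
    moreover have "Ck_on k U (pd U (axis i 1) f) \<longleftrightarrow> Ck_on k U (pd V (axis i 1) f)"
      by (rule Ck_on_cong) (rule pd_hp_open(2)[OF U(1) assms(1) U(2)])
    ultimately show "\<exists>U. hp_open U \<and> U \<subseteq> V \<and> x \<in> U \<and> Ck_on k U (pd V (axis i 1) f)"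
      using U by blast
  qed
  ultimately show ?case by (simp add: Ball_Basis_real2)
qed

lemma Ck_on_compose:
  assumes "hp_open U" "hp_open V" "\<And>x. x \<in> U \<Longrightarrow> T x \<in> V"
    "Ck_on k V f" "\<And>i. Ck_on k U (\<lambda>x. T x $ i)"
  shows "Ck_on k U (\<lambda>x. f (T x))"
  using assms(4,5)
proof (induction k arbitrary: f)
  case 0
  have "continuous_on U (\<lambda>x. (\<chi> i. T x $ i))" using 0 by (intro continuous_on_vec_lambda) auto
  then show ?case using 0 continuous_on_compose2[of V f U T] assms(3) by auto
next
  case (Suc k)
  obtain f1 f2 where f: "\<And>x. x \<in> V \<Longrightarrow> (f has_derivative (\<lambda>h. f1 x * h $ 1 + f2 x * h $ 2)) (at x
      within V)"
    "Ck_on k V f1" "Ck_on k V f2" by (rule Ck_on_SucE[OF assms(2) Suc.prems(1)]) (rule that,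
        assumption+)
  define g1 g2 where "g1 = (\<lambda>i. pd U (axis 1 1) (\<lambda>x. T x $ i))" and "g2 = (\<lambda>i. pd U (axis 2 1) (\<lambda>x.
      T x $ i))"
  have g: "((\<lambda>x. T x $ i) has_derivative (\<lambda>h. g1 i x * h $ 1 + g2 i x * h $ 2)) (at x within U)"
    if "x \<in> U" for x i
    using Ck_on_has_derivative[OF assms(1) that Suc.prems(2)[of i]] by (simp add: inner_real2 g1_def
        g2_def)
  have gk: "Ck_on k U (g1 i)" "Ck_on k U (g2 i)" for i
    using Suc.prems(2)[of i] by (auto simp: Ball_Basis_real2 g1_def g2_def)
  have Tk: "Ck_on k U (\<lambda>x. T x $ i)" for i using Suc.prems(2)[of i] by (rule Ck_on_SucD)
  have fT: "Ck_on k U (\<lambda>x. f1 (T x))" "Ck_on k U (\<lambda>x. f2 (T x))" using Suc.IH f Tk by auto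
  show ?case
  proof (rule Ck_on_SucI[OF assms(1)])
    fix x assume x: "x \<in> U"
    have "((\<lambda>x. (\<chi> i. T x $ i)) has_derivative (\<lambda>h. \<chi> i. g1 i x * h $ 1 + g2 i x * h $ 2)) (at x
        within U)"
      by (subst has_derivative_componentwise_within) (use g[OF x] in \<open>simp add: Ball_Basis_real2
          inner_axis\<close>)
    then have A: "(T has_derivative (\<lambda>h. \<chi> i. g1 i x * h $ 1 + g2 i x * h $ 2)) (at x within U)" by
        simp
    have B: "(f has_derivative (\<lambda>h. f1 (T x) * h $ 1 + f2 (T x) * h $ 2)) (at (T x) within T ` U)"
      by (rule has_derivative_subset[OF f(1)]) (use assms(3) x in auto)
    show "((\<lambda>x. f (T x)) has_derivative (\<lambda>h. (f1 (T x) * g1 1 x + f2 (T x) * g1 2 x) * h $ 1 + (f1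
        (T x) * g2 1 x + f2 (T x) * g2 2 x) * h $ 2)) (at x within U)"
      by (rule has_derivative_eq_rhs[OF has_derivative_in_compose[OF A B]]) (simp add:
          algebra_simps)
  qed (intro Ck_on_add Ck_on_mult fT gk assms)+
qed

abbreviation pdi :: "(real^2) set \<Rightarrow> 2 \<Rightarrow> (real^2 \<Rightarrow> real) \<Rightarrow> real^2 \<Rightarrow> real" where
  "pdi V i \<equiv> pd V (axis i 1)"

lemma Ck_on_pdi: "Ck_on (Suc k) V f \<Longrightarrow> Ck_on k V (pdi V i f)"
  by (simp add: Ball_Basis_real2)

section \<open>Symmetry of second derivatives, and conditions at a minimum\<close>

lemma hp_open_interior:
  assumes "hp_open V" "x \<in> V" "0 < x $ 2"
  shows "x \<in> interior V"
proof -
  obtain r where r: "r > 0" "\<And>y. 0 \<le> y $ 2 \<Longrightarrow> dist y x < r \<Longrightarrow> y \<in> V" using hp_openD[OF assms(1,2)] by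
      blast
  have "ball x (min r (x $ 2)) \<subseteq> V"
  proof
    fix y assume y: "y \<in> ball x (min r (x $ 2))"
    have "\<bar>y $ 2 - x $ 2\<bar> \<le> dist y x" using component_le_norm_cart[of "y - x" 2] by (simp add:
        dist_norm)
    then show "y \<in> V" using r(2)[of y] y by (auto simp: dist_commute)
  qed
  then show ?thesis using r assms(3) by (meson centre_in_ball interior_maximal min_less_iff_conj
      open_ball subsetD)
qed

lemma Ck_on_line_derivative:
  assumes V: "hp_open V" and f: "Ck_on (Suc k) V f" and z: "y + s *\<^sub>R v \<in> V"
  shows "((\<lambda>s. f (y + s *\<^sub>R v)) has_real_derivative
     (pdi V 1 f (y + s *\<^sub>R v) * v $ 1 + pdi V 2 f (y + s *\<^sub>R v) * v $ 2)) (at s within {s. y + s *\<^sub>R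
         v \<in> V})"
proof -
  have 1: "((\<lambda>s. y + s *\<^sub>R v) has_derivative (\<lambda>s. s *\<^sub>R v)) (at s within {s. y + s *\<^sub>R v \<in> V})"
    by (auto intro!: derivative_eq_intros)
  have 2: "(f has_derivative (\<lambda>h. (\<chi> i. pdi V i f (y + s *\<^sub>R v)) \<bullet> h)) (at (y + s *\<^sub>R v) within (\<lambda>s.
      y + s *\<^sub>R v) ` {s. y + s *\<^sub>R v \<in> V})"
    by (rule has_derivative_subset[OF Ck_on_has_derivative[OF V z f]]) auto
  show ?thesis unfolding has_field_derivative_def
    by (rule has_derivative_eq_rhs[OF has_derivative_in_compose[OF 1 2]]) (auto simp: inner_real2
        algebra_simps)
qed

lemma at_within_line_interior:
  assumes "hp_open V" "y + s *\<^sub>R v \<in> V" "0 < (y + s *\<^sub>R v) $ 2"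
  shows "at s within {s. y + s *\<^sub>R v \<in> V} = at s"
proof (rule at_within_interior)
  have "open ((\<lambda>s. y + s *\<^sub>R v) -` interior V)"
    by (intro continuous_open_vimage continuous_intros) auto
  moreover have "s \<in> (\<lambda>s. y + s *\<^sub>R v) -` interior V"
    using hp_open_interior[OF assms] by simp
  moreover have "(\<lambda>s. y + s *\<^sub>R v) -` interior V \<subseteq> {s. y + s *\<^sub>R v \<in> V}"
    using interior_subset by auto
  ultimately show "s \<in> interior {s. y + s *\<^sub>R v \<in> V}" by (rule interiorI)
qed

text \<open>The mean value theorem is applied along axis \<open>i\<close> to the difference of two
  translates and then along axis \<open>j\<close> to \<open>pdi V i f\<close>. The left side is
  symmetric in \<open>i\<close> and \<open>j\<close>, which is the source of the symmetry of second
  derivatives. The square lies in the open half plane so that all derivatives are two-sided.\<close>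

lemma second_difference_mvt:
  assumes V: "hp_open V" and f: "Ck_on 2 V f" and h: "0 < h"
    and box: "\<And>s t. \<lbrakk>0 \<le> s; s \<le> h; 0 \<le> t; t \<le> h\<rbrakk> \<Longrightarrow>
      x + s *\<^sub>R axis i 1 + t *\<^sub>R axis j 1 \<in> V \<and> 0 < (x + s *\<^sub>R axis i 1 + t *\<^sub>R axis j 1) $ 2"
  shows "\<exists>s t. 0 < s \<and> s < h \<and> 0 < t \<and> t < h \<and>
    f (x + h *\<^sub>R axis i 1 + h *\<^sub>R axis j 1) - f (x + h *\<^sub>R axis i 1) - f (x + h *\<^sub>R axis j 1) + f x
      = h\<^sup>2 * pdi V j (pdi V i f) (x + s *\<^sub>R axis i 1 + t *\<^sub>R axis j 1)"
proof -
  let ?i = "axis i 1 :: real^2" and ?j = "axis j 1 :: real^2"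
  have f2: "Ck_on (Suc 1) V f" using f by (simp add: numeral_2_eq_2)
  have ax: "pdi V 1 g z * axis k 1 $ 1 + pdi V 2 g z * axis k 1 $ 2 = pdi V k g z" for g z and k ::
      2
    using exhaust_2[of k] by auto
  have d: "((\<lambda>s. g (y + s *\<^sub>R axis k 1)) has_real_derivative pdi V k g (y + s *\<^sub>R axis k 1)) (at s)"
    if "Ck_on (Suc m) V g" "y + s *\<^sub>R axis k 1 \<in> V \<and> 0 < (y + s *\<^sub>R axis k 1) $ 2" for g y s m and k
        :: 2
    using Ck_on_line_derivative[OF V that(1), of y s "axis k 1"] that(2) at_within_line_interior[OF
        V, of y s "axis k 1"]
    unfolding ax by metis
  have "\<exists>s>0. s < h \<and> (f ((x + h *\<^sub>R ?j) + h *\<^sub>R ?i) - f (x + h *\<^sub>R ?i)) - (f ((x + h *\<^sub>R ?j) + 0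
      *\<^sub>R ?i) - f (x + 0 *\<^sub>R ?i))
      = (h - 0) * (pdi V i f ((x + h *\<^sub>R ?j) + s *\<^sub>R ?i) - pdi V i f (x + s *\<^sub>R ?i))"
    apply (rule MVT2[of 0 h "\<lambda>s. f ((x + h *\<^sub>R ?j) + s *\<^sub>R ?i) - f (x + s *\<^sub>R ?i)"])
    using h apply simp
    apply (intro DERIV_diff d[OF f2])
    using box[of _ h] box[of _ 0] h by (auto simp: algebra_simps)
  then obtain s where s: "0 < s" "s < h" and 1: "f (x + h *\<^sub>R ?j + h *\<^sub>R ?i) - f (x + h *\<^sub>R ?i) - (f
      (x + h *\<^sub>R ?j) - f x)
      = h * (pdi V i f (x + h *\<^sub>R ?j + s *\<^sub>R ?i) - pdi V i f (x + s *\<^sub>R ?i))" by auto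
  have "\<exists>t>0. t < h \<and> pdi V i f ((x + s *\<^sub>R ?i) + h *\<^sub>R ?j) - pdi V i f ((x + s *\<^sub>R ?i) + 0 *\<^sub>R ?j)
      = (h - 0) * pdi V j (pdi V i f) ((x + s *\<^sub>R ?i) + t *\<^sub>R ?j)"
    apply (rule MVT2[of 0 h "\<lambda>t. pdi V i f ((x + s *\<^sub>R ?i) + t *\<^sub>R ?j)"])
    using h apply simp
    apply (rule d[OF Ck_on_pdi[OF f2, unfolded One_nat_def]])
    using box[of s] s by auto
  then obtain t where t: "0 < t" "t < h" and 2: "pdi V i f (x + s *\<^sub>R ?i + h *\<^sub>R ?j) - pdi V i f (x
      + s *\<^sub>R ?i)
      = h * pdi V j (pdi V i f) (x + s *\<^sub>R ?i + t *\<^sub>R ?j)" by auto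
  have "x + h *\<^sub>R ?j + s *\<^sub>R ?i = x + s *\<^sub>R ?i + h *\<^sub>R ?j" "x + h *\<^sub>R ?j + h *\<^sub>R ?i = x + h *\<^sub>R ?i +
      h *\<^sub>R ?j"
    by (simp_all add: algebra_simps)
  with 1 2 have "f (x + h *\<^sub>R ?i + h *\<^sub>R ?j) - f (x + h *\<^sub>R ?i) - (f (x + h *\<^sub>R ?j) - f x) = h * (h
      * pdi V j (pdi V i f) (x + s *\<^sub>R ?i + t *\<^sub>R ?j))"
    by metis
  then show ?thesis using s t by (intro exI[of _ s] exI[of _ t]) (simp add: power2_eq_square
      algebra_simps)
qed

text \<open>Schwarz: evaluating the same second difference in both orders produces two points, at
  distance at most twice the side of the square from \<open>x\<close>, where the two mixed
  derivatives agree; then the side tends to 0.\<close>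

lemma pdi_commute_interior:
  assumes V: "hp_open V" and f: "Ck_on 2 V f" and x: "x \<in> V" "0 < x $ 2"
  shows "pdi V j (pdi V i f) x = pdi V i (pdi V j f) x"
proof -
  obtain r where r: "r > 0" "ball x r \<subseteq> V" using hp_open_interior[OF V x] mem_interior by blast
  define q where "q = min r (x $ 2)"
  have q: "q > 0" using r x by (simp add: q_def)
  have near: "dist (x + s *\<^sub>R axis k 1 + t *\<^sub>R axis l 1) x \<le> s + t" if "0 \<le> s" "0 \<le> t" for s t and k
      l :: 2
    using norm_triangle_ineq[of "s *\<^sub>R (axis k 1 :: real^2)" "t *\<^sub>R axis l 1"] that
    by (simp add: dist_norm add.assoc)
  have box: "x + s *\<^sub>R axis k 1 + t *\<^sub>R axis l 1 \<in> V \<and> 0 < (x + s *\<^sub>R axis k 1 + t *\<^sub>R axis l 1) $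
      2"
    if "0 \<le> s" "0 \<le> t" "s + t < q" for s t and k l :: 2
    using near[OF that(1,2), of k l] that r x q axis_nonneg[of k 2] axis_nonneg[of l 2]
    by (auto simp: q_def dist_commute mem_ball intro!: subsetD[OF r(2)] add_pos_nonneg)
  have f2: "Ck_on (Suc (Suc 0)) V f" using f by (simp add: numeral_2_eq_2)
  have c: "continuous_on V (pdi V k (pdi V l f))" for k l
    using Ck_on_pdi[OF Ck_on_pdi[OF f2]] by simp
  \<comment> \<open>Side lengths of the squares; the factor 1/3 keeps every point of the square, at
    distance at most \<open>P n + P n\<close>, inside the radius \<open>q\<close>.\<close>
  define P where "P = (\<lambda>n. inverse (real (Suc n)) * (q / 3))"
  have P: "0 < P n" "P n + P n < q" for n
  proof -
    show "0 < P n" using q by (simp add: P_def)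
    have "inverse (real (Suc n)) \<le> 1" by (simp add: inverse_eq_divide)
    then have "P n \<le> q / 3" unfolding P_def using q mult_right_mono[of "inverse (real (Suc n))" 1
        "q/3"] by simp
    then show "P n + P n < q" using q by linarith
  qed
  have "\<exists>p p'. p \<in> V \<and> dist p x \<le> P n + P n \<and> p' \<in> V \<and> dist p' x \<le> P n + P n \<and>
      pdi V j (pdi V i f) p = pdi V i (pdi V j f) p'" for n
  proof -
    let ?h = "P n"
    obtain s t where a: "0 < s" "s < ?h" "0 < t" "t < ?h"
      "f (x + ?h *\<^sub>R axis i 1 + ?h *\<^sub>R axis j 1) - f (x + ?h *\<^sub>R axis i 1) - f (x + ?h *\<^sub>R axis j 1)
          + f x
      = ?h\<^sup>2 * pdi V j (pdi V i f) (x + s *\<^sub>R axis i 1 + t *\<^sub>R axis j 1)"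
      using second_difference_mvt[OF V f P(1)[of n], of x i j] box[of _ _ i j] P(2)[of n] by force
    obtain s' t' where b: "0 < s'" "s' < ?h" "0 < t'" "t' < ?h"
      "f (x + ?h *\<^sub>R axis j 1 + ?h *\<^sub>R axis i 1) - f (x + ?h *\<^sub>R axis j 1) - f (x + ?h *\<^sub>R axis i 1)
          + f x
      = ?h\<^sup>2 * pdi V i (pdi V j f) (x + s' *\<^sub>R axis j 1 + t' *\<^sub>R axis i 1)"
      using second_difference_mvt[OF V f P(1)[of n], of x j i] box[of _ _ j i] P(2)[of n] by force
    have "x + ?h *\<^sub>R axis j 1 + ?h *\<^sub>R axis i 1 = x + ?h *\<^sub>R axis i 1 + ?h *\<^sub>R axis j 1" by simp
    from b(5)[unfolded this] a(5) have "?h\<^sup>2 * pdi V j (pdi V i f) (x + s *\<^sub>R axis i 1 + t *\<^sub>R axis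
        j 1) = ?h\<^sup>2 * pdi V i (pdi V j f) (x + s' *\<^sub>R axis j 1 + t' *\<^sub>R axis i 1)"
      by linarith
    then have e: "pdi V j (pdi V i f) (x + s *\<^sub>R axis i 1 + t *\<^sub>R axis j 1) = pdi V i (pdi V j f) (x
        + s' *\<^sub>R axis j 1 + t' *\<^sub>R axis i 1)"
      using P(1)[of n] by simp
    show ?thesis
      apply (rule exI[of _ "x + s *\<^sub>R axis i 1 + t *\<^sub>R axis j 1"], rule exI[of _ "x + s' *\<^sub>R axis j
          1 + t' *\<^sub>R axis i 1"])
      using e a b P(2)[of n] near[of s t i j] near[of s' t' j i] box[of s t i j] box[of s' t' j i]
          by auto
  qed
  then obtain p p' where p: "\<And>n. p n \<in> V" "\<And>n. dist (p n) x \<le> P n + P n" "\<And>n. p' n \<in> V" "\<And>n. dist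
      (p' n) x \<le> P n + P n"
     "\<And>n. pdi V j (pdi V i f) (p n) = pdi V i (pdi V j f) (p' n)" by metis
  have P0: "(\<lambda>n. P n + P n) \<longlonglongrightarrow> 0"
    unfolding P_def using LIMSEQ_inverse_real_of_nat
    by (intro tendsto_add_zero tendsto_mult_left_zero) auto
  have "p \<longlonglongrightarrow> x" "p' \<longlonglongrightarrow> x"
    unfolding tendsto_dist_iff[of _ x]
    by (rule Lim_null_comparison[OF _ P0]; use p in simp)+
  then have "(\<lambda>n. pdi V j (pdi V i f) (p n)) \<longlonglongrightarrow> pdi V j (pdi V i f) x"
    "(\<lambda>n. pdi V i (pdi V j f) (p' n)) \<longlonglongrightarrow> pdi V i (pdi V j f) x"
    by (intro continuous_on_tendsto_compose[OF c _ x(1)]; simp add: p(1,3) del: p(5))+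
  then show ?thesis unfolding p(5) by (rule LIMSEQ_unique)
qed

text \<open>Boundary points are limits of interior ones along axis 2, and
  \<open>line_nontrivial\<close> makes that limit unique. This extends identities from the open half
  plane to the boundary line.\<close>

lemma hp_open_continuous_eq:
  assumes V: "hp_open V" and "continuous_on V f" "continuous_on V g"
    and eq: "\<And>x. x \<in> V \<Longrightarrow> 0 < x $ 2 \<Longrightarrow> f x = (g x :: real)" and x: "x \<in> V"
  shows "f x = g x"
proof -
  let ?A = "{s. x + s *\<^sub>R axis 2 1 \<in> V}" 
  have *: "((\<lambda>s. h (x + s *\<^sub>R axis 2 1)) \<longlongrightarrow> h x) (at 0 within ?A)" if "continuous_on V h" for h :: "_
      \<Rightarrow> real"
  proof -
    have "continuous_on ?A (\<lambda>s. h (x + s *\<^sub>R axis 2 1))"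
      by (rule continuous_on_compose2[OF that]) (auto intro!: continuous_intros)
    from this[unfolded continuous_on_def, rule_format, of 0] show ?thesis using x by simp
  qed
  show ?thesis
  proof (cases "0 < x $ 2")
    case False
    then have x2: "x $ 2 = 0" using hp_open_nonneg[OF V x] by simp
    have "eventually (\<lambda>s. f (x + s *\<^sub>R axis 2 1) = g (x + s *\<^sub>R axis 2 1)) (at 0 within ?A)"
      unfolding eventually_at_topological
      using eq hp_open_nonneg[OF V] x2 by (intro exI[of _ UNIV]) fastforce
    then have "((\<lambda>s. g (x + s *\<^sub>R axis 2 1)) \<longlongrightarrow> f x) (at 0 within ?A)"
      by (rule Lim_transform_eventually[OF *[OF assms(2)]])
    then show ?thesis using tendsto_unique[OF line_nontrivial[OF V x] _ *[OF assms(3)]] by blast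
  qed (use eq x in auto)
qed

lemma pdi_commute:
  assumes V: "hp_open V" and f: "Ck_on 2 V f" and x: "x \<in> V"
  shows "pdi V j (pdi V i f) x = pdi V i (pdi V j f) x"
proof (rule hp_open_continuous_eq[OF V])
  have f2: "Ck_on (Suc (Suc 0)) V f" using f by (simp add: numeral_2_eq_2)
  show "continuous_on V (pdi V j (pdi V i f))" "continuous_on V (pdi V i (pdi V j f))"
    using Ck_on_pdi[OF Ck_on_pdi[OF f2]] by simp_all
qed (use pdi_commute_interior[OF V f] x in auto)

text \<open>Along every line through \<open>x\<close> the first derivative vanishes. Were the second
  one negative, the first would be negative just after 0 and the mean value theorem would push
  \<open>f\<close> below its minimum.\<close>

lemma local_min_derivatives:
  fixes v :: "real^2"
  assumes V: "hp_open V" and f: "Ck_on 2 V f" and x: "x \<in> V" "0 < x $ 2"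
    and e: "0 < e" "\<And>y. y \<in> V \<Longrightarrow> dist y x < e \<Longrightarrow> f x \<le> f y"
  shows "pdi V i f x = 0"
    "0 \<le> v $ 1 * v $ 1 * pdi V 1 (pdi V 1 f) x + v $ 1 * v $ 2 * (pdi V 1 (pdi V 2 f) x + pdi V 2
        (pdi V 1 f) x)
        + v $ 2 * v $ 2 * pdi V 2 (pdi V 2 f) x"
proof -
  have f2: "Ck_on (Suc (Suc 0)) V f" using f by (simp add: numeral_2_eq_2)
  obtain r where r: "r > 0" "ball x r \<subseteq> V" using hp_open_interior[OF V x] mem_interior by blast
  define q where "q = min e (min r (x $ 2))"
  have q: "q > 0" using r x e by (simp add: q_def)
  have in1: "x + s *\<^sub>R v \<in> V" "0 < (x + s *\<^sub>R v) $ 2" "f x \<le> f (x + s *\<^sub>R v)" if "\<bar>s\<bar> * norm v < q"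
      for s and v :: "real^2"
  proof -
    show *: "x + s *\<^sub>R v \<in> V" using that r by (intro subsetD[OF r(2)]) (auto simp: q_def dist_norm)
    show "0 < (x + s *\<^sub>R v) $ 2" 
      using component_le_norm_cart[of "s *\<^sub>R v" 2] that by (auto simp: q_def)
    show "f x \<le> f (x + s *\<^sub>R v)" using that * by (intro e(2)) (auto simp: q_def dist_norm)
  qed
  define p where "p = (\<lambda>v s. pdi V 1 f (x + s *\<^sub>R v) * v $ 1 + pdi V 2 f (x + s *\<^sub>R v) * v $ 2)"
  have d1: "((\<lambda>s. f (x + s *\<^sub>R v)) has_real_derivative p v s) (at s)" if "\<bar>s\<bar> * norm v < q" for s
      and v :: "real^2"
    using Ck_on_line_derivative[OF V f2, of x s v] at_within_line_interior[OF V, of x s v] in1[OF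
        that]
    by (simp add: p_def)
  have bd: "\<exists>d>0. \<forall>s. \<bar>s\<bar> < d \<longrightarrow> \<bar>s\<bar> * norm v < q" for v :: "real^2"
  proof (intro exI conjI allI impI)
    show "0 < q / (norm v + 1)" using q by (simp add: add_nonneg_pos)
    fix s :: real assume "\<bar>s\<bar> < q / (norm v + 1)"
    then have "\<bar>s\<bar> * (norm v + 1) < q" by (simp add: pos_less_divide_eq add_nonneg_pos)
    then show "\<bar>s\<bar> * norm v < q" by (smt (verit) distrib_left mult_cancel_left2)
  qed
  have p0: "p v 0 = 0" for v :: "real^2"
  proof -
    obtain d where d: "d > 0" "\<And>s. \<bar>s\<bar> < d \<Longrightarrow> \<bar>s\<bar> * norm v < q" using bd[of v] by blast
    show ?thesis
      by (rule DERIV_local_min[OF d1[of 0 v] d(1)]) (use d in1 q in auto)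
  qed
  show "pdi V i f x = 0"
    using p0[of "axis i 1"] exhaust_2[of i] by (auto simp: p_def)
  define h where "h = v $ 1 * v $ 1 * pdi V 1 (pdi V 1 f) x + v $ 1 * v $ 2 * (pdi V 1 (pdi V 2 f) x
      + pdi V 2 (pdi V 1 f) x)
        + v $ 2 * v $ 2 * pdi V 2 (pdi V 2 f) x"
  have "(p v has_real_derivative h) (at 0)"
  proof -
    have "((\<lambda>s. pdi V i f (x + s *\<^sub>R v)) has_real_derivative
       (pdi V 1 (pdi V i f) x * v $ 1 + pdi V 2 (pdi V i f) x * v $ 2)) (at 0)" for i
      using Ck_on_line_derivative[OF V Ck_on_pdi[OF f2, of i], of x 0 v] at_within_line_interior[OF
          V, of x 0 v] x
      by simp
    from DERIV_add[OF DERIV_cmult_right[OF this[of 1], of "v $ 1"] DERIV_cmult_right[OF this[of 2],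
        of "v $ 2"]]
    show ?thesis by (simp add: p_def[abs_def] h_def algebra_simps)
  qed
  have "0 \<le> h"
  proof (rule ccontr)
    assume "\<not> 0 \<le> h"
    then obtain d' where d': "d' > 0" "\<And>s. 0 < s \<Longrightarrow> s < d' \<Longrightarrow> p v (0 + s) < p v 0"
      using DERIV_neg_dec_right[OF \<open>(p v has_real_derivative h) (at 0)\<close>] by force
    obtain d where d: "d > 0" "\<And>s. \<bar>s\<bar> < d \<Longrightarrow> \<bar>s\<bar> * norm v < q" using bd[of v] by blast
    define m where "m = min d d' / 2"
    have m: "0 < m" "m < d" "m < d'" using d d' by (auto simp: m_def)
    have "\<exists>z>0. z < m \<and> f (x + m *\<^sub>R v) - f (x + 0 *\<^sub>R v) = (m - 0) * p v z"
      by (rule MVT2[OF m(1), of "\<lambda>s. f (x + s *\<^sub>R v)"]) (use d1[OF d(2), of _] m in auto)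
    then obtain z where z: "0 < z" "z < m" "f (x + m *\<^sub>R v) - f x = m * p v z" by auto
    have "p v z < 0" using d'(2)[of z] z m p0 by auto
    then have "m * p v z < 0" using m by (simp add: mult_pos_neg)
    moreover have "f x \<le> f (x + m *\<^sub>R v)" using in1(3)[of m v] d(2)[of m] m by auto
    ultimately show False using z by linarith
  qed
  then show "0 \<le> v $ 1 * v $ 1 * pdi V 1 (pdi V 1 f) x + v $ 1 * v $ 2 * (pdi V 1 (pdi V 2 f) x +
      pdi V 2 (pdi V 1 f) x)
        + v $ 2 * v $ 2 * pdi V 2 (pdi V 2 f) x" by (simp add: h_def)
qed

text \<open>Completing the square writes the form as \<open>a\<close> times the second derivative
  along \<open>(1, b/a)\<close> plus \<open>(a * d - b * b) / a\<close> times the one along axis 2,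
  which avoids a diagonalisation.\<close>

lemma local_min_trace:
  assumes V: "hp_open V" and f: "Ck_on 2 V f" and x: "x \<in> V" "0 < x $ 2"
    and e: "0 < e" "\<And>y. y \<in> V \<Longrightarrow> dist y x < e \<Longrightarrow> f x \<le> f y"
    and a: "0 < a" "0 \<le> a * d - b * b"
  shows "0 \<le> a * pdi V 1 (pdi V 1 f) x + b * (pdi V 1 (pdi V 2 f) x + pdi V 2 (pdi V 1 f) x) + d *
      pdi V 2 (pdi V 2 f) x"
proof -
  note D = local_min_derivatives(2)[OF V f x e]
  have 1: "0 \<le> a * (pdi V 1 (pdi V 1 f) x + (b/a) * (pdi V 1 (pdi V 2 f) x + pdi V 2 (pdi V 1 f) x)
      + (b/a) * (b/a) * pdi V 2 (pdi V 2 f) x)"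
    using D[of "vector [1, b/a]"] a by (intro mult_nonneg_nonneg) auto
  have 2: "0 \<le> pdi V 2 (pdi V 2 f) x" using D[of "axis 2 1"] by simp
  have "0 \<le> (a * d - b * b) / a * pdi V 2 (pdi V 2 f) x" using 2 a by simp
  moreover have "a * h + b * k + d * l = a * (h + (b/a) * k + (b/a) * (b/a) * l) + (a * d - b * b) /
      a * l" for h k l
    using a(1) by (simp add: field_simps)
  ultimately show ?thesis using 1 by (metis add_nonneg_nonneg)
qed

lemma matrix_inv_2:
  fixes A :: "real^2^2"
  assumes A: "det A \<noteq> 0"
  shows "matrix_inv A $ 1 $ 1 = A $ 2 $ 2 / det A" "matrix_inv A $ 1 $ 2 = - A $ 1 $ 2 / det A"
    "matrix_inv A $ 2 $ 1 = - A $ 2 $ 1 / det A" "matrix_inv A $ 2 $ 2 = A $ 1 $ 1 / det A"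
proof -
  define B :: "real^2^2" where "B = vector [vector [A $ 2 $ 2 / det A, - A $ 1 $ 2 / det A], vector
      [- A $ 2 $ 1 / det A, A $ 1 $ 1 / det A]]"
  have "A ** B = mat 1"
    using assms by (simp add: B_def matrix_matrix_mult_def mat_def vec_eq_iff forall_2 sum_2
        diff_divide_distrib[symmetric] mult.commute)
      (simp add: det_2 mult.commute)
  moreover from this have "B ** A = mat 1" by (simp add: matrix_left_right_inverse)
  ultimately have *: "A ** B = mat 1 \<and> B ** A = mat 1" by blast
  have "matrix_inv A ** A = mat 1"
    unfolding matrix_inv_def by (rule someI2[where a = B]) (use * in auto)
  then have "matrix_inv A = B" using \<open>A ** B = mat 1\<close>
    by (metis matrix_mul_assoc matrix_mul_lid matrix_mul_rid)
  then show "matrix_inv A $ 1 $ 1 = A $ 2 $ 2 / det A" "matrix_inv A $ 1 $ 2 = - A $ 1 $ 2 / det A"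
    "matrix_inv A $ 2 $ 1 = - A $ 2 $ 1 / det A" "matrix_inv A $ 2 $ 2 = A $ 1 $ 1 / det A"
    by (simp_all add: B_def)
qed

declare Ck_on.simps(2) [simp del]

lemma Ck_on_2: "Ck_on 2 V f \<longleftrightarrow> Ck_on (Suc (Suc 0)) V f"
  by (simp add: numeral_2_eq_2)

lemma pdi_eqI:
  assumes "hp_open V" "x \<in> V" "(f has_derivative (\<lambda>h. a * h $ 1 + b * h $ 2)) (at x within V)"
  shows "pdi V i f x = (if i = 1 then a else b)"
  using has_derivative_pd(2)[OF assms] exhaust_2[of i] by auto

lemma C1_has_derivative:
  assumes "hp_open V" "x \<in> V" "Ck_on (Suc k) V f"
  shows "(f has_derivative (\<lambda>h. pdi V 1 f x * h $ 1 + pdi V 2 f x * h $ 2)) (at x within V)"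
  using Ck_on_has_derivative[OF assms] by (simp add: inner_real2)

lemma pdi_cong: "x \<in> V \<Longrightarrow> (\<And>y. y \<in> V \<Longrightarrow> f y = g y) \<Longrightarrow> pdi V i f x = pdi V i g x"
  by (rule has_pd_cong(2))

context
  fixes V :: "(real^2) set" and x
  assumes V: "hp_open V" "x \<in> V"
begin

lemma pdi_const [simp]: "pdi V i (\<lambda>y. c) x = 0"
  using pdi_eqI[OF V, of "\<lambda>y. c" 0 0] by simp

lemma pdi_add:
  assumes "Ck_on (Suc k) V f" "Ck_on (Suc k) V g"
  shows "pdi V i (\<lambda>y. f y + g y) x = pdi V i f x + pdi V i g x"
  using has_derivative_pd(2)[OF V has_derivative_add[OF C1_has_derivative[OF V assms(1)]
      C1_has_derivative[OF V assms(2)]]]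
    exhaust_2[of i] by auto

lemma pdi_diff:
  assumes "Ck_on (Suc k) V f" "Ck_on (Suc k) V g"
  shows "pdi V i (\<lambda>y. f y - g y) x = pdi V i f x - pdi V i g x"
  using has_derivative_pd(2)[OF V has_derivative_diff[OF C1_has_derivative[OF V assms(1)]
      C1_has_derivative[OF V assms(2)]]]
    exhaust_2[of i] by auto

lemma pdi_mult:
  assumes "Ck_on (Suc k) V f" "Ck_on (Suc k) V g"
  shows "pdi V i (\<lambda>y. f y * g y) x = f x * pdi V i g x + pdi V i f x * g x"
  using has_derivative_pd(2)[OF V has_derivative_mult[OF C1_has_derivative[OF V assms(1)]
      C1_has_derivative[OF V assms(2)]]]
    exhaust_2[of i] by auto

lemma pdi_cmult:
  assumes "Ck_on (Suc k) V f"
  shows "pdi V i (\<lambda>y. c * f y) x = c * pdi V i f x"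
  using pdi_mult[OF Ck_on_const[OF V(1), of "Suc k" c] assms] by simp

lemma pdi_real_compose:
  assumes "Ck_on (Suc k) V f" "(\<phi> has_real_derivative d) (at (f x))"
  shows "pdi V i (\<lambda>y. \<phi> (f y)) x = d * pdi V i f x"
  using has_derivative_pd(2)[OF V DERIV_compose_FDERIV[OF assms(2) C1_has_derivative[OF V
      assms(1)]]]
    exhaust_2[of i] by auto

lemma pdi_compose:
  assumes W: "hp_open W" "\<And>y. y \<in> V \<Longrightarrow> T y \<in> W"
    and T: "\<And>j. Ck_on (Suc k) V (\<lambda>y. T y $ j)" and f: "Ck_on (Suc l) W f"
  shows "pdi V i (\<lambda>y. f (T y)) x =
    pdi W 1 f (T x) * pdi V i (\<lambda>y. T y $ 1) x + pdi W 2 f (T x) * pdi V i (\<lambda>y. T y $ 2) x"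
proof -
  define g1 g2 where "g1 = (\<lambda>i. pdi V 1 (\<lambda>x. T x $ i))" and "g2 = (\<lambda>i. pdi V 2 (\<lambda>x. T x $ i))"
  have A: "(T has_derivative (\<lambda>h. \<chi> i. g1 i x * h $ 1 + g2 i x * h $ 2)) (at x within V)"
    by (subst has_derivative_componentwise_within)
      (use C1_has_derivative[OF V T] in \<open>simp add: Ball_Basis_real2 inner_axis g1_def g2_def\<close>)
  have B: "(f has_derivative (\<lambda>h. pdi W 1 f (T x) * h $ 1 + pdi W 2 f (T x) * h $ 2)) (at (T x)
      within T ` V)"
    by (rule has_derivative_subset[OF C1_has_derivative[OF W(1) _ f]]) (use W V in auto)
  show ?thesis
    using has_derivative_pd(2)[OF V has_derivative_in_compose[OF A B], of i] exhaust_2[of i]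
    by (auto simp: g1_def g2_def)
qed

end

section \<open>Chart invariance of the Laplacian\<close>

lemma openin_continuous_preimage_greaterThan:
  assumes "hp_open V" "continuous_on V (f :: _ \<Rightarrow> real)"
  shows "hp_open {x \<in> V. 0 < f x}"
proof -
  have "openin (top_of_set V) (V \<inter> f -` {0<..})"
    using assms(2) by (intro continuous_openin_preimage_gen) auto
  moreover have "V \<inter> f -` {0<..} = {x \<in> V. 0 < f x}" by auto
  ultimately show ?thesis using assms(1) openin_trans by metis
qed

section \<open>Charts, transition maps and positivity of the metric\<close>

locale riemannian_surface =
  fixes S :: "'a surface"
  assumes surface: "compact_riemannian_surface S"
begin

abbreviation "X \<equiv> surf_top S"
abbreviation "M \<equiv> topspace (surf_top S)"
abbreviation "\<A> \<equiv> surf_atlas S"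
abbreviation "g \<equiv> surf_metric S"

lemma compact_space_X: "compact_space X" and Hausdorff_X: "Hausdorff_space X"
  and chart: "c \<in> \<A> \<Longrightarrow> is_chart X c"
  and atlas_cover: "(\<Union>c\<in>\<A>. chart_dom c) = M"
  using surface unfolding compact_riemannian_surface_def by auto

lemma smooth_transition: "c \<in> \<A> \<Longrightarrow> c' \<in> \<A> \<Longrightarrow> Ck_on n (overlap c c') (\<lambda>x. transition c c' x $ k)"
  using surface unfolding compact_riemannian_surface_def smooth_on_def by auto

lemma smooth_metric: "c \<in> \<A> \<Longrightarrow> Ck_on n (chart_img c) (\<lambda>x. g c x $ i $ j)"
  using surface unfolding compact_riemannian_surface_def smooth_on_def by auto

lemma metric_sym: "c \<in> \<A> \<Longrightarrow> x \<in> chart_img c \<Longrightarrow> g c x $ 2 $ 1 = g c x $ 1 $ 2"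
proof -
  assume "c \<in> \<A>" "x \<in> chart_img c"
  then have "transpose (g c x) = g c x"
    using surface unfolding compact_riemannian_surface_def by blast
  then show ?thesis by (simp add: transpose_def vec_eq_iff)
qed

lemma metric_transform: "c \<in> \<A> \<Longrightarrow> c' \<in> \<A> \<Longrightarrow> x \<in> overlap c c' \<Longrightarrow>
    g c x = transpose (jacobian c c' x) ** g c' (transition c c' x) ** jacobian c c' x"
  using surface unfolding compact_riemannian_surface_def by blast

lemma metric_pos:
  assumes c: "c \<in> \<A>" "x \<in> chart_img c"
  shows "0 < g c x $ 1 $ 1" "0 < det (g c x)"
proof -
  have pos: "0 < v \<bullet> (g c x *v v)" if "v \<noteq> 0" for v
    using surface c that unfolding compact_riemannian_surface_def by blast
  have q: "v \<bullet> (g c x *v v) = v $ 1 * v $ 1 * g c x $ 1 $ 1 + 2 * v $ 1 * v $ 2 * g c x $ 1 $ 2 + v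
      $ 2 * v $ 2 * g c x $ 2 $ 2" for v
    using metric_sym[OF c] by (simp add: inner_real2 matrix_vector_mult_def sum_2 algebra_simps)
  show p: "0 < g c x $ 1 $ 1" using pos[of "axis 1 1"] by (simp add: q axis_eq_0_iff)
  \<comment> \<open>The vector orthogonal to \<open>axis 1 1\<close> for the metric; its squared
    length is \<open>g11 * det g\<close>, which turns positivity of the form into positivity of the
    determinant.\<close>
  let ?v = "vector [- g c x $ 1 $ 2, g c x $ 1 $ 1] :: real^2"
  have "?v \<noteq> 0" using p by (metis vector_2(2) less_irrefl zero_index)
  then have "0 < ?v \<bullet> (g c x *v ?v)" by (rule pos)
  also have "\<dots> = g c x $ 1 $ 1 * det (g c x)"
    unfolding q using metric_sym[OF c] by (simp add: det_2 algebra_simps)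
  finally show "0 < det (g c x)" using p by (simp add: zero_less_mult_iff)
qed

lemma metric_inv_2:
  assumes c: "c \<in> \<A>" "x \<in> chart_img c"
  shows "metric_inv S c x $ 1 $ 1 = g c x $ 2 $ 2 / det (g c x)" "metric_inv S c x $ 1 $ 2 = - g c x
      $ 1 $ 2 / det (g c x)"
    "metric_inv S c x $ 2 $ 1 = - g c x $ 1 $ 2 / det (g c x)" "metric_inv S c x $ 2 $ 2 = g c x $ 1
        $ 1 / det (g c x)"
  using matrix_inv_2[of "g c x"] metric_pos(2)[OF c] metric_sym[OF c] by (auto simp: metric_inv_def)

lemma det_metric: "c \<in> \<A> \<Longrightarrow> x \<in> chart_img c \<Longrightarrow> det (g c x) = g c x $ 1 $ 1 * g c x $ 2 $ 2 - g c x $ 1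
    $ 2 * g c x $ 1 $ 2"
  using metric_sym by (simp add: det_2)

lemma chart_facts:
  assumes c: "c \<in> \<A>"
  shows chart_dom_open: "openin X (chart_dom c)"
    and chart_img_open: "hp_open (chart_img c)"
    and chart_inj: "inj_on (chart_map c) (chart_dom c)"
    and chart_dom_subset: "chart_dom c \<subseteq> M"
proof -
  have ch: "openin X (chart_dom c)" "hp_open (chart_img c)"
     "homeomorphic_map (subtopology X (chart_dom c)) (top_of_set (chart_img c)) (chart_map c)"
    using chart[OF c] by (auto simp: is_chart_def)
  then show "openin X (chart_dom c)" "hp_open (chart_img c)" by auto
  show "chart_dom c \<subseteq> M" using ch(1) by (rule openin_subset)
  then show "inj_on (chart_map c) (chart_dom c)"
    using homeomorphic_imp_injective_map[OF ch(3)] by (simp add: topspace_subtopology Int_absorb1)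
qed

lemma chart_inv_map [simp]: "c \<in> \<A> \<Longrightarrow> p \<in> chart_dom c \<Longrightarrow> chart_inv c (chart_map c p) = p"
  unfolding chart_inv_def by (rule inv_into_f_f[OF chart_inj])

lemma chart_map_inv [simp]: "x \<in> chart_img c \<Longrightarrow> chart_map c (chart_inv c x) = x"
  unfolding chart_inv_def chart_img_def by (rule f_inv_into_f)

lemma chart_inv_dom [simp]: "x \<in> chart_img c \<Longrightarrow> chart_inv c x \<in> chart_dom c"
  unfolding chart_inv_def chart_img_def by (rule inv_into_into)

lemma chart_map_img [simp]: "p \<in> chart_dom c \<Longrightarrow> chart_map c p \<in> chart_img c"
  unfolding chart_img_def by simp

lemma openin_chart_image:
  assumes c: "c \<in> \<A>" and U: "openin X U" "U \<subseteq> chart_dom c"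
  shows "hp_open (chart_map c ` U)"
proof -
  have "openin (subtopology X (chart_dom c)) U"
    using U by (simp add: openin_subtopology_alt) blast
  then have "openin (top_of_set (chart_img c)) (chart_map c ` U)"
    using chart[OF c] unfolding is_chart_def by (meson homeomorphic_imp_open_map open_map_def)
  then show ?thesis using chart_img_open[OF c] openin_trans by blast
qed

lemma openin_chart_preimage:
  assumes c: "c \<in> \<A>" and W: "hp_open W" "W \<subseteq> chart_img c"
  shows "openin X (chart_inv c ` W)"
proof -
  have "chart_map c ` (chart_inv c ` W) = W" using W(2) by (force simp: image_image)
  moreover have "openin (top_of_set (chart_img c)) W"
    using W by (metis openin_subset_trans chart_img_open[OF c] openin_imp_subset)
  moreover have "chart_inv c ` W \<subseteq> topspace (subtopology X (chart_dom c))"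
    using W(2) by (auto simp: topspace_subtopology intro!: subsetD[OF chart_dom_subset[OF c]]
        chart_inv_dom)
  ultimately have "openin (subtopology X (chart_dom c)) (chart_inv c ` W)"
    using chart[OF c] unfolding is_chart_def by (metis homeomorphic_map_openness)
  then show ?thesis using chart_dom_open[OF c] openin_trans_full by blast
qed

lemma chart_inv_image:
  "c \<in> \<A> \<Longrightarrow> W \<subseteq> chart_img c \<Longrightarrow> chart_inv c ` W = {p \<in> chart_dom c. chart_map c p \<in> W}"
  by (force simp: subset_iff)

lemma overlap_open: "c \<in> \<A> \<Longrightarrow> c' \<in> \<A> \<Longrightarrow> hp_open (overlap c c')"
  unfolding overlap_def by (intro openin_chart_image openin_Int chart_dom_open) auto

lemma overlap_subset: "overlap c c' \<subseteq> chart_img c"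
  unfolding overlap_def chart_img_def by auto

lemma overlapI: "p \<in> chart_dom c \<Longrightarrow> p \<in> chart_dom c' \<Longrightarrow> chart_map c p \<in> overlap c c'"
  unfolding overlap_def by auto

lemma transition_map: "c \<in> \<A> \<Longrightarrow> p \<in> chart_dom c \<Longrightarrow> transition c c' (chart_map c p) = chart_map c' p"
  by (simp add: transition_def)

lemma overlapE:
  assumes "x \<in> overlap c c'"
  obtains p where "p \<in> chart_dom c" "p \<in> chart_dom c'" "x = chart_map c p"
  using assms unfolding overlap_def by auto

lemma transition_overlap: "c \<in> \<A> \<Longrightarrow> x \<in> overlap c c' \<Longrightarrow> transition c c' x \<in> chart_img c'"
  by (elim overlapE) (simp add: transition_map)

lemma chart_inv_transition:
  "c \<in> \<A> \<Longrightarrow> c' \<in> \<A> \<Longrightarrow> x \<in> overlap c c' \<Longrightarrow> chart_inv c' (transition c c' x) = chart_inv c x"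
  by (elim overlapE) (simp add: transition_map)

abbreviation "J c c' k i \<equiv> pdi (overlap c c') i (\<lambda>y. transition c c' y $ k)"

lemma jacobian_nth: "jacobian c c' x $ k $ i = J c c' k i x"
  by (simp add: jacobian_def)

lemma Ck_on_J: "c \<in> \<A> \<Longrightarrow> c' \<in> \<A> \<Longrightarrow> Ck_on n (overlap c c') (J c c' k i)"
  by (rule Ck_on_pdi[OF smooth_transition])

lemma det_jacobian: "det (jacobian c c' x) = J c c' 1 1 x * J c c' 2 2 x - J c c' 1 2 x * J c c' 2 1
    x"
  by (simp add: det_2 jacobian_nth)

lemma det_metric_transform:
  assumes "c \<in> \<A>" "c' \<in> \<A>" "x \<in> overlap c c'"
  shows "det (g c x) = (det (jacobian c c' x))\<^sup>2 * det (g c' (transition c c' x))"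
  unfolding metric_transform[OF assms] by (simp add: det_mul det_transpose power2_eq_square)

lemma det_jacobian_nz:
  assumes "c \<in> \<A>" "c' \<in> \<A>" "x \<in> overlap c c'"
  shows "det (jacobian c c' x) \<noteq> 0"
  using det_metric_transform[OF assms] metric_pos(2)[OF assms(1) subsetD[OF overlap_subset
      assms(3)]]
  by auto

lemma metric_transform_nth:
  assumes "c \<in> \<A>" "c' \<in> \<A>" "x \<in> overlap c c'"
  shows "g c x $ i $ j = J c c' 1 i x * J c c' 1 j x * g c' (transition c c' x) $ 1 $ 1
     + (J c c' 1 i x * J c c' 2 j x + J c c' 2 i x * J c c' 1 j x) * g c' (transition c c' x) $ 1 $
         2
     + J c c' 2 i x * J c c' 2 j x * g c' (transition c c' x) $ 2 $ 2"
  unfolding metric_transform[OF assms]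
  using metric_sym[OF assms(2) transition_overlap[OF assms(1,3)]]
  by (simp add: matrix_matrix_mult_def sum_2 transpose_def jacobian_nth algebra_simps)

text \<open>A substitute for invariance of domain: if another chart put \<open>p\<close> in the open
  half plane, the second component of the transition map would have an interior minimum there, its
  gradient would vanish, and the Jacobian would be singular.\<close>

lemma boundary_chart:
  assumes p: "p \<in> bdry S" and c: "c \<in> \<A>" "p \<in> chart_dom c"
  shows "chart_map c p $ 2 = 0"
proof (rule ccontr)
  assume nz: "chart_map c p $ 2 \<noteq> 0"
  obtain c' where c': "c' \<in> \<A>" "p \<in> chart_dom c'" "chart_map c' p $ 2 = 0"
    using p unfolding bdry_def by auto
  let ?x = "chart_map c p" and ?O = "overlap c c'"
  have x: "?x \<in> ?O" using c(2) c'(2) by (rule overlapI)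
  have pos: "0 < ?x $ 2" using nz hp_open_nonneg[OF overlap_open[OF c(1) c'(1)] x] by simp
  have "J c c' 2 i ?x = 0" for i
  proof (rule local_min_derivatives(1)[OF overlap_open[OF c(1) c'(1)] smooth_transition[OF c(1)
      c'(1)] x pos])
    show "transition c c' ?x $ 2 \<le> transition c c' y $ 2" if "y \<in> ?O" for y
      using hp_open_nonneg[OF chart_img_open[OF c'(1)] transition_overlap[OF c(1) that]] c c' 
      by (simp add: transition_map)
  qed (rule zero_less_one)
  then show False using det_jacobian_nz[OF c(1) c'(1) x] by (simp add: det_jacobian)
qed

lemma inter_chart:
  assumes p: "p \<in> inter S" and c: "c \<in> \<A>" "p \<in> chart_dom c"
  shows "0 < chart_map c p $ 2"
proof -
  have "chart_map c p $ 2 \<noteq> 0" using assms unfolding inter_def bdry_def by auto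
  then show ?thesis using hp_open_nonneg[OF chart_img_open[OF c(1)] chart_map_img[OF c(2)]] by simp
qed

section \<open>The selected chart and the Laplacian in divergence form\<close>

lemma chart_at:
  assumes "p \<in> M" shows "chart_at S p \<in> \<A>" "p \<in> chart_dom (chart_at S p)"
proof -
  have "\<exists>c. c \<in> \<A> \<and> p \<in> chart_dom c" using assms atlas_cover by blast
  then have "chart_at S p \<in> \<A> \<and> p \<in> chart_dom (chart_at S p)"
    unfolding chart_at_def by (rule someI_ex)
  then show "chart_at S p \<in> \<A>" "p \<in> chart_dom (chart_at S p)" by auto
qed

text \<open>The gradient as a vector density, for which the plain coordinate divergence is the right
  one.\<close>

definition flux :: "'a chart \<Rightarrow> (real^2 \<Rightarrow> real) \<Rightarrow> 2 \<Rightarrow> real^2 \<Rightarrow> real" where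
  "flux c f i y = sqrt (det (g c y)) * (\<Sum>j\<in>UNIV. metric_inv S c y $ i $ j * cpd c j f y)"

definition lap :: "'a chart \<Rightarrow> (real^2 \<Rightarrow> real) \<Rightarrow> real^2 \<Rightarrow> real" where
  "lap c f x = (cpd c 1 (flux c f 1) x + cpd c 2 (flux c f 2) x) / sqrt (det (g c x))"

lemma laplacian_lap: "laplacian S f p = lap (chart_at S p) (f \<circ> chart_inv (chart_at S p)) (chart_map
    (chart_at S p) p)"
  unfolding laplacian_def lap_def Let_def flux_def[abs_def] by (simp add: sum_2)

text \<open>In dimension two the inverse metric is the adjugate over the determinant, so a single
  factor \<open>sqrt (det g)\<close> survives in the denominator.\<close>

lemma flux_2:
  assumes c: "c \<in> \<A>" "x \<in> chart_img c"
  shows "flux c f 1 x = (g c x $ 2 $ 2 * cpd c 1 f x - g c x $ 1 $ 2 * cpd c 2 f x) / sqrt (det (g c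
      x))"
    "flux c f 2 x = (g c x $ 1 $ 1 * cpd c 2 f x - g c x $ 1 $ 2 * cpd c 1 f x) / sqrt (det (g c
        x))"
proof -
  have "sqrt (det (g c x)) * sqrt (det (g c x)) = det (g c x)" "sqrt (det (g c x)) \<noteq> 0"
    using metric_pos(2)[OF c] by auto
  then have "sqrt (det (g c x)) * (a / det (g c x)) = a / sqrt (det (g c x))" for a
    by (metis (no_types, opaque_lifting) mult.commute nonzero_divide_mult_cancel_left
        times_divide_eq_right mult_cancel_left divide_divide_eq_left' nonzero_mult_div_cancel_left)
  moreover have "flux c f 1 x = sqrt (det (g c x)) * ((g c x $ 2 $ 2 * cpd c 1 f x - g c x $ 1 $ 2 *
      cpd c 2 f x) / det (g c x))"
   "flux c f 2 x = sqrt (det (g c x)) * ((g c x $ 1 $ 1 * cpd c 2 f x - g c x $ 1 $ 2 * cpd c 1 f x)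
       / det (g c x))"
    unfolding flux_def sum_2 metric_inv_2[OF c] by (simp_all add: diff_divide_distrib)
  ultimately show "flux c f 1 x = (g c x $ 2 $ 2 * cpd c 1 f x - g c x $ 1 $ 2 * cpd c 2 f x) / sqrt
      (det (g c x))"
    "flux c f 2 x = (g c x $ 1 $ 1 * cpd c 2 f x - g c x $ 1 $ 2 * cpd c 1 f x) / sqrt (det (g c
        x))"
    by metis+
qed

lemma Ck_on_det: "c \<in> \<A> \<Longrightarrow> Ck_on n (chart_img c) (\<lambda>x. det (g c x))"
  unfolding det_2 by (intro Ck_on_diff Ck_on_mult smooth_metric chart_img_open)

lemma Ck_on_sqrt_det: "c \<in> \<A> \<Longrightarrow> Ck_on n (chart_img c) (\<lambda>x. sqrt (det (g c x)))"
  by (intro Ck_on_sqrt chart_img_open Ck_on_det metric_pos(2))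

lemma sqrt_det_nz: "c \<in> \<A> \<Longrightarrow> x \<in> chart_img c \<Longrightarrow> sqrt (det (g c x)) \<noteq> 0"
  using metric_pos(2) by fastforce

lemma Ck_on_flux:
  assumes c: "c \<in> \<A>" and f: "Ck_on 2 (chart_img c) f"
  shows "Ck_on (Suc 0) (chart_img c) (flux c f i)"
proof -
  note V = chart_img_open[OF c]
  have f': "Ck_on (Suc 0) (chart_img c) (cpd c j f)" for j
    using Ck_on_pdi f unfolding Ck_on_2 .
  have 1: "Ck_on (Suc 0) (chart_img c) (\<lambda>x. (g c x $ 2 $ 2 * cpd c 1 f x - g c x $ 1 $ 2 * cpd c 2 f
      x) / sqrt (det (g c x)))"
    by (intro Ck_on_divide Ck_on_diff Ck_on_mult V f' smooth_metric c Ck_on_sqrt_det sqrt_det_nz)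
  have 2: "Ck_on (Suc 0) (chart_img c) (\<lambda>x. (g c x $ 1 $ 1 * cpd c 2 f x - g c x $ 1 $ 2 * cpd c 1 f
      x) / sqrt (det (g c x)))"
    by (intro Ck_on_divide Ck_on_diff Ck_on_mult V f' smooth_metric c Ck_on_sqrt_det sqrt_det_nz)
  show ?thesis
    using 1 2 exhaust_2[of i] Ck_on_cong[of "chart_img c" "flux c f 1", OF flux_2(1)[OF c]]
      Ck_on_cong[of "chart_img c" "flux c f 2", OF flux_2(2)[OF c]] by auto
qed

lemma chart_function_transition:
  assumes "c \<in> \<A>" "c' \<in> \<A>" "x \<in> overlap c c'"
  shows "(f \<circ> chart_inv c) x = (f \<circ> chart_inv c') (transition c c' x)"
  using chart_inv_transition[OF assms] by simp

lemma cpd_transition: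
  assumes c: "c \<in> \<A>" "c' \<in> \<A>" and x: "x \<in> overlap c c'"
    and f: "Ck_on (Suc k) (chart_img c') (f \<circ> chart_inv c')"
  shows "cpd c i (f \<circ> chart_inv c) x =
     cpd c' 1 (f \<circ> chart_inv c') (transition c c' x) * J c c' 1 i x + cpd c' 2 (f \<circ> chart_inv c')
         (transition c c' x) * J c c' 2 i x"
proof -
  have "cpd c i (f \<circ> chart_inv c) x = pdi (overlap c c') i (f \<circ> chart_inv c) x"
    using pd_hp_open(2)[OF overlap_open[OF c] chart_img_open[OF c(1)] overlap_subset x] by simp
  also have "\<dots> = pdi (overlap c c') i (\<lambda>y. (f \<circ> chart_inv c') (transition c c' y)) x"
    by (rule pdi_cong[OF x]) (rule chart_function_transition[OF c])
  also have "\<dots> = cpd c' 1 (f \<circ> chart_inv c') (transition c c' x) * J c c' 1 i x + cpd c' 2 (f \<circ>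
      chart_inv c') (transition c c' x) * J c c' 2 i x"
    by (rule pdi_compose[OF overlap_open[OF c] x chart_img_open[OF c(2)] transition_overlap[OF c(1)]
        smooth_transition[OF c] f])
  finally show ?thesis .
qed

text \<open>Vector densities transform by the adjugate of the Jacobian. The sign \<open>s\<close>
  appears because \<open>sqrt (det g)\<close> only sees the absolute value of the Jacobian
  determinant, and transition maps may reverse orientation.\<close>

lemma flux_transition:
  assumes c: "c \<in> \<A>" "c' \<in> \<A>" and x: "x \<in> overlap c c'"
    and f: "Ck_on (Suc k) (chart_img c') (f \<circ> chart_inv c')"
  defines "s \<equiv> sgn (det (jacobian c c' x))"
  shows "flux c (f \<circ> chart_inv c) 1 x = s * (J c c' 2 2 x * flux c' (f \<circ> chart_inv c') 1 (transition
      c c' x) - J c c' 1 2 x * flux c' (f \<circ> chart_inv c') 2 (transition c c' x))"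
    "flux c (f \<circ> chart_inv c) 2 x = s * (J c c' 1 1 x * flux c' (f \<circ> chart_inv c') 2 (transition c
        c' x) - J c c' 2 1 x * flux c' (f \<circ> chart_inv c') 1 (transition c c' x))"
    "sqrt (det (g c x)) = s * det (jacobian c c' x) * sqrt (det (g c' (transition c c' x)))"
proof -
  let ?T = "transition c c' x" and ?F = "f \<circ> chart_inv c'"
  have xc: "x \<in> chart_img c" using x overlap_subset by blast
  note xc' = transition_overlap[OF c(1) x]
  define d where "d = det (jacobian c c' x)"
  have d: "d \<noteq> 0" "s * s = 1" "s * d = \<bar>d\<bar>"
    using det_jacobian_nz[OF c x] by (auto simp: s_def d_def sgn_if)
  define r where "r = sqrt (det (g c' ?T))"
  have r: "r \<noteq> 0" using sqrt_det_nz[OF c(2) xc'] by (simp add: r_def)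
  show sq: "sqrt (det (g c x)) = s * det (jacobian c c' x) * sqrt (det (g c' ?T))"
    unfolding det_metric_transform[OF c x] using d by (simp add: real_sqrt_mult d_def)
  \<comment> \<open>The numerator and the root of the determinant both carry the factor
    \<open>d\<close>; what is left is \<open>1 / s\<close>, and this is \<open>s\<close>.\<close>
  have cancel: "A / (s * d * r) = s * (B / r)" if "A = d * B" for A B
  proof -
    have "s \<noteq> 0" using d(2) by auto
    then have "A / (s * d * r) = (1 / s) * (B / r)" using that d(1) by simp
    also have "1 / s = s" using d(2) \<open>s \<noteq> 0\<close> by (metis nonzero_eq_divide_eq)
    finally show ?thesis .
  qed
  have dJ: "d = J c c' 1 1 x * J c c' 2 2 x - J c c' 1 2 x * J c c' 2 1 x" by (simp add: d_def
      det_jacobian)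
  show "flux c (f \<circ> chart_inv c) 1 x = s * (J c c' 2 2 x * flux c' ?F 1 ?T - J c c' 1 2 x * flux c'
      ?F 2 ?T)"
    unfolding flux_2[OF c(1) xc] flux_2[OF c(2) xc'] sq cpd_transition[OF c x f]
        metric_transform_nth[OF c x] d_def[symmetric] r_def[symmetric]
      times_divide_eq_right diff_divide_distrib[symmetric]
    by (subst times_divide_eq_right[symmetric], rule cancel) (simp add: dJ algebra_simps)
  show "flux c (f \<circ> chart_inv c) 2 x = s * (J c c' 1 1 x * flux c' ?F 2 ?T - J c c' 2 1 x * flux c'
      ?F 1 ?T)"
    unfolding flux_2[OF c(1) xc] flux_2[OF c(2) xc'] sq cpd_transition[OF c x f]
        metric_transform_nth[OF c x] d_def[symmetric] r_def[symmetric]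
      times_divide_eq_right diff_divide_distrib[symmetric]
    by (subst times_divide_eq_right[symmetric], rule cancel) (simp add: dJ algebra_simps)
qed

text \<open>The Piola identity: the rows of the adjugate of a Jacobian matrix are divergence free.\<close>

lemma lap_transition:
  assumes c: "c \<in> \<A>" "c' \<in> \<A>" and x: "x \<in> overlap c c'"
    and f: "Ck_on 2 (chart_img c') (f \<circ> chart_inv c')"
  shows "lap c (f \<circ> chart_inv c) x = lap c' (f \<circ> chart_inv c') (transition c c' x)"
proof -
  let ?O = "overlap c c'" and ?T = "transition c c'" and ?F = "flux c' (f \<circ> chart_inv c')" and ?G =
      "flux c (f \<circ> chart_inv c)"
  define s where "s = sgn (det (jacobian c c' x))"
  \<comment> \<open>On \<open>U\<close> the sign of the Jacobian determinant is constantly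
    \<open>s\<close>, so the rule for the flux holds with a fixed sign and can be differentiated at
    \<open>x\<close>.\<close>
  define U where "U = {y \<in> ?O. 0 < s * det (jacobian c c' y)}"
  note O = overlap_open[OF c]
  have f1: "Ck_on (Suc (Suc 0)) (chart_img c') (f \<circ> chart_inv c')" using f by (simp add: Ck_on_2)
  have "continuous_on ?O (\<lambda>y. s * det (jacobian c c' y))"
    unfolding det_jacobian
    by (intro continuous_intros Ck_on_imp_continuous[OF Ck_on_J[OF c]])
  then have U: "hp_open U" unfolding U_def by (rule openin_continuous_preimage_greaterThan[OF O])
  have UO: "U \<subseteq> ?O" unfolding U_def by auto
  have xU: "x \<in> U" using x det_jacobian_nz[OF c x] by (auto simp: U_def s_def sgn_if)
  have sU: "sgn (det (jacobian c c' y)) = s" if "y \<in> U" for y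
    using that det_jacobian_nz[OF c x] by (auto simp: U_def s_def sgn_if split: if_splits)
  have pdU: "pdi U i h x = pdi ?O i h x" for i h using pd_hp_open(2)[OF U O UO xU] .
  have pdV: "cpd c i h x = pdi U i h x" for i h
    using pd_hp_open(2)[OF U chart_img_open[OF c(1)] _ xU] UO overlap_subset[of c c'] by auto
  have JU: "Ck_on (Suc 0) U (J c c' k i)" for k i
    by (rule Ck_on_subset[OF U O UO Ck_on_J[OF c]])
  have TU: "Ck_on (Suc 0) U (\<lambda>y. ?T y $ k)" for k
    by (rule Ck_on_subset[OF U O UO smooth_transition[OF c]])
  have F1: "Ck_on (Suc 0) (chart_img c') (?F a)" for a by (rule Ck_on_flux[OF c(2) f])
  have TV: "?T y \<in> chart_img c'" if "y \<in> U" for y using transition_overlap[OF c(1)] UO that by blast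
  have FU: "Ck_on (Suc 0) U (\<lambda>y. ?F a (?T y))" for a
    by (rule Ck_on_compose[OF U chart_img_open[OF c(2)] TV F1 TU])
  have dF: "pdi U i (\<lambda>y. ?F a (?T y)) x = cpd c' 1 (?F a) (?T x) * J c c' 1 i x + cpd c' 2 (?F a)
      (?T x) * J c c' 2 i x" for i a
    using pdi_compose[OF U xU chart_img_open[OF c(2)] TV TU F1] unfolding pdU .
  have prod: "pdi U i (\<lambda>y. s * (J c c' k l y * ?F a (?T y) - J c c' k' l' y * ?F b (?T y))) x =
     s * (J c c' k l x * pdi U i (\<lambda>y. ?F a (?T y)) x + pdi ?O i (J c c' k l) x * ?F a (?T x)
       - (J c c' k' l' x * pdi U i (\<lambda>y. ?F b (?T y)) x + pdi ?O i (J c c' k' l') x * ?F b (?T x)))"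
           for i k l k' l' a b
    by (subst pdi_cmult[OF U xU Ck_on_diff[OF U Ck_on_mult[OF U JU FU] Ck_on_mult[OF U JU FU]]],
        subst pdi_diff[OF U xU Ck_on_mult[OF U JU FU] Ck_on_mult[OF U JU FU]],
        subst pdi_mult[OF U xU JU FU], subst pdi_mult[OF U xU JU FU], simp add: pdU)
  have "cpd c 1 (?G 1) x = pdi U 1 (\<lambda>y. s * (J c c' 2 2 y * ?F 1 (?T y) - J c c' 1 2 y * ?F 2 (?T
      y))) x"
    unfolding pdV by (rule pdi_cong[OF xU]) (use flux_transition(1)[OF c _ f1] sU UO in auto)
  moreover have "cpd c 2 (?G 2) x = pdi U 2 (\<lambda>y. s * (J c c' 1 1 y * ?F 2 (?T y) - J c c' 2 1 y * ?F
      1 (?T y))) x"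
    unfolding pdV by (rule pdi_cong[OF xU]) (use flux_transition(2)[OF c _ f1] sU UO in auto)
  moreover have "pdi ?O 1 (J c c' k 2) x = pdi ?O 2 (J c c' k 1) x" for k
    by (rule pdi_commute[OF O smooth_transition[OF c] x])
  ultimately have "cpd c 1 (?G 1) x + cpd c 2 (?G 2) x = s * det (jacobian c c' x) * (cpd c' 1 (?F
      1) (?T x) + cpd c' 2 (?F 2) (?T x))"
    unfolding prod dF det_jacobian by (simp add: algebra_simps)
  moreover have "s * det (jacobian c c' x) \<noteq> 0" using xU by (auto simp: U_def)
  ultimately show ?thesis
    unfolding lap_def flux_transition(3)[OF c x f1] s_def[symmetric] by simp
qed

lemma laplacian_chart:
  assumes p: "p \<in> M" and c: "c \<in> \<A>" "p \<in> chart_dom c"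
    and f: "Ck_on 2 (chart_img c) (f \<circ> chart_inv c)"
  shows "laplacian S f p = lap c (f \<circ> chart_inv c) (chart_map c p)"
  unfolding laplacian_lap
  using lap_transition[OF chart_at(1)[OF p] c(1) overlapI[OF chart_at(2)[OF p] c(2)] f]
    transition_map[OF chart_at[OF p], of c] by simp

text \<open>The first-order coefficients that appear when the divergence is expanded; classically
  minus the trace of the Christoffel symbols with upper index \<open>j\<close>.\<close>

definition lap_coeff :: "'a chart \<Rightarrow> 2 \<Rightarrow> real^2 \<Rightarrow> real" where
  "lap_coeff c j x = (cpd c 1 (\<lambda>y. sqrt (det (g c y)) * metric_inv S c y $ 1 $ j) x + cpd c 2 (\<lambda>y.
      sqrt (det (g c y)) * metric_inv S c y $ 2 $ j) x) / sqrt (det (g c x))"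

lemma Ck_on_metric_inv: "c \<in> \<A> \<Longrightarrow> Ck_on n (chart_img c) (\<lambda>x. metric_inv S c x $ i $ j)"
proof -
  assume c: "c \<in> \<A>"
  have *: "Ck_on n (chart_img c) (\<lambda>x. e * g c x $ k $ l / det (g c x))" for e k l
    using metric_pos(2)[OF c] by (intro Ck_on_divide Ck_on_mult Ck_on_const chart_img_open c
        smooth_metric Ck_on_det) force
  have "Ck_on n (chart_img c) (\<lambda>x. metric_inv S c x $ 1 $ 1)" "Ck_on n (chart_img c) (\<lambda>x. metric_inv
      S c x $ 1 $ 2)"
   "Ck_on n (chart_img c) (\<lambda>x. metric_inv S c x $ 2 $ 1)" "Ck_on n (chart_img c) (\<lambda>x. metric_inv S c
       x $ 2 $ 2)"
    using *[of 1 2 2] *[of "-1" 1 2] *[of 1 1 1]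
    by (simp_all add: metric_inv_2[OF c] cong: Ck_on_cong)
  then show ?thesis using exhaust_2[of i] exhaust_2[of j] by auto
qed

lemma continuous_lap_coeff: "c \<in> \<A> \<Longrightarrow> continuous_on (chart_img c) (lap_coeff c j)"
  unfolding lap_coeff_def[abs_def]
  by (intro continuous_intros Ck_on_imp_continuous[OF Ck_on_pdi[of 0]] Ck_on_mult chart_img_open
      Ck_on_sqrt_det Ck_on_metric_inv ballI
      Ck_on_imp_continuous[OF Ck_on_det] sqrt_det_nz)

lemma lap_expand:
  assumes c: "c \<in> \<A>" "x \<in> chart_img c" and f: "Ck_on 2 (chart_img c) f"
  shows "lap c f x = metric_inv S c x $ 1 $ 1 * cpd c 1 (cpd c 1 f) x
     + metric_inv S c x $ 1 $ 2 * (cpd c 1 (cpd c 2 f) x + cpd c 2 (cpd c 1 f) x)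
     + metric_inv S c x $ 2 $ 2 * cpd c 2 (cpd c 2 f) x
     + lap_coeff c 1 x * cpd c 1 f x + lap_coeff c 2 x * cpd c 2 f x"
proof -
  note V = chart_img_open[OF c(1)]
  have f': "Ck_on (Suc 0) (chart_img c) (cpd c j f)" for j
    using Ck_on_pdi f unfolding Ck_on_2 .
  let ?r = "\<lambda>y. sqrt (det (g c y))" and ?a = "\<lambda>i j y. metric_inv S c y $ i $ j"
  note ra = Ck_on_mult[OF V Ck_on_sqrt_det[OF c(1)] Ck_on_metric_inv[OF c(1)], of "Suc 0"]
  have fl: "flux c f i = (\<lambda>y. (?r y * ?a i 1 y) * cpd c 1 f y + (?r y * ?a i 2 y) * cpd c 2 f y)"
      for i
    by (auto simp: flux_def sum_2 algebra_simps)
  have "cpd c k (flux c f i) x = ?r x * ?a i 1 x * cpd c k (cpd c 1 f) x + cpd c k (\<lambda>y. ?r y * ?a i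
      1 y) x * cpd c 1 f x
      + (?r x * ?a i 2 x * cpd c k (cpd c 2 f) x + cpd c k (\<lambda>y. ?r y * ?a i 2 y) x * cpd c 2 f x)"
          for k i
    unfolding fl
    by (subst pdi_add[OF V c(2) Ck_on_mult[OF V ra f'] Ck_on_mult[OF V ra f']],
        subst pdi_mult[OF V c(2) ra f'], subst pdi_mult[OF V c(2) ra f'], simp)
  moreover have "?a 2 1 x = ?a 1 2 x" by (simp add: metric_inv_2[OF c])
  moreover define r where "r = ?r x"
  moreover have "r \<noteq> 0" unfolding r_def by (rule sqrt_det_nz[OF c])
  ultimately show ?thesis unfolding lap_def lap_coeff_def r_def[symmetric]
    by (simp add: field_simps)
qed

end

section \<open>Curvature and normal derivative at the boundary\<close>

lemma pdi_tangential:
  assumes V: "hp_open V" "x \<in> V" and f: "\<And>y. y \<in> V \<Longrightarrow> y $ 2 = x $ 2 \<Longrightarrow> f y = c"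
  shows "pdi V 1 f x = 0"
proof -
  have "((\<lambda>s. f (x + s *\<^sub>R axis 1 1)) has_vector_derivative 0) (at 0 within {s. x + s *\<^sub>R axis 1 1 \<in>
      V})"
    unfolding has_vector_derivative_def
    by (rule has_derivative_transform[where f = "\<lambda>s. c"]) (use V f in auto)
  then show ?thesis unfolding pd_def
    using vector_derivative_within line_nontrivial[OF V] by blast
qed

lemma pdi_normal_nonneg:
  assumes V: "hp_open V" "x \<in> V" and f: "Ck_on (Suc k) V f"
    and "0 < e" and le: "\<And>s. 0 < s \<Longrightarrow> s < e \<Longrightarrow> x + s *\<^sub>R axis 2 1 \<in> V \<Longrightarrow> f x \<le> f (x + s *\<^sub>R axis 2 1)"
  shows "0 \<le> pdi V 2 f x"
proof -
  obtain r where r: "r > 0" "\<And>y. 0 \<le> y $ 2 \<Longrightarrow> dist y x < r \<Longrightarrow> y \<in> V" using hp_openD[OF V] by blast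
  have x2: "0 \<le> x $ 2" using hp_open_nonneg[OF V] .
  have inV: "x + s *\<^sub>R axis 2 1 \<in> V" if "0 \<le> s" "s < r" for s
    by (rule r(2)) (use that x2 in \<open>auto simp: dist_norm\<close>)
  have "((\<lambda>s. f (x + s *\<^sub>R axis 2 1)) has_real_derivative pdi V 2 f x) (at 0 within {s. x + s *\<^sub>R
      axis 2 1 \<in> V})"
    using Ck_on_line_derivative[OF V(1) f, of x 0 "axis 2 1"] V(2) by simp
  then have "((\<lambda>s. f (x + s *\<^sub>R axis 2 1)) has_real_derivative pdi V 2 f x) (at 0 within {0..<r})"
    by (rule has_field_derivative_subset) (use inV in auto)
  then have "((\<lambda>s. (f (x + s *\<^sub>R axis 2 1) - f (x + 0 *\<^sub>R axis 2 1)) / (s - 0)) \<longlongrightarrow> pdi V 2 f x) (at 0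
      within {0..<r})"
    unfolding has_field_derivative_iff .
  moreover have "\<forall>\<^sub>F s in at 0 within {0..<r}. 0 \<le> (f (x + s *\<^sub>R axis 2 1) - f (x + 0 *\<^sub>R axis 2 1))
      / (s - 0)"
    unfolding eventually_at using le inV \<open>0 < e\<close>
    by (intro exI[of _ e]) (auto simp: dist_real_def)
  moreover have "at 0 within {0..<r} \<noteq> bot"
    using r(1) islimpt_greaterThanLessThan1[of 0 r]
    by (auto simp: trivial_limit_within intro: islimpt_subset[of _ "{0<..<r}"])
  ultimately show ?thesis by (rule tendsto_lowerbound)
qed

text \<open>Orthogonality to \<open>axis 1 1\<close> fixes the line spanned by
  \<open>(b, - a)\<close>, whose squared length is \<open>a * D\<close>; the sign condition selects
  the outward direction.\<close>

lemma outward_normal_eq: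
  assumes sym: "surf_metric S c x $ 2 $ 1 = surf_metric S c x $ 1 $ 2"
    and pos: "0 < surf_metric S c x $ 1 $ 1" "0 < det (surf_metric S c x)"
  shows "outward_normal S c x = (1 / sqrt (surf_metric S c x $ 1 $ 1 * det (surf_metric S c x))) *\<^sub>R
      vector [surf_metric S c x $ 1 $ 2, - surf_metric S c x $ 1 $ 1]" (is "_ = ?n")
proof -
  define a b d where "a = surf_metric S c x $ 1 $ 1" and "b = surf_metric S c x $ 1 $ 2" and "d =
      surf_metric S c x $ 2 $ 2"
  define D where "D = det (surf_metric S c x)"
  have D: "D = a * d - b * b" using sym by (simp add: D_def a_def b_def d_def det_2)
  define r where "r = sqrt (a * D)"
  have ap: "0 < a" "0 < D" using pos by (auto simp: a_def D_def)
  then have r: "0 < r" "r * r = a * D" by (auto simp: r_def)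
  have e1: "n \<bullet> (surf_metric S c x *v axis 1 1) = n $ 1 * a + n $ 2 * b" for n
    using sym by (simp add: inner_real2 matrix_vector_mult_def sum_2 a_def b_def)
  have e2: "n \<bullet> (surf_metric S c x *v n) = n $ 1 * n $ 1 * a + 2 * (n $ 1 * n $ 2 * b) + n $ 2 * n $
      2 * d" for n
    using sym by (simp add: inner_real2 matrix_vector_mult_def sum_2 a_def b_def d_def
        algebra_simps)
  have n: "?n $ 1 = b / r" "?n $ 2 = - a / r"
    by (simp_all add: r_def a_def b_def D_def)
  show ?thesis unfolding outward_normal_def e1 e2
  proof (rule the_equality)
    have "b * b * a + 2 * (b * (- a) * b) + a * a * d = r * r" using r(2) unfolding D by (simp add:
        algebra_simps)
    then have "(b * b * a + 2 * (b * (- a) * b) + a * a * d) / (r * r) = 1" using r(1) by simp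
    then have "b / r * (b / r) * a + 2 * (b / r * (- a / r) * b) + - a / r * (- a / r) * d = 1"
      by (simp add: add_divide_distrib diff_divide_distrib)
    then show "?n $ 1 * a + ?n $ 2 * b = 0 \<and> ?n $ 1 * ?n $ 1 * a + 2 * (?n $ 1 * ?n $ 2 * b) + ?n $
        2 * ?n $ 2 * d = 1 \<and> ?n $ 2 < 0"
      unfolding n using r ap by (simp add: divide_neg_pos)
  next
    fix m :: "real^2"
    assume m: "m $ 1 * a + m $ 2 * b = 0 \<and> m $ 1 * m $ 1 * a + 2 * (m $ 1 * m $ 2 * b) + m $ 2 * m $
        2 * d = 1 \<and> m $ 2 < 0"
    then have m1: "m $ 1 * a = - (m $ 2 * b)" by linarith
    have "(m $ 1 * a) * (m $ 1 * a) + 2 * ((m $ 1 * a) * m $ 2 * b) + m $ 2 * m $ 2 * d * a = a * 1"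
      using m by (auto simp: algebra_simps dest!: arg_cong[of _ 1 "\<lambda>t. a * t"])
    then have "m $ 2 * m $ 2 * D = a" unfolding m1 D by (simp add: algebra_simps)
    then have "(m $ 2 * r) * (m $ 2 * r) = a * a"
      using r(2) by (metis mult.assoc mult.commute)
    then have "(- (m $ 2 * r))\<^sup>2 = a\<^sup>2" by (simp add: power2_eq_square)
    moreover have "0 \<le> - (m $ 2 * r)" using m r(1) by (simp add: mult_nonpos_nonneg)
    ultimately have "- (m $ 2 * r) = a" by (rule power2_eq_imp_eq) (use ap in simp)
    then have m2: "m $ 2 = - a / r" using r(1) by (simp add: field_simps)
    then have "m $ 1 * a = b / r * a" using m1 by simp
    then have "m $ 1 = b / r" using ap(1) by (metis less_irrefl mult_right_cancel)
    with m2 n show "m = ?n" by (simp add: vec_eq_iff forall_2)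
  qed
qed

text \<open>This is \<open>2 * det g\<close> times the Christoffel symbol with upper index 2 and
  lower indices 1, 1. Clearing the denominator makes the rules under conformal and coordinate change
  polynomial.\<close>

definition curvature_numerator :: "'a surface \<Rightarrow> 'a chart \<Rightarrow> real^2 \<Rightarrow> real" where
  "curvature_numerator S c x =
     surf_metric S c x $ 1 $ 1 * (2 * cpd c 1 (\<lambda>y. surf_metric S c y $ 1 $ 2) x - cpd c 2 (\<lambda>y.
         surf_metric S c y $ 1 $ 1) x)
     - surf_metric S c x $ 1 $ 2 * cpd c 1 (\<lambda>y. surf_metric S c y $ 1 $ 1) x"

text \<open>The covector of the normal has no first component and the tangent field no second one,
  so a single Christoffel symbol contributes. The statement stands outside the locale because it is
  also applied to \<open>conformal S w\<close>, where \<open>w\<close> is merely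
  \<open>C^2\<close>.\<close>

lemma geodesic_curvature_eq:
  assumes c: "c = chart_at S p" "x = chart_map c p" and V: "hp_open (chart_img c)" "x \<in> chart_img c"
    and sym: "surf_metric S c x $ 2 $ 1 = surf_metric S c x $ 1 $ 2"
    and pos: "0 < surf_metric S c x $ 1 $ 1" "0 < det (surf_metric S c x)"
  shows "geodesic_curvature S p = curvature_numerator S c x /
     (2 * surf_metric S c x $ 1 $ 1 * sqrt (surf_metric S c x $ 1 $ 1 * det (surf_metric S c x)))"
proof -
  define a b d where "a = surf_metric S c x $ 1 $ 1" and "b = surf_metric S c x $ 1 $ 2" and "d =
      surf_metric S c x $ 2 $ 2"
  define D where "D = det (surf_metric S c x)"
  have D: "D = a * d - b * b" using sym by (simp add: D_def a_def b_def d_def det_2)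
  define r where "r = sqrt (a * D)"
  have ap: "0 < a" "0 < D" using pos by (auto simp: a_def D_def)
  then have r: "0 < r" "r * r = a * D" by (auto simp: r_def)
  let ?n = "outward_normal S c x" and ?A = "tangent_acceleration S c x"
  have n: "?n = (1 / r) *\<^sub>R vector [b, - a]"
    unfolding outward_normal_eq[OF sym pos] by (simp add: r_def a_def b_def D_def)
  have gn: "(surf_metric S c x *v ?n) $ 1 = 0" "(surf_metric S c x *v ?n) $ 2 = - D / r"
    unfolding n D using sym by (simp_all add: matrix_vector_mult_def sum_2 a_def b_def d_def
        diff_divide_distrib algebra_simps)
  have "det (surf_metric S c x) \<noteq> 0" using pos by simp
  note inv = matrix_inv_2[OF this, folded metric_inv_def, folded D_def a_def]
  have ut: "unit_tangent S c x $ 1 * unit_tangent S c x $ 1 = 1 / a" "unit_tangent S c y $ 2 = 0"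
      for y
    using ap by (auto simp: unit_tangent_def a_def real_sqrt_mult_self)
  have "?A $ 2 = christoffel S c 2 1 1 x * (unit_tangent S c x $ 1 * unit_tangent S c x $ 1)"
    by (simp add: tangent_acceleration_def sum_2 ut(2) pdi_const[OF V])
  also have "\<dots> = curvature_numerator S c x / (2 * a * D)"
    unfolding ut christoffel_def sum_2 inv curvature_numerator_def using sym ap
    by (simp add: a_def[symmetric] b_def[symmetric] D_def[symmetric] divide_simps)
  finally have "geodesic_curvature S p = curvature_numerator S c x / (2 * a * D) * (D / r)"
    unfolding geodesic_curvature_def Let_def c(1)[symmetric] c(2)[symmetric] inner_real2 gn by simp
  also have "\<dots> = curvature_numerator S c x / (2 * a * r)" using ap r by simp
  finally show ?thesis by (simp add: a_def r_def D_def)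
qed

lemma normal_derivative_eq:
  assumes c: "c = chart_at S p" "x = chart_map c p"
    and sym: "surf_metric S c x $ 2 $ 1 = surf_metric S c x $ 1 $ 2"
    and pos: "0 < surf_metric S c x $ 1 $ 1" "0 < det (surf_metric S c x)"
  shows "normal_derivative S f p =
     (surf_metric S c x $ 1 $ 2 * cpd c 1 (f \<circ> chart_inv c) x - surf_metric S c x $ 1 $ 1 * cpd c 2
         (f \<circ> chart_inv c) x)
       / sqrt (surf_metric S c x $ 1 $ 1 * det (surf_metric S c x))"
  unfolding normal_derivative_def Let_def c(1)[symmetric] c(2)[symmetric] outward_normal_eq[OF sym
      pos] sum_2
  by (simp add: diff_divide_distrib)

lemma chart_at_conformal [simp]: "chart_at (conformal S w) = chart_at S"
  by (auto simp: chart_at_def conformal_def)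

lemma surf_metric_conformal [simp]: "surf_metric (conformal S w) c x = exp (2 * w (chart_inv c x))
    *\<^sub>R surf_metric S c x"
  by (simp add: conformal_def)

section \<open>Conformal change, and chart independence at the boundary\<close>

context riemannian_surface
begin

text \<open>With the factor \<open>E = exp (2 * w)\<close> the numerator becomes
  \<open>E * E\<close> times the sum of the old one and
  \<open>2 * a * (b * d1 w - a * d2 w)\<close>; the new term divided by
  \<open>2 * a * sqrt (a * D)\<close> is the normal derivative. The denominator scales by
  \<open>exp (5 * w)\<close>, which leaves \<open>exp (- w)\<close>.\<close>

lemma geodesic_curvature_conformal:
  assumes p: "p \<in> M" and w: "\<And>c. c \<in> \<A> \<Longrightarrow> Ck_on 2 (chart_img c) (w \<circ> chart_inv c)"
  shows "geodesic_curvature (conformal S w) p = exp (- w p) * (normal_derivative S w p +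
      geodesic_curvature S p)"
proof -
  define c x where "c = chart_at S p" and "x = chart_map c p"
  have c: "c \<in> \<A>" "p \<in> chart_dom c" using chart_at[OF p] by (auto simp: c_def)
  have x: "x \<in> chart_img c" using c by (simp add: x_def)
  note V = chart_img_open[OF c(1)] x
  define W where "W = w \<circ> chart_inv c"
  have W: "Ck_on (Suc 0) (chart_img c) W" using w[OF c(1)] Ck_on_mono[of 2 _ _ "Suc 0"] by (simp
      add: W_def)
  define E where "E = (\<lambda>y. exp (2 * W y))"
  have E': "cpd c i E x = E x * (2 * cpd c i W x)" for i
  proof -
    have "((\<lambda>t. exp (2 * t)) has_real_derivative (exp (2 * W x) * 2)) (at (W x))"
      by (auto intro!: derivative_eq_intros)
    from pdi_real_compose[OF V W this] show ?thesis by (simp add: E_def)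
  qed
  have E1: "Ck_on (Suc 0) (chart_img c) E"
  proof (rule Ck_on_SucI[OF V(1)])
    fix y assume y: "y \<in> chart_img c"
    have "((\<lambda>t. exp (2 * t)) has_real_derivative (exp (2 * W y) * 2)) (at (W y))"
      by (auto intro!: derivative_eq_intros)
    from DERIV_compose_FDERIV[OF this C1_has_derivative[OF V(1) y W]]
    show "(E has_derivative (\<lambda>h. (E y * 2 * cpd c 1 W y) * h $ 1 + (E y * 2 * cpd c 2 W y) * h $ 2))
        (at y within chart_img c)"
      by (simp add: E_def algebra_simps)
  next
    have "continuous_on (chart_img c) E" unfolding E_def
      by (intro continuous_intros Ck_on_imp_continuous[OF W])
    then show "Ck_on 0 (chart_img c) (\<lambda>y. E y * 2 * cpd c 1 W y)" "Ck_on 0 (chart_img c) (\<lambda>y. E y *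
        2 * cpd c 2 W y)"
      using Ck_on_pdi[OF W] by (auto intro!: continuous_intros)
  qed
  have EG: "cpd c k (\<lambda>y. exp (2 * w (chart_inv c y)) * g c y $ i $ j) x = E x * (cpd c k (\<lambda>y. g c y
      $ i $ j) x + 2 * cpd c k W x * g c x $ i $ j)" for i j k
    using pdi_mult[OF V E1 smooth_metric[OF c(1)], of k i j] unfolding E' by (simp add: E_def W_def
        algebra_simps)
  define e where "e = exp (w p)"
  have e: "0 < e" "exp (2 * w (chart_inv c x)) = e * e" "E x = e * e" "exp (- w p) = 1 / e"
    using c exp_add[of "w p" "w p"] by (simp_all add: e_def x_def E_def W_def exp_minus
        inverse_eq_divide)
  define a b D where "a = g c x $ 1 $ 1" and "b = g c x $ 1 $ 2" and "D = det (g c x)"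
  have pos: "0 < a" "0 < D" using metric_pos[OF c(1) x] by (auto simp: a_def D_def)
  define r where "r = sqrt (a * D)"
  have r: "0 < r" using pos by (simp add: r_def)
  have D': "det ((e * e) *\<^sub>R g c x) = (e * e) * (e * e) * D" unfolding D_def det_2 by (simp add:
      algebra_simps)
  have r': "sqrt (e * e * a * (e * e * (e * e) * D)) = e * e * e * r"
  proof -
    have "e * e * a * (e * e * (e * e) * D) = (e * e * e)\<^sup>2 * (a * D)" by (simp add:
        power2_eq_square algebra_simps)
    then show ?thesis using e(1) by (simp add: real_sqrt_mult r_def)
  qed
  have N: "curvature_numerator (conformal S w) c x = e * e * (e * e) * (curvature_numerator S c x +
      2 * a * (b * cpd c 1 W x - a * cpd c 2 W x))"
    unfolding curvature_numerator_def surf_metric_conformal scaleR_matrix_vector_assoc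
        vector_scaleR_component real_scaleR_def EG e(2,3)
    unfolding a_def[symmetric] b_def[symmetric]
    by (simp add: algebra_simps)
  have "geodesic_curvature (conformal S w) p = e * e * (e * e) * (curvature_numerator S c x + 2 * a
      * (b * cpd c 1 W x - a * cpd c 2 W x)) / (2 * (e * e * a) * (e * e * e * r))"
    using geodesic_curvature_eq[of c "conformal S w" p x, OF _ x_def V]
      metric_sym[OF c(1) x] pos e N D' r'
    by (simp add: c_def[symmetric] a_def[symmetric])
  also have "\<dots> = (1 / e) * ((b * cpd c 1 W x - a * cpd c 2 W x) / r + curvature_numerator S c x / (2
      * a * r))"
    using e(1) pos r by (simp add: field_simps)
  also have "(b * cpd c 1 W x - a * cpd c 2 W x) / r = normal_derivative S w p"
    using normal_derivative_eq[OF c_def x_def metric_sym[OF c(1) x] metric_pos[OF c(1) x], of w]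
    by (simp add: W_def r_def a_def b_def D_def)
  also have "curvature_numerator S c x / (2 * a * r) = geodesic_curvature S p"
    using geodesic_curvature_eq[OF c_def x_def V metric_sym[OF c(1) x] metric_pos[OF c(1) x]]
    by (simp add: r_def a_def D_def)
  finally show ?thesis using e(4) by simp
qed

text \<open>A transition map fixes the boundary line, so at boundary points its Jacobian is upper
    triangular
  and stays so in the tangential direction.\<close>

lemma boundary_jacobian:
  assumes p: "p \<in> bdry S" and c: "c \<in> \<A>" "p \<in> chart_dom c" and c': "c' \<in> \<A>" "p \<in> chart_dom c'"
  shows "J c c' 2 1 (chart_map c p) = 0" "0 < J c c' 2 2 (chart_map c p)"
    "pdi (overlap c c') 1 (J c c' 2 1) (chart_map c p) = 0"
proof -
  note O = overlap_open[OF c(1) c'(1)] overlapI[OF c(2) c'(2)]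
  have T0: "transition c c' y $ 2 = 0" if y: "y \<in> overlap c c'" "y $ 2 = 0" for y
  proof -
    obtain q where q: "q \<in> chart_dom c" "q \<in> chart_dom c'" "y = chart_map c q" using overlapE[OF
        y(1)] .
    then have "q \<in> bdry S" using y(2) c(1) chart_dom_subset[OF c(1)] unfolding bdry_def by auto
    then show ?thesis using boundary_chart[OF _ c'(1) q(2)] transition_map[OF c(1) q(1)] q(3) by
        simp
  qed
  have x2: "chart_map c p $ 2 = 0" by (rule boundary_chart[OF p c])
  have J0: "J c c' 2 1 y = 0" if y: "y \<in> overlap c c'" "y $ 2 = 0" for y
    by (rule pdi_tangential[OF O(1) y(1), of _ 0]) (use T0 y in auto)
  then show j: "J c c' 2 1 (chart_map c p) = 0" using O(2) x2 by blast
  show "pdi (overlap c c') 1 (J c c' 2 1) (chart_map c p) = 0"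
    by (rule pdi_tangential[OF O, of _ 0]) (use J0 x2 in auto)
  have "0 \<le> J c c' 2 2 (chart_map c p)"
  proof (rule pdi_normal_nonneg[OF O smooth_transition[OF c(1) c'(1), of "Suc 0"] zero_less_one])
    fix s assume "chart_map c p + s *\<^sub>R axis 2 1 \<in> overlap c c'"
    from hp_open_nonneg[OF chart_img_open[OF c'(1)] transition_overlap[OF c(1) this]]
    show "transition c c' (chart_map c p) $ 2 \<le> transition c c' (chart_map c p + s *\<^sub>R axis 2 1) $
        2"
      using T0[OF O(2) x2] by simp
  qed
  moreover have "J c c' 2 2 (chart_map c p) \<noteq> 0"
    using det_jacobian_nz[OF c(1) c'(1) O(2)] j by (auto simp: det_jacobian)
  ultimately show "0 < J c c' 2 2 (chart_map c p)" by simp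
qed

lemma boundary_metric_transform:
  assumes p: "p \<in> bdry S" and c: "c \<in> \<A>" "p \<in> chart_dom c" and c': "c' \<in> \<A>" "p \<in> chart_dom c'"
  defines "x \<equiv> chart_map c p" and "y \<equiv> chart_map c' p"
  shows "g c x $ 1 $ 1 = J c c' 1 1 x * J c c' 1 1 x * g c' y $ 1 $ 1"
    "g c x $ 1 $ 2 = J c c' 1 1 x * (J c c' 1 2 x * g c' y $ 1 $ 1 + J c c' 2 2 x * g c' y $ 1 $ 2)"
    "sqrt (g c x $ 1 $ 1 * det (g c x)) = J c c' 1 1 x * J c c' 1 1 x * J c c' 2 2 x * sqrt (g c' y
        $ 1 $ 1 * det (g c' y))"
    "J c c' 1 1 x \<noteq> 0"
proof -
  note xO = overlapI[OF c(2) c'(2), folded x_def]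
  have y: "transition c c' x = y" using transition_map[OF c] by (simp add: x_def y_def)
  note j = boundary_jacobian(1,2)[OF p c c', folded x_def]
  show g11: "g c x $ 1 $ 1 = J c c' 1 1 x * J c c' 1 1 x * g c' y $ 1 $ 1"
    "g c x $ 1 $ 2 = J c c' 1 1 x * (J c c' 1 2 x * g c' y $ 1 $ 1 + J c c' 2 2 x * g c' y $ 1 $ 2)"
    unfolding metric_transform_nth[OF c(1) c'(1) xO] y j by (simp_all add: algebra_simps)
  show "J c c' 1 1 x \<noteq> 0" using det_jacobian_nz[OF c(1) c'(1) xO] j by (auto simp: det_jacobian)
  have "g c x $ 1 $ 1 * det (g c x) = (J c c' 1 1 x * J c c' 1 1 x * J c c' 2 2 x)\<^sup>2 * (g c' y $ 1 $
      1 * det (g c' y))"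
    unfolding g11 det_metric_transform[OF c(1) c'(1) xO] y det_jacobian j by (simp add:
        power2_eq_square algebra_simps)
  moreover have "0 \<le> J c c' 1 1 x * J c c' 1 1 x * J c c' 2 2 x" using j(2) by simp
  ultimately show "sqrt (g c x $ 1 $ 1 * det (g c x)) = J c c' 1 1 x * J c c' 1 1 x * J c c' 2 2 x *
      sqrt (g c' y $ 1 $ 1 * det (g c' y))"
    by (simp add: real_sqrt_mult)
qed

text \<open>The operators are evaluated in the selected chart \<open>chart_at S p\<close>, which may
  jump with \<open>p\<close>, while the estimates use one chart for all \<open>p\<close> near a
  given boundary point.\<close>

lemma normal_derivative_chart:
  assumes p: "p \<in> bdry S" and c': "c' \<in> \<A>" "p \<in> chart_dom c'"
    and f: "Ck_on 2 (chart_img c') (f \<circ> chart_inv c')"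
  defines "y \<equiv> chart_map c' p"
  shows "normal_derivative S f p = (g c' y $ 1 $ 2 * cpd c' 1 (f \<circ> chart_inv c') y - g c' y $ 1 $ 1
      * cpd c' 2 (f \<circ> chart_inv c') y)
       / sqrt (g c' y $ 1 $ 1 * det (g c' y))"
proof -
  have pM: "p \<in> M" using p by (simp add: bdry_def)
  define c x where "c = chart_at S p" and "x = chart_map c p"
  have c: "c \<in> \<A>" "p \<in> chart_dom c" using chart_at[OF pM] by (auto simp: c_def)
  have x: "x \<in> chart_img c" using c by (simp add: x_def)
  note xO = overlapI[OF c(2) c'(2), folded x_def]
  have y: "transition c c' x = y" using transition_map[OF c] by (simp add: x_def y_def)
  note j = boundary_jacobian(1,2)[OF p c c', folded x_def]
  note G = boundary_metric_transform[OF p c c', folded x_def y_def]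
  have f1: "Ck_on (Suc (Suc 0)) (chart_img c') (f \<circ> chart_inv c')" using f by (simp add: Ck_on_2)
  define a b d where "a = J c c' 1 1 x" and "b = J c c' 1 2 x" and "d = J c c' 2 2 x"
  have q: "a * a * d \<noteq> 0" using G(4) j(2) by (simp add: a_def d_def)
  show ?thesis
    unfolding normal_derivative_eq[OF c_def x_def metric_sym[OF c(1) x] metric_pos[OF c(1) x]]
      cpd_transition[OF c(1) c'(1) xO f1] y G(3) j
    unfolding G(1,2) a_def[symmetric] b_def[symmetric] d_def[symmetric]
    by (subst mult_divide_mult_cancel_left[OF q, symmetric]) (simp add: algebra_simps)
qed

text \<open>Second derivatives of the transition map enter through the derivatives of the metric.
  The tangential derivative of \<open>J c c' 2 1\<close> vanishes, the mixed ones cancel by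
  symmetry, and the terms with the tangential derivative of \<open>J c c' 1 1\<close> cancel between
  the two summands of the numerator.\<close>

lemma curvature_numerator_transform:
  assumes p: "p \<in> bdry S" and c: "c \<in> \<A>" "p \<in> chart_dom c" and c': "c' \<in> \<A>" "p \<in> chart_dom c'"
  defines "x \<equiv> chart_map c p" and "y \<equiv> chart_map c' p"
  shows "curvature_numerator S c x = (J c c' 1 1 x)^4 * J c c' 2 2 x * curvature_numerator S c' y"
proof -
  let ?O = "overlap c c'" and ?T = "transition c c'"
  note O = overlap_open[OF c(1) c'(1)]
  note xO = overlapI[OF c(2) c'(2), folded x_def]
  have y: "?T x = y" using transition_map[OF c] by (simp add: x_def y_def)
  note j = boundary_jacobian[OF p c c', folded x_def]
  note G = boundary_metric_transform[OF p c c', folded x_def y_def]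
  note JO = Ck_on_J[OF c(1) c'(1), of "Suc 0"]
  let ?h = "\<lambda>i j z. g c' (?T z) $ i $ j"
  have hO: "Ck_on (Suc 0) ?O (?h i j)" for i j
    by (rule Ck_on_compose[OF O chart_img_open[OF c'(1)] transition_overlap[OF c(1)]
        smooth_metric[OF c'(1)] smooth_transition[OF c(1) c'(1)]])
  have dh: "pdi ?O k (?h i j) x = cpd c' 1 (\<lambda>z. g c' z $ i $ j) y * J c c' 1 k x + cpd c' 2 (\<lambda>z. g
      c' z $ i $ j) y * J c c' 2 k x" for i j k
    using pdi_compose[OF O xO chart_img_open[OF c'(1)] transition_overlap[OF c(1)]
        smooth_transition[OF c(1) c'(1)] smooth_metric[OF c'(1)]]
    unfolding y by blast
  have d3: "pdi ?O k (\<lambda>z. J c c' a i z * J c c' b l z * ?h m n z) x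
     = J c c' a i x * J c c' b l x * pdi ?O k (?h m n) x + (J c c' a i x * pdi ?O k (J c c' b l) x +
         pdi ?O k (J c c' a i) x * J c c' b l x) * g c' y $ m $ n"
    for a b i l m n k
    by (subst pdi_mult[OF O xO Ck_on_mult[OF O JO JO] hO], subst pdi_mult[OF O xO JO JO]) (simp add:
        y)
  note JJh = Ck_on_mult[OF O Ck_on_mult[OF O JO JO] hO]
  have dg: "cpd c k (\<lambda>z. g c z $ i $ l) x =
      pdi ?O k (\<lambda>z. J c c' 1 i z * J c c' 1 l z * ?h 1 1 z) x
    + pdi ?O k (\<lambda>z. J c c' 1 i z * J c c' 2 l z * ?h 1 2 z) x
    + pdi ?O k (\<lambda>z. J c c' 2 i z * J c c' 1 l z * ?h 1 2 z) x
    + pdi ?O k (\<lambda>z. J c c' 2 i z * J c c' 2 l z * ?h 2 2 z) x" for i l k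
  proof -
    have "cpd c k (\<lambda>z. g c z $ i $ l) x = pdi ?O k (\<lambda>z. g c z $ i $ l) x"
      using pd_hp_open(2)[OF O chart_img_open[OF c(1)] overlap_subset xO] by simp
    also have "\<dots> = pdi ?O k (\<lambda>z. J c c' 1 i z * J c c' 1 l z * ?h 1 1 z + J c c' 1 i z * J c c' 2 l
        z * ?h 1 2 z
        + J c c' 2 i z * J c c' 1 l z * ?h 1 2 z + J c c' 2 i z * J c c' 2 l z * ?h 2 2 z) x"
      by (rule pdi_cong[OF xO], subst metric_transform_nth[OF c(1) c'(1)]) (auto simp:
          algebra_simps)
    finally show ?thesis
      by (simp only: pdi_add[OF O xO Ck_on_add[OF O Ck_on_add[OF O JJh JJh] JJh] JJh]
        pdi_add[OF O xO Ck_on_add[OF O JJh JJh] JJh] pdi_add[OF O xO JJh JJh])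
  qed
  have sch: "pdi ?O 1 (J c c' m 2) x = pdi ?O 2 (J c c' m 1) x" for m
    by (rule pdi_commute[OF O smooth_transition[OF c(1) c'(1)] xO])
  show ?thesis
    unfolding curvature_numerator_def[of S c x] dg d3 dh sch j(1) j(3) G(1,2)
    unfolding curvature_numerator_def
    by (simp add: algebra_simps power4_eq_xxxx)
qed

text \<open>Makes sense off the boundary line as well, so that continuity on a compact half ball
  bounds the geodesic curvature.\<close>

definition boundary_curvature :: "'a chart \<Rightarrow> real^2 \<Rightarrow> real" where
  "boundary_curvature c x = curvature_numerator S c x / (2 * g c x $ 1 $ 1 * sqrt (g c x $ 1 $ 1 *
      det (g c x)))"

lemma geodesic_curvature_chart:
  assumes p: "p \<in> bdry S" and c': "c' \<in> \<A>" "p \<in> chart_dom c'"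
  shows "geodesic_curvature S p = boundary_curvature c' (chart_map c' p)"
proof -
  have pM: "p \<in> M" using p by (simp add: bdry_def)
  define c x where "c = chart_at S p" and "x = chart_map c p"
  define y where "y = chart_map c' p"
  have c: "c \<in> \<A>" "p \<in> chart_dom c" using chart_at[OF pM] by (auto simp: c_def)
  have x: "x \<in> chart_img c" using c by (simp add: x_def)
  note j = boundary_jacobian(1,2)[OF p c c', folded x_def]
  note G = boundary_metric_transform[OF p c c', folded x_def y_def]
  note N = curvature_numerator_transform[OF p c c', folded x_def y_def]
  define a d where "a = J c c' 1 1 x" and "d = J c c' 2 2 x"
  have q: "a ^ 4 * d \<noteq> 0" using G(4) j(2) by (simp add: a_def d_def)
  have "geodesic_curvature S p = a ^ 4 * d * curvature_numerator S c' y / (a ^ 4 * d * (2 * g c' y $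
      1 $ 1 * sqrt (g c' y $ 1 $ 1 * det (g c' y))))"
    unfolding geodesic_curvature_eq[OF c_def x_def chart_img_open[OF c(1)] x metric_sym[OF c(1) x]
        metric_pos[OF c(1) x]] N G(3) unfolding G(1) a_def[symmetric] d_def[symmetric]
    by (simp add: algebra_simps power4_eq_xxxx)
  then show ?thesis unfolding mult_divide_mult_cancel_left[OF q] boundary_curvature_def y_def .
qed

lemma continuous_boundary_curvature:
  assumes c: "c \<in> \<A>" shows "continuous_on (chart_img c) (boundary_curvature c)"
  unfolding boundary_curvature_def[abs_def] curvature_numerator_def
  by (intro continuous_intros ballI Ck_on_imp_continuous[OF Ck_on_pdi[OF smooth_metric[OF c]]]
      Ck_on_imp_continuous[OF smooth_metric[OF c]]
      Ck_on_imp_continuous[OF Ck_on_det[OF c]])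
    (use metric_pos[OF c] in force)

end

section \<open>Elliptic operators in charts and compactness\<close>

lemma Ck_on_real_compose:
  assumes V: "hp_open V" and f: "Ck_on (Suc k) V f"
    and \<phi>: "\<And>y. y \<in> V \<Longrightarrow> (\<phi> has_real_derivative \<phi>' (f y)) (at (f y))"
    and \<phi>': "Ck_on k V (\<lambda>y. \<phi>' (f y))"
  shows "Ck_on (Suc k) V (\<lambda>y. \<phi> (f y))"
proof (rule Ck_on_SucI[OF V])
  fix y assume y: "y \<in> V"
  show "((\<lambda>y. \<phi> (f y)) has_derivative (\<lambda>h. (\<phi>' (f y) * pdi V 1 f y) * h $ 1 + (\<phi>' (f y) * pdi V 2 f
      y) * h $ 2)) (at y within V)"
    by (rule has_derivative_eq_rhs[OF DERIV_compose_FDERIV[OF \<phi>[OF y] C1_has_derivative[OF V y f]]])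
      (simp add: algebra_simps)
qed (intro Ck_on_mult V \<phi>' Ck_on_pdi[OF f])+

text \<open>Bumps, barriers and corrector are all built from these polynomials around
  \<open>y\<close>: their derivatives are explicit and they are smooth across the boundary
  line.\<close>

definition quad :: "real^2 \<Rightarrow> real \<Rightarrow> real \<Rightarrow> real \<Rightarrow> real \<Rightarrow> real \<Rightarrow> real \<Rightarrow> real^2 \<Rightarrow> real" where
  "quad y k k1 k2 k11 k12 k22 x = k + k1 * (x $ 1 - y $ 1) + k2 * (x $ 2 - y $ 2)
     + k11 * (x $ 1 - y $ 1)\<^sup>2 + k12 * ((x $ 1 - y $ 1) * (x $ 2 - y $ 2)) + k22 * (x $ 2 - y $
         2)\<^sup>2"

lemma Ck_on_quad: "hp_open V \<Longrightarrow> Ck_on n V (quad y k k1 k2 k11 k12 k22)"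
  unfolding quad_def[abs_def] power2_eq_square
  by (intro Ck_on_add Ck_on_mult Ck_on_diff Ck_on_const Ck_on_nth)

lemma continuous_on_quad: "continuous_on A (quad y k k1 k2 k11 k12 k22)"
  unfolding quad_def[abs_def] by (intro continuous_intros)

lemma pdi_quad:
  assumes "hp_open V" "x \<in> V"
  shows "pdi V 1 (quad y k k1 k2 k11 k12 k22) x = k1 + 2 * k11 * (x $ 1 - y $ 1) + k12 * (x $ 2 - y
      $ 2)"
    "pdi V 2 (quad y k k1 k2 k11 k12 k22) x = k2 + k12 * (x $ 1 - y $ 1) + 2 * k22 * (x $ 2 - y $
        2)"
proof -
  note [derivative_intros] = bounded_linear.has_derivative[OF bounded_linear_vec_nth]
  have "(quad y k k1 k2 k11 k12 k22 has_derivative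
      (\<lambda>h. (k1 + 2 * k11 * (x $ 1 - y $ 1) + k12 * (x $ 2 - y $ 2)) * h $ 1
         + (k2 + k12 * (x $ 1 - y $ 1) + 2 * k22 * (x $ 2 - y $ 2)) * h $ 2)) (at x within V)"
    unfolding quad_def[abs_def] by (auto intro!: derivative_eq_intros simp: algebra_simps)
  from pdi_eqI[OF assms this]
  show "pdi V 1 (quad y k k1 k2 k11 k12 k22) x = k1 + 2 * k11 * (x $ 1 - y $ 1) + k12 * (x $ 2 - y $
      2)"
    "pdi V 2 (quad y k k1 k2 k11 k12 k22) x = k2 + k12 * (x $ 1 - y $ 1) + 2 * k22 * (x $ 2 - y $
        2)"
    by simp_all
qed

lemma pdi_pdi_quad:
  assumes V: "hp_open V" "x \<in> V"
  shows "pdi V 1 (pdi V 1 (quad y k k1 k2 k11 k12 k22)) x = 2 * k11"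
    "pdi V 2 (pdi V 1 (quad y k k1 k2 k11 k12 k22)) x = k12"
    "pdi V 1 (pdi V 2 (quad y k k1 k2 k11 k12 k22)) x = k12"
    "pdi V 2 (pdi V 2 (quad y k k1 k2 k11 k12 k22)) x = 2 * k22"
proof -
  have 1: "pdi V i (pdi V 1 (quad y k k1 k2 k11 k12 k22)) x = pdi V i (quad y k1 (2 * k11) k12 0 0
      0) x" for i
    by (rule pdi_cong[OF V(2)]) (simp add: pdi_quad[OF V(1)] quad_def)
  have 2: "pdi V i (pdi V 2 (quad y k k1 k2 k11 k12 k22)) x = pdi V i (quad y k2 k12 (2 * k22) 0 0
      0) x" for i
    by (rule pdi_cong[OF V(2)]) (simp add: pdi_quad[OF V(1)] quad_def)
  show "pdi V 1 (pdi V 1 (quad y k k1 k2 k11 k12 k22)) x = 2 * k11"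
    "pdi V 2 (pdi V 1 (quad y k k1 k2 k11 k12 k22)) x = k12"
    "pdi V 1 (pdi V 2 (quad y k k1 k2 k11 k12 k22)) x = k12"
    "pdi V 2 (pdi V 2 (quad y k k1 k2 k11 k12 k22)) x = 2 * k22"
    unfolding 1 2 by (simp_all add: pdi_quad[OF V])
qed

context riemannian_surface
begin

text \<open>The expanded Laplacian, with partial derivatives taken within \<open>V\<close>: the
  logarithm in a barrier is \<open>C^2\<close> only where its argument is positive, hence on sets
  smaller than the chart image.\<close>

definition ell :: "'a chart \<Rightarrow> (real^2) set \<Rightarrow> (real^2 \<Rightarrow> real) \<Rightarrow> real^2 \<Rightarrow> real" where
  "ell c V f x = metric_inv S c x $ 1 $ 1 * pdi V 1 (pdi V 1 f) x
     + metric_inv S c x $ 1 $ 2 * (pdi V 1 (pdi V 2 f) x + pdi V 2 (pdi V 1 f) x)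
     + metric_inv S c x $ 2 $ 2 * pdi V 2 (pdi V 2 f) x
     + lap_coeff c 1 x * pdi V 1 f x + lap_coeff c 2 x * pdi V 2 f x"

text \<open>The squared length of the gradient in the metric.\<close>

definition gradsq :: "'a chart \<Rightarrow> (real^2) set \<Rightarrow> (real^2 \<Rightarrow> real) \<Rightarrow> real^2 \<Rightarrow> real" where
  "gradsq c V f x = metric_inv S c x $ 1 $ 1 * (pdi V 1 f x)\<^sup>2 + 2 * metric_inv S c x $ 1 $ 2 * (pdi
      V 1 f x * pdi V 2 f x)
     + metric_inv S c x $ 2 $ 2 * (pdi V 2 f x)\<^sup>2"

lemma lap_ell: "c \<in> \<A> \<Longrightarrow> x \<in> chart_img c \<Longrightarrow> Ck_on 2 (chart_img c) f \<Longrightarrow> lap c f x = ell c (chart_img c)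
    f x"
  unfolding ell_def by (rule lap_expand)

lemma pdi_pdi_subset:
  assumes "hp_open U" "hp_open V" "U \<subseteq> V" "x \<in> U"
  shows "pdi U i (pdi U j f) x = pdi V i (pdi V j f) x"
proof -
  have "pdi U i (pdi U j f) x = pdi U i (pdi V j f) x"
    by (rule pdi_cong[OF assms(4)]) (rule pd_hp_open(2)[OF assms(1-3)])
  then show ?thesis using pd_hp_open(2)[OF assms] by simp
qed

lemma ell_subset:
  assumes "hp_open U" "hp_open V" "U \<subseteq> V" "x \<in> U"
  shows "ell c U f x = ell c V f x"
  unfolding ell_def using pdi_pdi_subset[OF assms] pd_hp_open(2)[OF assms] by simp

lemma ell_cong:
  assumes "x \<in> V" "\<And>y. y \<in> V \<Longrightarrow> f y = h y"
  shows "ell c V f x = ell c V h x"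
proof -
  have 1: "pdi V i f y = pdi V i h y" if "y \<in> V" for i y by (rule pdi_cong[OF that assms(2)])
  have "pdi V i (pdi V j f) x = pdi V i (pdi V j h) x" for i j by (rule pdi_cong[OF assms(1) 1])
  then show ?thesis unfolding ell_def using 1[OF assms(1)] by simp
qed

lemma pdi_pdi_linear:
  assumes V: "hp_open V" "x \<in> V" and f: "Ck_on 2 V f" "Ck_on 2 V h"
  shows "pdi V i (pdi V j (\<lambda>y. a * f y + b * h y)) x = a * pdi V i (pdi V j f) x + b * pdi V i (pdi
      V j h) x"
    "pdi V i (\<lambda>y. a * f y + b * h y) x = a * pdi V i f x + b * pdi V i h x"
proof -
  have f2: "Ck_on (Suc (Suc 0)) V f" "Ck_on (Suc (Suc 0)) V h" using f by (simp_all add: Ck_on_2)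
  have 1: "pdi V i (\<lambda>y. a * f y + b * h y) z = a * pdi V i f z + b * pdi V i h z" if "z \<in> V" for z i
    by (simp add: pdi_add[OF V(1) that Ck_on_cmult[OF V(1) f2(1)] Ck_on_cmult[OF V(1) f2(2)]]
        pdi_cmult[OF V(1) that f2(1)] pdi_cmult[OF V(1) that f2(2)])
  then show "pdi V i (\<lambda>y. a * f y + b * h y) x = a * pdi V i f x + b * pdi V i h x" using V(2) by
      blast
  have "pdi V i (pdi V j (\<lambda>y. a * f y + b * h y)) x = pdi V i (\<lambda>z. a * pdi V j f z + b * pdi V j h
      z) x"
    by (rule pdi_cong[OF V(2) 1])
  also have "\<dots> = a * pdi V i (pdi V j f) x + b * pdi V i (pdi V j h) x"
    by (simp add: pdi_add[OF V Ck_on_cmult[OF V(1) Ck_on_pdi[OF f2(1)]] Ck_on_cmult[OF V(1)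
        Ck_on_pdi[OF f2(2)]]]
        pdi_cmult[OF V Ck_on_pdi[OF f2(1)]] pdi_cmult[OF V Ck_on_pdi[OF f2(2)]])
  finally show "pdi V i (pdi V j (\<lambda>y. a * f y + b * h y)) x = a * pdi V i (pdi V j f) x + b * pdi V
      i (pdi V j h) x" .
qed

lemma ell_linear:
  assumes V: "hp_open V" "x \<in> V" and f: "Ck_on 2 V f" "Ck_on 2 V h"
  shows "ell c V (\<lambda>y. a * f y + b * h y) x = a * ell c V f x + b * ell c V h x"
  unfolding ell_def pdi_pdi_linear[OF V f] by (simp add: algebra_simps)

lemma ell_compose:
  assumes V: "hp_open V" "x \<in> V" and f: "Ck_on 2 V f"
    and \<phi>: "\<And>y. y \<in> V \<Longrightarrow> (\<phi> has_real_derivative \<phi>' (f y)) (at (f y))"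
    and \<phi>': "\<And>y. y \<in> V \<Longrightarrow> (\<phi>' has_real_derivative \<phi>'' (f y)) (at (f y))"
    and cont: "continuous_on V (\<lambda>y. \<phi>'' (f y))"
  shows "ell c V (\<lambda>y. \<phi> (f y)) x = \<phi>' (f x) * ell c V f x + \<phi>'' (f x) * gradsq c V f x"
    "Ck_on 2 V (\<lambda>y. \<phi> (f y))"
proof -
  have f2: "Ck_on (Suc (Suc 0)) V f" using f by (simp add: Ck_on_2)
  have c1: "Ck_on (Suc 0) V (\<lambda>y. \<phi>' (f y))"
    by (rule Ck_on_real_compose[OF V(1) Ck_on_SucD[OF f2] \<phi>']) (use cont in auto)
  show "Ck_on 2 V (\<lambda>y. \<phi> (f y))" unfolding Ck_on_2
    by (rule Ck_on_real_compose[OF V(1) f2 \<phi> c1])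
  have 1: "pdi V j (\<lambda>y. \<phi> (f y)) z = \<phi>' (f z) * pdi V j f z" if "z \<in> V" for z j
    by (rule pdi_real_compose[OF V(1) that f2 \<phi>[OF that]])
  have 2: "pdi V i (pdi V j (\<lambda>y. \<phi> (f y))) x = \<phi>' (f x) * pdi V i (pdi V j f) x + \<phi>'' (f x) * pdi V
      i f x * pdi V j f x" for i j
  proof -
    have "pdi V i (pdi V j (\<lambda>y. \<phi> (f y))) x = pdi V i (\<lambda>z. \<phi>' (f z) * pdi V j f z) x"
      by (rule pdi_cong[OF V(2) 1])
    then show ?thesis
      by (simp add: pdi_mult[OF V c1 Ck_on_pdi[OF f2]] pdi_real_compose[OF V f2 \<phi>'[OF V(2)]])
  qed
  show "ell c V (\<lambda>y. \<phi> (f y)) x = \<phi>' (f x) * ell c V f x + \<phi>'' (f x) * gradsq c V f x"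
    unfolding ell_def gradsq_def 1[OF V(2)] 2 by (simp add: algebra_simps power2_eq_square)
qed

lemma ell_quad:
  assumes V: "hp_open V" "x \<in> V"
  shows "ell c V (quad y k k1 k2 k11 k12 k22) x = 2 * k11 * metric_inv S c x $ 1 $ 1 + 2 * k12 *
      metric_inv S c x $ 1 $ 2
    + 2 * k22 * metric_inv S c x $ 2 $ 2
    + lap_coeff c 1 x * (k1 + 2 * k11 * (x $ 1 - y $ 1) + k12 * (x $ 2 - y $ 2))
    + lap_coeff c 2 x * (k2 + k12 * (x $ 1 - y $ 1) + 2 * k22 * (x $ 2 - y $ 2))"
  unfolding ell_def pdi_pdi_quad[OF V] pdi_quad[OF V] by simp

lemma metric_inv_pos:
  assumes c: "c \<in> \<A>" "x \<in> chart_img c"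
  shows "0 < metric_inv S c x $ 1 $ 1" "0 < metric_inv S c x $ 2 $ 2"
    "0 < metric_inv S c x $ 1 $ 1 * metric_inv S c x $ 2 $ 2 - metric_inv S c x $ 1 $ 2 * metric_inv
        S c x $ 1 $ 2"
proof -
  define D where "D = det (g c x)"
  have D: "D = g c x $ 1 $ 1 * g c x $ 2 $ 2 - g c x $ 1 $ 2 * g c x $ 1 $ 2" using det_metric[OF c]
      by (simp add: D_def)
  have p: "0 < g c x $ 1 $ 1" "0 < D" using metric_pos[OF c] by (auto simp: D_def)
  have "0 < g c x $ 1 $ 1 * g c x $ 2 $ 2" using p D by (smt (verit) zero_le_square)
  then have "0 < g c x $ 2 $ 2" using p(1) by (simp add: zero_less_mult_iff)
  then show "0 < metric_inv S c x $ 1 $ 1" "0 < metric_inv S c x $ 2 $ 2" using p metric_inv_2[OF c]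
      by (simp_all add: D_def)
  have "metric_inv S c x $ 1 $ 1 * metric_inv S c x $ 2 $ 2 - metric_inv S c x $ 1 $ 2 * metric_inv
      S c x $ 1 $ 2
     = D / (D * D)" unfolding metric_inv_2[OF c] D_def[symmetric] by (simp add: D
         diff_divide_distrib)
  then show "0 < metric_inv S c x $ 1 $ 1 * metric_inv S c x $ 2 $ 2 - metric_inv S c x $ 1 $ 2 *
      metric_inv S c x $ 1 $ 2"
    using p by simp
qed

lemma ell_local_min:
  assumes c: "c \<in> \<A>" and V: "hp_open V" "V \<subseteq> chart_img c" and f: "Ck_on 2 V f" and x: "x \<in> V" "0 < x
      $ 2"
    and e: "0 < e" "\<And>y. y \<in> V \<Longrightarrow> dist y x < e \<Longrightarrow> f x \<le> f y"
  shows "0 \<le> ell c V f x"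
proof -
  have xc: "x \<in> chart_img c" using x V by auto
  have "pdi V i f x = 0" for i by (rule local_min_derivatives(1)[OF V(1) f x e])
  then show ?thesis unfolding ell_def
    using local_min_trace[OF V(1) f x e metric_inv_pos(1)[OF c xc], of "metric_inv S c x $ 2 $ 2"
        "metric_inv S c x $ 1 $ 2"]
      metric_inv_pos(3)[OF c xc] by simp
qed

section \<open>Compactness: finite covers and attained minima\<close>

lemma half_ball_nhd:
  assumes c: "c \<in> \<A>" "p \<in> chart_dom c" and W: "hp_open W" "W \<subseteq> chart_img c" "chart_map c p \<in> W"
  obtains r where "0 < r" "cball (chart_map c p) r \<inter> half_plane \<subseteq> W"
proof -
  obtain r where r: "r > 0" "\<And>y. 0 \<le> y $ 2 \<Longrightarrow> dist y (chart_map c p) < r \<Longrightarrow> y \<in> W"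
    using hp_openD[OF W(1,3)] by blast
  show ?thesis
    by (rule that[of "r/2"]) (use r in \<open>auto simp: half_plane_def dist_commute intro!: r(2)\<close>)
qed

lemma openin_half_plane_ball: "hp_open (ball x r \<inter> half_plane)"
  by (metis Int_commute open_ball openin_open_Int)

lemma compact_half_ball: "compact (cball x r \<inter> half_plane)"
proof -
  have "closed half_plane" unfolding half_plane_def by (intro closed_Collect_le continuous_intros)
  then show ?thesis by (rule compact_Int_closed[OF compact_cball])
qed

lemma compactin_clopen: "closedin X G \<Longrightarrow> compactin X G"
  using compact_space_X closedin_compact_space by blast

lemma finite_subcover:
  assumes G: "closedin X G" and N: "\<And>p. p \<in> G \<Longrightarrow> openin X (N p)" "\<And>p. p \<in> G \<Longrightarrow> p \<in> N p"
  obtains H where "finite H" "H \<subseteq> G" "G \<subseteq> \<Union> (N ` H)"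
proof -
  have cover: "(\<forall>U\<in>N ` G. openin X U) \<and> G \<subseteq> \<Union> (N ` G)" using N by blast
  have "\<forall>\<U>. (\<forall>U\<in>\<U>. openin X U) \<and> G \<subseteq> \<Union>\<U> \<longrightarrow> (\<exists>\<F>. finite \<F> \<and> \<F> \<subseteq> \<U> \<and> G \<subseteq> \<Union>\<F>)"
    using compactin_clopen[OF G] by (simp add: compactin_def)
  from this[rule_format, OF cover] obtain F where F: "finite F" "F \<subseteq> N ` G" "G \<subseteq> \<Union>F" by (elim exE
      conjE) (rule that)
  obtain H where "H \<subseteq> G" "finite H" "F = N ` H" using finite_subset_image[OF F(1,2)] by blast
  then show ?thesis using F(3) that by blast
qed

text \<open>\<open>C\<close> serves in three roles: a curvature bound, the reciprocal of a lower
  bound for a Laplacian, and the time after which an estimate holds. In each case finitely many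
  local constants are replaced by their maximum.\<close>

lemma compact_uniform:
  assumes G: "closedin X G"
    and loc: "\<And>p. p \<in> G \<Longrightarrow> \<exists>N. openin X N \<and> p \<in> N \<and> (\<exists>C::real. \<forall>q\<in>N \<inter> G. P C q)"
    and mono: "\<And>C C' q. C \<le> C' \<Longrightarrow> P C q \<Longrightarrow> P C' q"
  shows "\<exists>C. \<forall>q\<in>G. P C q"
proof -
  obtain N C where N: "\<And>p. p \<in> G \<Longrightarrow> openin X (N p)" "\<And>p. p \<in> G \<Longrightarrow> p \<in> N p"
      "\<And>p q. p \<in> G \<Longrightarrow> q \<in> N p \<inter> G \<Longrightarrow> P (C p) q"
    using loc by metis
  obtain H where H: "finite H" "H \<subseteq> G" "G \<subseteq> \<Union> (N ` H)" using finite_subcover[OF G N(1,2)] .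
  show ?thesis
  proof (intro exI ballI)
    fix q assume q: "q \<in> G"
    then obtain p where p: "p \<in> H" "q \<in> N p" using H(3) by auto
    then have "P (C p) q" using N(3) q H(2) by blast
    then show "P (Max (C ` H)) q" by (rule mono[rotated]) (use p H in auto)
  qed
qed

text \<open>Reduces extremal problems on the abstract space, in particular on its products with a
  time interval, to compact subsets of \<open>real^2\<close>.\<close>

lemma compact_chart_cover:
  assumes G: "closedin X G" "openin X G"
  shows "\<exists>I. finite I \<and> (\<forall>(c, K)\<in>I. c \<in> \<A> \<and> compact K \<and> K \<subseteq> chart_map c ` (G \<inter> chart_dom c)) \<and>
     G = (\<Union>(c, K)\<in>I. chart_inv c ` K)"
proof -
  let ?Q = "\<lambda>p z. fst z \<in> \<A> \<and> compact (fst (snd z)) \<and> fst (snd z) \<subseteq> chart_map (fst z) ` (G \<inter>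
      chart_dom (fst z))
      \<and> openin X (snd (snd z)) \<and> p \<in> snd (snd z) \<and> snd (snd z) \<subseteq> chart_inv (fst z) ` fst (snd z)"
  have "\<exists>z. ?Q p z"
    if p: "p \<in> G" for p
  proof -
    have "p \<in> M" using p G(2) openin_subset by blast
    then obtain c where c: "c \<in> \<A>" "p \<in> chart_dom c" using atlas_cover by blast
    let ?W = "chart_map c ` (G \<inter> chart_dom c)" and ?x = "chart_map c p"
    have W: "hp_open ?W" by (intro openin_chart_image openin_Int G chart_dom_open c) auto
    have Wc: "?W \<subseteq> chart_img c" by auto
    have xW: "?x \<in> ?W" using p c by blast
    obtain r where r: "0 < r" "cball ?x r \<inter> half_plane \<subseteq> ?W"
      using half_ball_nhd[OF c W Wc xW] .
    have sub: "ball ?x r \<inter> half_plane \<subseteq> cball ?x r \<inter> half_plane" by auto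
    have "openin X (chart_inv c ` (ball ?x r \<inter> half_plane))"
      using r(2) sub Wc by (intro openin_chart_preimage[OF c(1) openin_half_plane_ball]) blast
    moreover have "?x \<in> half_plane" using hp_open_nonneg[OF W xW] by (simp add: half_plane_def)
    then have "p \<in> chart_inv c ` (ball ?x r \<inter> half_plane)" using r(1) c
      by (intro image_eqI[of _ _ ?x]) auto
    moreover have "chart_inv c ` (ball ?x r \<inter> half_plane) \<subseteq> chart_inv c ` (cball ?x r \<inter> half_plane)"
      using sub by blast
    ultimately show ?thesis
      by (intro exI[of _ "(c, cball ?x r \<inter> half_plane, chart_inv c ` (ball ?x r \<inter> half_plane))"])
        (simp only: fst_conv snd_conv c(1) compact_half_ball r(2) simp_thms)
  qed
  then have "\<exists>z. \<forall>p\<in>G. ?Q p (z p)" by (intro bchoice) blast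
  then obtain z where z: "\<forall>p\<in>G. ?Q p (z p)" by blast
  define c K N where "c = (\<lambda>p. fst (z p))" and "K = (\<lambda>p. fst (snd (z p)))" and "N = (\<lambda>p. snd (snd (z
      p)))"
  have N: "\<And>p. p \<in> G \<Longrightarrow> c p \<in> \<A>" "\<And>p. p \<in> G \<Longrightarrow> compact (K p)"
    "\<And>p. p \<in> G \<Longrightarrow> K p \<subseteq> chart_map (c p) ` (G \<inter> chart_dom (c p))"
    "\<And>p. p \<in> G \<Longrightarrow> openin X (N p)" "\<And>p. p \<in> G \<Longrightarrow> p \<in> N p" "\<And>p. p \<in> G \<Longrightarrow> N p \<subseteq> chart_inv (c p) ` K p"
    using z by (simp_all add: c_def K_def N_def)
  obtain H where H: "finite H" "H \<subseteq> G" "G \<subseteq> \<Union> (N ` H)" using finite_subcover[OF G(1) N(4,5)] .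
  let ?I = "(\<lambda>p. (c p, K p)) ` H"
  have "(\<Union>(c, K)\<in>?I. chart_inv c ` K) \<subseteq> G"
  proof clarsimp
    fix p x assume p: "p \<in> H" and x: "x \<in> K p"
    then obtain q where q: "q \<in> G" "q \<in> chart_dom (c p)" "x = chart_map (c p) q" using N(3)[of p]
        H(2) by blast
    then show "chart_inv (c p) x \<in> G" using N(1)[of p] p H(2) by auto
  qed
  moreover have "G \<subseteq> (\<Union>(c, K)\<in>?I. chart_inv c ` K)"
  proof
    fix q assume "q \<in> G"
    then obtain p where "p \<in> H" "q \<in> N p" using H(3) by auto
    then show "q \<in> (\<Union>(c, K)\<in>?I. chart_inv c ` K)" using N(6)[of p] H(2) by auto
  qed
  moreover have "\<forall>(c, K)\<in>?I. c \<in> \<A> \<and> compact K \<and> K \<subseteq> chart_map c ` (G \<inter> chart_dom c)"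
    by (simp add: N(1-3)[OF subsetD[OF H(2)]])
  moreover have "finite ?I" using H(1) by simp
  ultimately show ?thesis by (intro exI[of _ ?I] conjI) (auto simp only: set_eq_subset)
qed

lemma attains_min:
  fixes f :: "'a \<Rightarrow> real \<Rightarrow> real"
  assumes G: "closedin X G" "openin X G" "G \<noteq> {}" and ab: "a \<le> b"
    and f: "\<And>c. c \<in> \<A> \<Longrightarrow> continuous_on (chart_img c \<times> {a..b}) (\<lambda>(x, t). f (chart_inv c x) t)"
  shows "\<exists>p\<in>G. \<exists>t\<in>{a..b}. \<forall>q\<in>G. \<forall>s\<in>{a..b}. f p t \<le> f q s"
proof -
  obtain I where I: "finite I" "\<And>c K. (c, K) \<in> I \<Longrightarrow> c \<in> \<A> \<and> compact K \<and> K \<subseteq> chart_map c ` (G \<inter>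
      chart_dom c)"
     "G = (\<Union>(c, K)\<in>I. chart_inv c ` K)" using compact_chart_cover[OF G(1,2)] by fastforce
  define R where "R = (\<Union>(c, K)\<in>I. (\<lambda>(x, t). f (chart_inv c x) t) ` (K \<times> {a..b}))"
  have R: "R = (\<lambda>(p, t). f p t) ` (G \<times> {a..b})" unfolding R_def by (subst I(3)) force
  have "compact R" unfolding R_def
  proof (intro compact_UN I(1), clarify)
    fix c K assume ck: "(c, K) \<in> I"
    have "K \<subseteq> chart_img c" using I(2)[OF ck] by (auto simp: chart_img_def)
    then show "compact ((\<lambda>(x, t). f (chart_inv c x) t) ` (K \<times> {a..b}))"
      using I(2)[OF ck] by (intro compact_continuous_image compact_Times continuous_on_subset[OF f])
          auto
  qed
  moreover have "R \<noteq> {}" using G(3) ab by (auto simp: R)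
  ultimately obtain m where m: "m \<in> R" "\<forall>v\<in>R. m \<le> v" using compact_attains_inf by blast
  obtain p t where pt: "p \<in> G" "t \<in> {a..b}" "m = f p t" using m(1) unfolding R by auto
  have "f p t \<le> f q s" if "q \<in> G" "s \<in> {a..b}" for q s
    using m(2) that unfolding R pt(3) by auto
  then show ?thesis using pt by blast
qed

lemma closedin_bdry: "closedin X (bdry S)"
proof -
  have "openin X (M - bdry S)"
  proof (subst openin_subopen, intro ballI)
    fix p assume p: "p \<in> M - bdry S"
    then obtain c where c: "c \<in> \<A>" "p \<in> chart_dom c" using atlas_cover by blast
    let ?W = "{x \<in> chart_img c. 0 < x $ 2}"
    have "hp_open ?W" by (intro openin_continuous_preimage_greaterThan chart_img_open c
        continuous_intros)
    then have o: "openin X (chart_inv c ` ?W)" by (rule openin_chart_preimage[OF c(1)]) auto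
    have e: "chart_inv c ` ?W = {q \<in> chart_dom c. chart_map c q \<in> ?W}" by (rule chart_inv_image[OF
        c(1)]) auto
    have "p \<in> chart_inv c ` ?W" unfolding e using p c inter_chart[of p c] by (auto simp: inter_def)
    moreover have "chart_inv c ` ?W \<subseteq> M - bdry S"
      unfolding e using boundary_chart[OF _ c(1)] chart_dom_subset[OF c(1)] by auto
    ultimately show "\<exists>T. openin X T \<and> p \<in> T \<and> T \<subseteq> M - bdry S" using o by blast
  qed
  then show ?thesis by (simp add: closedin_def bdry_def)
qed

end

section \<open>The solution away from the boundary\<close>

text \<open>A minimum over a space-time cylinder may sit at the final time, so only earlier times
  are compared.\<close>

lemma derivative_nonpos_at_left_min:
  fixes h :: "real \<Rightarrow> real"
  assumes "(h has_real_derivative d) (at t)" "a < t" "\<And>s. a \<le> s \<Longrightarrow> s \<le> t \<Longrightarrow> h t \<le> h s"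
  shows "d \<le> 0"
proof (rule ccontr)
  assume "\<not> d \<le> 0"
  then obtain e where e: "e > 0" "\<And>k. 0 < k \<Longrightarrow> k < e \<Longrightarrow> h (t - k) < h t"
    using DERIV_pos_inc_left[OF assms(1)] by force
  define k where "k = min (e / 2) (t - a)"
  have "0 < k" "k < e" using e(1) assms(2) by (auto simp: k_def)
  moreover have "a \<le> t - k" by (simp add: k_def)
  ultimately show False using e(2)[of k] assms(3)[of "t - k"] by auto
qed

text \<open>Non-emptiness of the boundary is included because differentiability, monotonicity and
  growth of \<open>\<psi>\<close> are read off at a boundary point. The other case of the theorem is
  vacuous.\<close>

locale flow = riemannian_surface S for S :: "'a surface" +
  fixes \<alpha> T3 :: real and u0 :: "'a \<Rightarrow> real" and \<phi> u :: "'a \<Rightarrow> real \<Rightarrow> real" and \<psi> :: "real \<Rightarrow> real"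
  assumes admissible: "admissible_pair S \<alpha> u0 \<phi>"
    and T3: "T3 > 0" and \<phi>_\<psi>: "\<forall>p\<in>bdry S. \<forall>t\<ge>T3. \<phi> p t = \<psi> t"
    and deriv_\<psi>: "(deriv \<psi> \<longlongrightarrow> 0) at_top"
    and solution: "cauchy_dirichlet_solution S \<alpha> u0 \<phi> u"
    and bdry_nonempty: "bdry S \<noteq> {}"
begin

abbreviation "K \<equiv> gauss_curvature S"

definition ut :: "'a \<Rightarrow> real \<Rightarrow> real" where
  "ut p t = dt {0..} (u p) t"

lemma parabolic:
  assumes "c \<in> \<A>" "0 < T"
  shows "parabolic_C2_holder \<alpha> (chart_img c) T (u \<circ> chart_inv c)"
  using solution assms unfolding cauchy_dirichlet_solution_def parabolic_C2_surface_def by blast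

lemma Ck_on_u:
  assumes c: "c \<in> \<A>" and t: "0 \<le> t"
  shows "Ck_on 2 (chart_img c) (\<lambda>x. u (chart_inv c x) t)"
proof -
  have "0 < t + 1" using t by simp
  from parabolic[OF c this] t show ?thesis unfolding parabolic_C2_holder_def by simp
qed

lemma continuous_u:
  assumes c: "c \<in> \<A>" and t: "0 \<le> a"
  shows "continuous_on (chart_img c \<times> {a..b}) (\<lambda>(x, t). u (chart_inv c x) t)"
proof -
  have "0 < \<bar>b\<bar> + 1" by simp
  from parabolic[OF c this] have "continuous_on (chart_img c \<times> {0..\<bar>b\<bar> + 1}) (\<lambda>(x, t). (u \<circ>
      chart_inv c) x t)"
    unfolding parabolic_C2_holder_def by blast
  then have "continuous_on (chart_img c \<times> {0..\<bar>b\<bar> + 1}) (\<lambda>(x, t). u (chart_inv c x) t)" by (simp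
      add: o_def)
  then show ?thesis by (rule continuous_on_subset) (use t in auto)
qed

lemma at_within_halfline:
  assumes "0 \<le> (t::real)" "t < T"
  shows "at t within {0..T} = at t within {0..}"
  by (rule at_within_nhd[of _ "{..<T}"]) (use assms in auto)

lemma u_has_derivative_within:
  assumes p: "p \<in> M" and t: "0 \<le> t"
  shows "(u p has_vector_derivative ut p t) (at t within {0..})"
proof -
  obtain c where c: "c \<in> \<A>" "p \<in> chart_dom c" using p atlas_cover by blast
  have "0 < t + 1" using t by simp
  from parabolic[OF c(1) this] have "\<forall>x\<in>chart_img c. u (chart_inv c x) differentiable (at t within
      {0..t+1})"
    unfolding parabolic_C2_holder_def using t by simp
  then have "u p differentiable (at t within {0..t+1})" using c by (metis chart_inv_map
      chart_map_img)
  then have "u p differentiable (at t within {0..})" using at_within_halfline[of t "t+1"] t by simp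
  then show ?thesis unfolding ut_def dt_def by (simp add: vector_derivative_works)
qed

lemma u_has_derivative:
  assumes p: "p \<in> M" and t: "0 < t"
  shows "(u p has_real_derivative ut p t) (at t)"
proof -
  have "at t within {0..} = at t" by (rule at_within_interior) (use t in \<open>simp add:
      interior_real_atLeast\<close>)
  then show ?thesis using u_has_derivative_within[OF p, of t] t
    by (simp add: has_real_derivative_iff_has_vector_derivative)
qed

lemma inter_in_M: "p \<in> inter S \<Longrightarrow> p \<in> M" and bdry_in_M: "p \<in> bdry S \<Longrightarrow> p \<in> M"
  by (auto simp: inter_def bdry_def)

lemma flow_equation:
  assumes p: "p \<in> inter S" and t: "0 \<le> t" and c: "c \<in> \<A>" "p \<in> chart_dom c"
  shows "ut p t = exp (- 2 * u p t) * (ell c (chart_img c) (\<lambda>x. u (chart_inv c x) t) (chart_map c p)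
      - K p) - 1"
proof -
  have "ut p t = flow_rhs S (\<lambda>q. u q t) p"
    using solution p t unfolding cauchy_dirichlet_solution_def ut_def by blast
  also have "laplacian S (\<lambda>q. u q t) p = ell c (chart_img c) (\<lambda>x. u (chart_inv c x) t) (chart_map c
      p)"
    using laplacian_chart[OF inter_in_M[OF p] c, of "\<lambda>q. u q t"] Ck_on_u[OF c(1) t] lap_ell[OF c(1)
        chart_map_img[OF c(2)] Ck_on_u[OF c(1) t]]
    by (simp add: o_def)
  ultimately show ?thesis by (simp add: flow_rhs_def laplacian_def)
qed

lemma u_bdry: "p \<in> bdry S \<Longrightarrow> T3 \<le> t \<Longrightarrow> u p t = \<psi> t"
  using solution \<phi>_\<psi> T3 unfolding cauchy_dirichlet_solution_def by auto

text \<open>\<open>deriv\<close> of an arbitrary function carries no information by itself;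
  differentiability of \<open>\<psi>\<close> beyond \<open>T3\<close> is inherited from
  \<open>u\<close> at a boundary point.\<close>

lemma \<psi>_derivative:
  assumes t: "T3 < t"
  shows "(\<psi> has_real_derivative deriv \<psi> t) (at t)" "p \<in> bdry S \<Longrightarrow> deriv \<psi> t = ut p t"
proof -
  have *: "(\<psi> has_real_derivative ut p t) (at t)" if p: "p \<in> bdry S" for p
  proof (rule has_field_derivative_transform_within_open[OF u_has_derivative[OF bdry_in_M[OF p]]])
    show "open {T3<..}" "t \<in> {T3<..}" "0 < t" using t T3 by auto
    show "u p s = \<psi> s" if "s \<in> {T3<..}" for s using u_bdry[OF p] that by simp
  qed
  then show **: "p \<in> bdry S \<Longrightarrow> deriv \<psi> t = ut p t" for p by (rule DERIV_imp_deriv)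
  obtain p where "p \<in> bdry S" using bdry_nonempty by blast
  then show "(\<psi> has_real_derivative deriv \<psi> t) (at t)" using * ** by metis
qed

lemma eventually_deriv_\<psi>_nonneg: "\<exists>T>T3. \<forall>t\<ge>T. 0 \<le> deriv \<psi> t"
proof -
  obtain T where T: "T > 0" "\<forall>p\<in>bdry S. \<forall>t\<ge>T. 0 \<le> dt {0..} (\<phi> p) t"
    using admissible unfolding admissible_pair_def by blast
  obtain p where p: "p \<in> bdry S" using bdry_nonempty by blast
  have up: "u p t = \<phi> p t" if "t \<ge> 0" for t
    using solution p that unfolding cauchy_dirichlet_solution_def by blast
  have "0 \<le> deriv \<psi> t" if t: "t \<ge> max T (T3 + 1)" for t
  proof -
    have "0 < t" "T3 < t" using t T3 by auto
    have "(\<phi> p has_vector_derivative ut p t) (at t within {0..})"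
      unfolding has_vector_derivative_def
    proof (rule has_derivative_transform[where f = "u p"])
      show "(u p has_derivative (\<lambda>x. x *\<^sub>R ut p t)) (at t within {0..})"
        using u_has_derivative_within[OF bdry_in_M[OF p], of t] \<open>0 < t\<close> by (simp add:
            has_vector_derivative_def)
    qed (use \<open>0 < t\<close> up in auto)
    moreover have "at t within {0..} = at t" by (rule at_within_interior) (use \<open>0 < t\<close> in \<open>simp add:
        interior_real_atLeast\<close>)
    then have "at t within {0..} \<noteq> bot" by simp
    ultimately have "dt {0..} (\<phi> p) t = ut p t" unfolding dt_def by (intro vector_derivative_within)
    moreover have "0 \<le> dt {0..} (\<phi> p) t" using T(2) p t by simp
    ultimately show ?thesis using \<psi>_derivative(2)[OF \<open>T3 < t\<close> p] by simp
  qed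
  then show ?thesis by (intro exI[of _ "max T (T3 + 1)"]) auto
qed

lemma \<psi>_mono:
  assumes T: "T3 < T" "\<forall>t\<ge>T. 0 \<le> deriv \<psi> t" and "T \<le> s" "s \<le> t"
  shows "\<psi> s \<le> \<psi> t"
proof (rule DERIV_nonneg_imp_nondecreasing[OF \<open>s \<le> t\<close>])
  fix r assume r: "s \<le> r" "r \<le> t"
  then have "T3 < r" "T \<le> r" using assms by linarith+
  then show "\<exists>y. (\<psi> has_real_derivative y) (at r) \<and> 0 \<le> y" using \<psi>_derivative(1) T(2) by blast
qed

lemma \<psi>_at_top: "filterlim \<psi> at_top at_top"
proof -
  obtain T1 \<xi> where \<xi>: "low_speed \<xi>" "\<forall>p\<in>bdry S. \<forall>t\<ge>T1. ln (\<xi> t) \<le> \<phi> p t"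
    using admissible unfolding admissible_pair_def by blast
  have "filterlim \<xi> at_top at_top" using \<xi>(1) unfolding low_speed_def by blast
  then have "filterlim (\<lambda>t. ln (\<xi> t)) at_top at_top" by (rule filterlim_compose[OF ln_at_top])
  moreover obtain p where p: "p \<in> bdry S" using bdry_nonempty by blast
  have "\<forall>\<^sub>F t in at_top. ln (\<xi> t) \<le> \<psi> t"
    unfolding eventually_at_top_linorder
    using \<xi>(2) p \<phi>_\<psi> by (intro exI[of _ "max T1 T3"]) fastforce
  ultimately show ?thesis by (rule filterlim_at_top_mono)
qed

text \<open>The flow equation at time \<open>0\<close> expresses the curvature through the Laplacian of \<open>u\<close> and
  \<open>u\<^sub>t\<close>, which spares the proof that the curvature does not depend on the chart.\<close>

lemma curvature_bounded: "\<exists>C. \<forall>p\<in>M. p \<in> inter S \<longrightarrow> \<bar>K p\<bar> \<le> C"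
proof (rule compact_uniform)
  show "closedin X M" by simp
  fix p assume p: "p \<in> M"
  obtain c where c: "c \<in> \<A>" "p \<in> chart_dom c" using p atlas_cover by blast
  let ?v = "\<lambda>x. u (chart_inv c x) 0"
  define \<kappa> where "\<kappa> = (\<lambda>x. ell c (chart_img c) ?v x - exp (2 * ?v x) * (ut (chart_inv c x) 0 + 1))"
  note par = parabolic[OF c(1) zero_less_one, unfolded parabolic_C2_holder_def]
  have "continuous_on (chart_img c \<times> {0..1}) (\<lambda>(x, t). dt {0..1} ((u \<circ> chart_inv c) x) t)" using par
      by blast
  then have "continuous_on (chart_img c) (\<lambda>x. (\<lambda>(x, t). dt {0..1} ((u \<circ> chart_inv c) x) t) (x, 0))"
    by (rule continuous_on_compose2) (auto intro!: continuous_intros)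
  moreover have "dt {0..1} ((u \<circ> chart_inv c) x) 0 = ut (chart_inv c x) 0" for x
    using at_within_halfline[of 0 1] by (simp add: dt_def ut_def)
  ultimately have cut: "continuous_on (chart_img c) (\<lambda>x. ut (chart_inv c x) 0)" by simp
  have u2: "Ck_on (Suc (Suc 0)) (chart_img c) ?v" using Ck_on_u[OF c(1), of 0] by (simp add:
      Ck_on_2)
  have "continuous_on (chart_img c) (ell c (chart_img c) ?v)"
    unfolding ell_def[abs_def]
    by (intro continuous_intros Ck_on_imp_continuous[OF Ck_on_metric_inv[OF c(1)]]
        continuous_lap_coeff[OF c(1)]
        Ck_on_imp_continuous[OF Ck_on_pdi[OF u2]] Ck_on_imp_continuous[OF Ck_on_pdi[OF Ck_on_pdi[OF
            u2]]])
  then have \<kappa>: "continuous_on (chart_img c) \<kappa>" unfolding \<kappa>_def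
    by (intro continuous_intros cut Ck_on_imp_continuous[OF u2])
  let ?x = "chart_map c p"
  have "openin (top_of_set (chart_img c)) (chart_img c \<inter> (\<lambda>x. \<bar>\<kappa> x\<bar>) -` {..<\<bar>\<kappa> ?x\<bar> + 1})" (is
      "openin _ ?W")
    by (intro continuous_openin_preimage_gen continuous_intros \<kappa> open_lessThan)
  then have W: "hp_open ?W" using chart_img_open[OF c(1)] openin_trans by blast
  have e: "chart_inv c ` ?W = {q \<in> chart_dom c. chart_map c q \<in> ?W}" by (rule chart_inv_image[OF
      c(1)]) auto
  show "\<exists>N. openin X N \<and> p \<in> N \<and> (\<exists>C. \<forall>q\<in>N \<inter> M. q \<in> inter S \<longrightarrow> \<bar>K q\<bar> \<le> C)"
  proof (intro exI conjI ballI impI)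
    show "openin X (chart_inv c ` ?W)" by (rule openin_chart_preimage[OF c(1) W]) auto
    show "p \<in> chart_inv c ` ?W" unfolding e using c by auto
    fix q assume q: "q \<in> chart_inv c ` ?W \<inter> M" "q \<in> inter S"
    have qc: "q \<in> chart_dom c" using q unfolding e by auto
    have "ut q 0 + 1 = exp (- 2 * u q 0) * (ell c (chart_img c) ?v (chart_map c q) - K q)"
      using flow_equation[OF q(2) _ c(1) qc, of 0] by simp
    then have "exp (2 * u q 0) * (ut q 0 + 1) = (exp (2 * u q 0) * exp (- 2 * u q 0)) * (ell c
        (chart_img c) ?v (chart_map c q) - K q)"
      by simp
    also have "exp (2 * u q 0) * exp (- 2 * u q 0) = 1" by (simp flip: exp_add)
    finally have "K q = \<kappa> (chart_map c q)" using c(1) qc by (simp add: \<kappa>_def)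
    then show "\<bar>K q\<bar> \<le> \<bar>\<kappa> ?x\<bar> + 1" using q unfolding e by auto
  qed
qed auto

lemma chart_min:
  assumes c: "c \<in> \<A>" "p \<in> chart_dom c" and W: "hp_open W" "W \<subseteq> chart_img c" and x: "chart_map c p \<in>
      W" "p \<in> inter S"
    and f: "Ck_on 2 W f" and e: "0 < e" "\<And>y. y \<in> W \<Longrightarrow> dist y (chart_map c p) < e \<Longrightarrow> f (chart_map c p)
        \<le> f y"
  shows "0 \<le> ell c W f (chart_map c p)"
  by (rule ell_local_min[OF c(1) W f x(1) inter_chart[OF x(2) c] e])

text \<open>A spatial maximum of \<open>u\<close> above a level controlled by the curvature decreases in time.\<close>

lemma u_le_\<psi>: "\<exists>t0>T3. (\<forall>t\<ge>t0. 0 \<le> deriv \<psi> t) \<and> (\<forall>p\<in>M. \<forall>t\<ge>t0. u p t \<le> \<psi> t)"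
proof -
  obtain T where T: "T > T3" "\<forall>t\<ge>T. 0 \<le> deriv \<psi> t" using eventually_deriv_\<psi>_nonneg by blast
  have T0: "0 < T" using T T3 by simp
  obtain C where C: "\<And>p. p \<in> inter S \<Longrightarrow> \<bar>K p\<bar> \<le> C" using curvature_bounded inter_in_M by blast
  have Mne: "M \<noteq> {}" using bdry_nonempty bdry_in_M by blast
  have cM: "closedin X M" "openin X M" by auto
  have cu: "continuous_on (chart_img c \<times> {T..b}) (\<lambda>(x, t). - u (chart_inv c x) t)" if "c \<in> \<A>" for b
      c
    using continuous_on_minus[OF continuous_u[OF that, of T b]] T0 by (simp add: case_prod_unfold)
  obtain m where m: "\<And>p. p \<in> M \<Longrightarrow> u p T \<le> m"
  proof -
    obtain p where "\<forall>q\<in>M. \<forall>s\<in>{T..T}. - u p T \<le> - u q s" using attains_min[OF cM Mne order_refl cu]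
        by auto
    then show ?thesis by (intro that[of "u p T"]) auto
  qed
  \<comment> \<open>Where \<open>u\<close> exceeds \<open>\<bar>C\<bar>\<close> the curvature term
    is at most \<open>u * exp (- 2 * u)\<close>, which is below 1, so at a spatial maximum the
    right-hand side of the flow is negative.\<close>
  define m1 where "m1 = max m (\<bar>C\<bar>)"
  \<comment> \<open>The bound uses \<open>\<psi>\<close> at the final time, which by monotonicity
    dominates all boundary values on \<open>{T..t1}\<close>. At the end it is applied with both
    times equal, once \<open>\<psi>\<close> has passed \<open>m1\<close>.\<close>
  have key: "u p t \<le> max m1 (\<psi> t1)" if p: "p \<in> M" and t: "T \<le> t" "t \<le> t1" for p t t1
  proof (rule ccontr)
    assume neg: "\<not> u p t \<le> max m1 (\<psi> t1)"
    have "T \<le> t1" using t by simp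
    then obtain q s where q: "q \<in> M" "s \<in> {T..t1}" and min: "\<forall>q'\<in>M. \<forall>s'\<in>{T..t1}. - u q s \<le> - u q'
        s'"
      using attains_min[OF cM Mne _ cu] by blast
    have big: "u q s > m1" "u q s > \<psi> t1" using min p t neg by force+
    have s: "T < s" using m[OF q(1)] big q(2) by (cases "s = T") (auto simp: m1_def)
    have "q \<notin> bdry S"
    proof
      assume "q \<in> bdry S"
      then have "u q s = \<psi> s" using u_bdry T s by simp
      also have "\<dots> \<le> \<psi> t1" using \<psi>_mono[OF T] s q by auto
      finally show False using big by simp
    qed
    then have qi: "q \<in> inter S" using q by (simp add: inter_def)
    obtain c where c: "c \<in> \<A>" "q \<in> chart_dom c" using q atlas_cover by blast
    let ?x = "chart_map c q" and ?v = "\<lambda>x. u (chart_inv c x) s"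
    have s0: "0 \<le> s" using s T0 by simp
    have "((\<lambda>r. - u q r) has_real_derivative - ut q s) (at s)"
      using u_has_derivative[OF q(1)] s T0 by (intro derivative_intros) auto
    then have "- ut q s \<le> 0" by (rule derivative_nonpos_at_left_min[OF _ s]) (use min q in auto)
    have v2: "Ck_on 2 (chart_img c) ?v" by (rule Ck_on_u[OF c(1) s0])
    \<comment> \<open>The dummy second summand brings the function into the shape of
      \<open>ell_linear\<close>.\<close>
    have "0 \<le> ell c (chart_img c) (\<lambda>x. (-1) * ?v x + 0 * ?v x) ?x"
    proof (rule chart_min[OF c chart_img_open[OF c(1)] order_refl chart_map_img[OF c(2)] qi _
        zero_less_one])
      show "Ck_on 2 (chart_img c) (\<lambda>x. (-1) * ?v x + 0 * ?v x)"
        by (intro Ck_on_add Ck_on_cmult chart_img_open c v2)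
      fix y assume "y \<in> chart_img c"
      then have "chart_inv c y \<in> M" using chart_dom_subset[OF c(1)] by auto
      then show "- 1 * ?v ?x + 0 * ?v ?x \<le> - 1 * ?v y + 0 * ?v y" using min q(2) c by auto
    qed
    then have "ell c (chart_img c) ?v ?x \<le> 0"
      unfolding ell_linear[OF chart_img_open[OF c(1)] chart_map_img[OF c(2)] v2 v2] by simp
    moreover have "ut q s = exp (- 2 * u q s) * (ell c (chart_img c) ?v ?x - K q) - 1" by (rule
        flow_equation[OF qi s0 c])
    moreover from calculation(1) have "exp (- 2 * u q s) * (ell c (chart_img c) ?v ?x - K q) \<le> exp
        (- 2 * u q s) * C"
      using C[OF qi] by (intro mult_left_mono) auto
    ultimately have "1 \<le> exp (- 2 * u q s) * C"
      using \<open>- ut q s \<le> 0\<close> by linarith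
    moreover have "exp (- 2 * u q s) * C \<le> exp (- 2 * u q s) * u q s" using big(1) by (intro
        mult_left_mono) (auto simp: m1_def)
    moreover have "exp (- 2 * u q s) * u q s < 1"
    proof -
      have "0 \<le> u q s" using big(1) by (auto simp: m1_def)
      then have "u q s < exp (2 * u q s)" using exp_ge_add_one_self[of "2 * u q s"] by linarith
      then have "exp (- 2 * u q s) * u q s < exp (- 2 * u q s) * exp (2 * u q s)" by (intro
          mult_strict_left_mono) auto
      then show ?thesis by (simp flip: exp_add)
    qed
    ultimately show False by linarith
  qed
  obtain t1 where t1: "\<And>t. t \<ge> t1 \<Longrightarrow> m1 \<le> \<psi> t"
    using \<psi>_at_top unfolding filterlim_at_top eventually_at_top_linorder by blast
  show ?thesis
  proof (intro exI[of _ "max T t1"] conjI ballI allI impI)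
    fix p t assume "p \<in> M" "t \<ge> max T t1"
    then show "u p t \<le> \<psi> t" using key[of p t t] t1[of t] by auto
  qed (use T in auto)
qed

end

text \<open>An exponent of at least 2 makes the power of the positive part differentiable at 0,
  where the difference quotient is bounded by \<open>\<bar>h\<bar> ^ Suc n\<close>. Two applications
  yield the \<open>C^2\<close> bump.\<close>

lemma has_real_derivative_pos_part_power:
  "((\<lambda>s. (max 0 s) ^ Suc (Suc n)) has_real_derivative real (Suc (Suc n)) * (max 0 s) ^ Suc n) (at
      s)"
proof -
  consider "s < 0" | "s = 0" | "0 < s" by linarith
  then show ?thesis
  proof cases
    case 1
    have "((\<lambda>s. 0) has_real_derivative 0) (at s)" by simp
    then have "((\<lambda>s. (max 0 s) ^ Suc (Suc n)) has_real_derivative 0) (at s)"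
      by (rule has_field_derivative_transform_within_open[of _ _ _ "{..<0}"]) (use 1 in auto)
    then show ?thesis using 1 by simp
  next
    case 2
    have "((\<lambda>h::real. (max 0 h) ^ Suc (Suc n) / h) \<longlongrightarrow> 0) (at 0)"
    proof (rule Lim_null_comparison)
      show "\<forall>\<^sub>F h::real in at 0. norm ((max 0 h) ^ Suc (Suc n) / h) \<le> \<bar>h\<bar> ^ Suc n"
      proof (intro always_eventually allI)
        fix h :: real
        show "norm ((max 0 h) ^ Suc (Suc n) / h) \<le> \<bar>h\<bar> ^ Suc n"
        proof (cases "0 < h")
          case False
          then have "norm ((max 0 h) ^ Suc (Suc n) / h) = 0" by simp
          then show ?thesis by (metis abs_ge_zero zero_le_power)
        qed simp
      qed
      have "((\<lambda>h. \<bar>h\<bar> ^ Suc n) \<longlongrightarrow> \<bar>0::real\<bar> ^ Suc n) (at 0)" by (intro tendsto_intros)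
      then show "((\<lambda>h. \<bar>h\<bar> ^ Suc n) \<longlongrightarrow> (0::real)) (at 0)" by simp
    qed
    then show ?thesis unfolding 2 has_field_derivative_iff by simp
  next
    case 3
    have "((\<lambda>s. s ^ Suc (Suc n)) has_real_derivative real (Suc (Suc n)) * s ^ Suc n) (at s)"
      using DERIV_pow[of "Suc (Suc n)" s] by simp
    then have "((\<lambda>s. (max 0 s) ^ Suc (Suc n)) has_real_derivative real (Suc (Suc n)) * s ^ Suc n)
        (at s)"
      by (rule has_field_derivative_transform_within_open[of _ _ _ "{0<..}"]) (use 3 in auto)
    then show ?thesis using 3 by simp
  qed
qed

lemma compact_lower_bound:
  fixes f :: "'b::topological_space \<Rightarrow> real"
  assumes "compact A" "continuous_on A f" "\<And>x. x \<in> A \<Longrightarrow> 0 < f x"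
  obtains \<theta> where "0 < \<theta>" "\<And>x. x \<in> A \<Longrightarrow> \<theta> \<le> f x"
proof (cases "A = {}")
  case False
  then obtain x where "x \<in> A" "\<forall>y\<in>A. f x \<le> f y" using continuous_attains_inf assms by blast
  then show ?thesis using that assms(3) by blast
qed (use that[of 1] in auto)

lemma compact_abs_bound:
  fixes f :: "'b::topological_space \<Rightarrow> real"
  assumes "compact A" "continuous_on A f"
  obtains C where "0 \<le> C" "\<And>x. x \<in> A \<Longrightarrow> \<bar>f x\<bar> \<le> C"
proof (cases "A = {}")
  case False
  then obtain x where "x \<in> A" "\<forall>y\<in>A. \<bar>f y\<bar> \<le> \<bar>f x\<bar>"
    using continuous_attains_sup[of A "\<lambda>x. \<bar>f x\<bar>"] assms continuous_on_rabs by blast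
  then show ?thesis using that[of "\<bar>f x\<bar>"] by auto
qed (use that[of 0] in auto)

section \<open>Bump functions and subharmonic functions on the whole surface\<close>

context riemannian_surface
begin

definition C2 :: "('a \<Rightarrow> real) \<Rightarrow> bool" where
  "C2 f \<longleftrightarrow> (\<forall>c\<in>\<A>. Ck_on 2 (chart_img c) (f \<circ> chart_inv c))"

abbreviation "cell c f \<equiv> ell c (chart_img c) (f \<circ> chart_inv c)"

lemma laplacian_ell:
  assumes "C2 f" "c \<in> \<A>" "p \<in> chart_dom c"
  shows "laplacian S f p = cell c f (chart_map c p)"
proof -
  have f: "Ck_on 2 (chart_img c) (f \<circ> chart_inv c)" using assms by (auto simp: C2_def)
  have "p \<in> M" using chart_dom_subset[OF assms(2)] assms(3) by auto
  from laplacian_chart[OF this assms(2,3) f] lap_ell[OF assms(2) chart_map_img[OF assms(3)] f] show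
      ?thesis by simp
qed

lemma C2_linear: "C2 f \<Longrightarrow> C2 h \<Longrightarrow> C2 (\<lambda>p. a * f p + b * h p)"
  unfolding C2_def using chart_img_open by (auto simp: o_def intro!: Ck_on_add Ck_on_cmult)

lemma laplacian_linear:
  assumes "C2 f" "C2 h" "p \<in> M"
  shows "laplacian S (\<lambda>p. a * f p + b * h p) p = a * laplacian S f p + b * laplacian S h p"
proof -
  obtain c where c: "c \<in> \<A>" "p \<in> chart_dom c" using assms atlas_cover by blast
  have "Ck_on 2 (chart_img c) (f \<circ> chart_inv c)" "Ck_on 2 (chart_img c) (h \<circ> chart_inv c)"
    using assms c by (auto simp: C2_def)
  from ell_linear[OF chart_img_open[OF c(1)] chart_map_img[OF c(2)] this, of c a b]
  show ?thesis unfolding laplacian_ell[OF C2_linear[OF assms(1,2)] c] laplacian_ell[OF assms(1) c]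
      laplacian_ell[OF assms(2) c]
    by (simp add: o_def)
qed

lemma continuous_ell:
  assumes c: "c \<in> \<A>" and V: "hp_open V" "V \<subseteq> chart_img c" and f: "Ck_on 2 V f"
  shows "continuous_on V (ell c V f)"
proof -
  have f2: "Ck_on (Suc (Suc 0)) V f" using f by (simp add: Ck_on_2)
  show ?thesis unfolding ell_def[abs_def]
    by (intro continuous_intros continuous_on_subset[OF Ck_on_imp_continuous[OF Ck_on_metric_inv[OF
        c]] V(2)]
        continuous_on_subset[OF continuous_lap_coeff[OF c] V(2)]
        Ck_on_imp_continuous[OF Ck_on_pdi[OF f2]] Ck_on_imp_continuous[OF Ck_on_pdi[OF Ck_on_pdi[OF
            f2]]])
qed

lemma continuous_gradsq:
  assumes c: "c \<in> \<A>" and V: "hp_open V" "V \<subseteq> chart_img c" and f: "Ck_on (Suc k) V f"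
  shows "continuous_on V (gradsq c V f)"
  unfolding gradsq_def[abs_def]
  by (intro continuous_intros continuous_on_subset[OF Ck_on_imp_continuous[OF Ck_on_metric_inv[OF
      c]] V(2)]
        Ck_on_imp_continuous[OF Ck_on_pdi[OF f]])

lemma gradsq_pos:
  assumes c: "c \<in> \<A>" "x \<in> chart_img c" and nz: "pdi V 1 f x \<noteq> 0 \<or> pdi V 2 f x \<noteq> 0"
  shows "0 < gradsq c V f x"
proof -
  define a b d where "a = metric_inv S c x $ 1 $ 1" and "b = metric_inv S c x $ 1 $ 2" and "d =
      metric_inv S c x $ 2 $ 2"
  define v w where "v = pdi V 1 f x" and "w = pdi V 2 f x"
  have p: "0 < a" "0 < a * d - b * b" using metric_inv_pos[OF c] by (auto simp: a_def b_def d_def)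
  have e: "a * gradsq c V f x = (a * v + b * w)\<^sup>2 + (a * d - b * b) * w\<^sup>2"
    by (simp add: gradsq_def a_def b_def d_def v_def w_def power2_eq_square algebra_simps)
  have "0 < (a * v + b * w)\<^sup>2 + (a * d - b * b) * w\<^sup>2"
  proof (cases "w = 0")
    case True then show ?thesis using nz p by (simp add: v_def w_def)
  next
    case False then show ?thesis using p by (simp add: add_nonneg_pos)
  qed
  then show ?thesis using e p(1) by (metis zero_less_mult_pos)
qed

lemma openin_laplacian_greater:
  assumes f: "C2 f" shows "openin X {p \<in> M. k < laplacian S f p}"
proof (subst openin_subopen, intro ballI)
  fix p assume p: "p \<in> {p \<in> M. k < laplacian S f p}"
  then obtain c where c: "c \<in> \<A>" "p \<in> chart_dom c" using atlas_cover by blast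
  let ?W = "{x \<in> chart_img c. 0 < cell c f x - k}"
  have "hp_open ?W"
    using f c by (intro openin_continuous_preimage_greaterThan chart_img_open continuous_intros
        continuous_ell) (auto simp: C2_def)
  then have o: "openin X (chart_inv c ` ?W)" by (rule openin_chart_preimage[OF c(1)]) auto
  have e: "chart_inv c ` ?W = {q \<in> chart_dom c. chart_map c q \<in> ?W}" by (rule chart_inv_image[OF
      c(1)]) auto
  have "p \<in> chart_inv c ` ?W" unfolding e using p c laplacian_ell[OF f c] by auto
  moreover have "chart_inv c ` ?W \<subseteq> {p \<in> M. k < laplacian S f p}"
    unfolding e using laplacian_ell[OF f c(1)] chart_dom_subset[OF c(1)] by auto
  ultimately show "\<exists>T. openin X T \<and> p \<in> T \<and> T \<subseteq> {p \<in> M. k < laplacian S f p}" using o by blast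
qed

lemma continuous_chart_inv:
  assumes c: "c \<in> \<A>" shows "continuous_map (top_of_set (chart_img c)) X (chart_inv c)"
  unfolding continuous_map_def
proof (intro conjI allI impI)
  show "chart_inv c \<in> topspace (top_of_set (chart_img c)) \<rightarrow> M" using chart_dom_subset[OF c] by auto
  fix U assume U: "openin X U"
  have "{x \<in> topspace (top_of_set (chart_img c)). chart_inv c x \<in> U} = chart_map c ` (U \<inter> chart_dom
      c)"
    using c by (force simp: image_iff)
  moreover have "hp_open (chart_map c ` (U \<inter> chart_dom c))"
    by (intro openin_chart_image c openin_Int U chart_dom_open) auto
  then have "openin (top_of_set (chart_img c)) (chart_map c ` (U \<inter> chart_dom c))"
    by (rule openin_subset_trans) (use hp_open_nonneg[OF chart_img_open[OF c]] in \<open>auto simp: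
        half_plane_def\<close>)
  ultimately show "openin (top_of_set (chart_img c)) {x \<in> topspace (top_of_set (chart_img c)).
      chart_inv c x \<in> U}" by simp
qed

lemma closedin_chart_compact:
  assumes c: "c \<in> \<A>" and A: "compact A" "A \<subseteq> chart_img c"
  shows "closedin X (chart_inv c ` A)"
proof -
  have "compactin (top_of_set (chart_img c)) A" using A by (simp add: compactin_subtopology)
  then have "compactin X (chart_inv c ` A)" by (rule image_compactin[OF _ continuous_chart_inv[OF
      c]])
  then show ?thesis by (rule compactin_imp_closedin[OF Hausdorff_X])
qed

lemma ell_zero:
  assumes "hp_open V" "x \<in> V" "\<And>y. y \<in> V \<Longrightarrow> f y = 0"
  shows "ell c V f x = 0"
proof -
  have "ell c V f x = ell c V (quad 0 0 0 0 0 0 0) x" by (rule ell_cong) (use assms in \<open>auto simp: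
      quad_def\<close>)
  then show ?thesis by (simp add: ell_quad[OF assms(1,2)])
qed

text \<open>A high power of the positive part of \<open>R\<^sup>2 - |x - x0|\<^sup>2\<close> is subharmonic away from the centre.\<close>

lemma bump_function:
  assumes c: "c \<in> \<A>" and R: "0 < R" "0 < \<rho>" "cball x0 R \<inter> half_plane \<subseteq> chart_img c"
  obtains h where "C2 h"
    "\<And>p. p \<in> chart_dom c \<Longrightarrow> \<rho> \<le> dist (chart_map c p) x0 \<Longrightarrow> dist (chart_map c p) x0 < R \<Longrightarrow> 0 < laplacian
        S h p"
    "\<And>p. p \<in> M \<Longrightarrow> p \<notin> chart_dom c \<or> R \<le> dist (chart_map c p) x0 \<Longrightarrow> laplacian S h p = 0"
proof -
  let ?V = "chart_img c"
  note V = chart_img_open[OF c]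
  define q where "q = quad x0 (R\<^sup>2) 0 0 (- 1) 0 (- 1)"
  have q: "q x = R\<^sup>2 - (dist x x0)\<^sup>2" for x
    by (simp add: q_def quad_def dist_vec_def L2_set_def sum_2 dist_real_def)
  have q2: "Ck_on 2 ?V q" unfolding q_def by (rule Ck_on_quad[OF V])
  let ?A = "cball x0 R \<inter> half_plane"
  let ?B = "?A \<inter> {x. \<rho> \<le> dist x x0}"
  have cB: "compact ?B" by (intro compact_Int_closed compact_half_ball closed_Collect_le
      continuous_intros)
  have gp: "0 < gradsq c ?V q x" if "x \<in> ?B" for x
  proof (rule gradsq_pos[OF c])
    show x: "x \<in> ?V" using that R by auto
    show "pdi ?V 1 q x \<noteq> 0 \<or> pdi ?V 2 q x \<noteq> 0"
    proof (rule ccontr)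
      assume "\<not> ?thesis"
      then have "x = x0" unfolding q_def pdi_quad[OF V x] by (simp add: vec_eq_iff forall_2)
      then show False using that R(2) by auto
    qed
  qed
  have q3: "Ck_on (Suc (Suc 0)) ?V q" using q2 by (simp add: Ck_on_2)
  have "continuous_on ?B (gradsq c ?V q)"
    by (rule continuous_on_subset[OF continuous_gradsq[OF c V order_refl q3]]) (use R in auto)
  then obtain \<theta> where \<theta>: "0 < \<theta>" "\<And>x. x \<in> ?B \<Longrightarrow> \<theta> \<le> gradsq c ?V q x" using compact_lower_bound[where
      f = "gradsq c ?V q", OF cB _ gp] by blast
  have "continuous_on ?B (ell c ?V q)"
    by (rule continuous_on_subset[OF continuous_ell[OF c V order_refl q2]]) (use R in auto)
  then obtain C where C: "0 \<le> C" "\<And>x. x \<in> ?B \<Longrightarrow> \<bar>ell c ?V q x\<bar> \<le> C" using compact_abs_bound[where f =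
      "ell c ?V q", OF cB] by blast
  \<comment> \<open>The exponent is chosen so that the gradient term, which comes with more than
    \<open>n * \<theta>\<close>, beats \<open>q\<close> times the Laplacian of \<open>q\<close>,
    whose absolute value is at most \<open>R * R * C\<close> where \<open>q\<close> is
    positive.\<close>
  obtain n :: nat where n: "R\<^sup>2 * C / \<theta> < real n" using reals_Archimedean2 by blast
  define f where "f = (\<lambda>x. (max 0 (q x)) ^ Suc (Suc (Suc (Suc n))))"
  have cont: "continuous_on ?V (\<lambda>x. real (Suc (Suc (Suc (Suc n)))) * (real (Suc (Suc (Suc n))) *
      (max 0 (q x)) ^ Suc (Suc n)))"
    by (intro continuous_intros Ck_on_imp_continuous[OF q2])
  note D = ell_compose[OF V _ q2, where \<phi> = "\<lambda>s. (max 0 s) ^ Suc (Suc (Suc (Suc n)))"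
      and \<phi>' = "\<lambda>s. real (Suc (Suc (Suc (Suc n)))) * (max 0 s) ^ Suc (Suc (Suc n))"
      and \<phi>'' = "\<lambda>s. real (Suc (Suc (Suc (Suc n)))) * (real (Suc (Suc (Suc n))) * (max 0 s) ^ Suc
          (Suc n))",
      OF _ has_real_derivative_pos_part_power DERIV_cmult[OF has_real_derivative_pos_part_power]
          cont]
  have f2: "Ck_on 2 ?V f"
  \<comment> \<open>\<open>ell_compose\<close> speaks about a point of \<open>V\<close>, so an empty
    chart image is treated apart.\<close>
  proof (cases "?V = {}")
    case True
    then show ?thesis unfolding Ck_on_2 by (simp add: Ck_on.simps(2))
  next
    case False
    then show ?thesis using D(2) unfolding f_def by blast
  qed
  have f0: "f x = 0" if "R \<le> dist x x0" for x
    using that R(1) by (simp add: f_def q max_def power_mono)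
  have ellf: "ell c ?V f x = real (Suc (Suc (Suc (Suc n)))) * (max 0 (q x)) ^ Suc (Suc n) *
      (max 0 (q x) * ell c ?V q x + real (Suc (Suc (Suc n))) * gradsq c ?V q x)" if "x \<in> ?V" for x
    unfolding f_def D(1)[OF that] by (simp add: algebra_simps)
  define h where "h = (\<lambda>p. if p \<in> chart_dom c then f (chart_map c p) else 0)"
  have hc: "(h \<circ> chart_inv c) x = f x" if "x \<in> ?V" for x using that by (simp add: h_def)
  \<comment> \<open>A compact set in the chart is closed in the Hausdorff surface. Its complement is
    thus an open set on which the extension vanishes, and this makes the extension by zero
    \<open>C^2\<close> in every other chart.\<close>
  let ?Z = "chart_inv c ` ?A"
  have Z: "closedin X ?Z" by (rule closedin_chart_compact[OF c compact_half_ball R(3)])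
  have hZ: "h p = 0" if "p \<notin> ?Z" for p
  proof (cases "p \<in> chart_dom c")
    case True
    have "chart_map c p \<notin> ?A" using that c True by (metis chart_inv_map imageI)
    then have "chart_map c p \<notin> cball x0 R"
      using hp_open_nonneg[OF V chart_map_img[OF True]] by (auto simp: half_plane_def)
    then show ?thesis using True f0 by (simp add: h_def dist_commute)
  qed (simp add: h_def)
  have ZU: "hp_open (chart_map c' ` (chart_dom c' - ?Z))" if "c' \<in> \<A>" for c'
    by (intro openin_chart_image that openin_diff chart_dom_open Z) auto
  have C2h: "C2 h" unfolding C2_def
  proof
    fix c' assume c': "c' \<in> \<A>"
    show "Ck_on 2 (chart_img c') (h \<circ> chart_inv c')"
    proof (rule Ck_on_local[OF chart_img_open[OF c']])
      fix x assume x: "x \<in> chart_img c'"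
      show "\<exists>U. hp_open U \<and> U \<subseteq> chart_img c' \<and> x \<in> U \<and> Ck_on 2 U (h \<circ> chart_inv c')"
      proof (cases "chart_inv c' x \<in> chart_dom c")
        case True
        have "Ck_on 2 (overlap c' c) (\<lambda>y. f (transition c' c y))"
          by (rule Ck_on_compose[OF overlap_open[OF c' c] V transition_overlap[OF c'] f2
              smooth_transition[OF c' c]])
        moreover have "Ck_on 2 (overlap c' c) (h \<circ> chart_inv c') \<longleftrightarrow> Ck_on 2 (overlap c' c) (\<lambda>y. f
            (transition c' c y))"
        proof (rule Ck_on_cong)
          fix y assume y: "y \<in> overlap c' c"
          show "(h \<circ> chart_inv c') y = f (transition c' c y)"
            using chart_function_transition[OF c' c y, of h] hc[OF transition_overlap[OF c' y]] by
                simp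
        qed
        moreover have "x \<in> overlap c' c" using overlapI[OF chart_inv_dom[OF x] True] x by simp
        ultimately show ?thesis
          by (intro exI[of _ "overlap c' c"] conjI overlap_open[OF c' c] overlap_subset) auto
      next
        case False
        let ?U = "chart_map c' ` (chart_dom c' - ?Z)"
        have "?Z \<subseteq> chart_dom c" using R(3) by auto
        then have "x \<in> ?U" using False x by (intro image_eqI[of _ _ "chart_inv c' x"]) auto
        moreover have "Ck_on 2 ?U (h \<circ> chart_inv c')"
        proof (rule iffD2[OF Ck_on_cong Ck_on_const[OF ZU[OF c']]])
          fix y assume "y \<in> ?U"
          then obtain z where z: "z \<in> chart_dom c'" "z \<notin> ?Z" "y = chart_map c' z" by blast
          show "(h \<circ> chart_inv c') y = 0" using hZ[OF z(2)] z(1,3) c' by simp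
        qed
        ultimately show ?thesis using ZU[OF c'] by (intro exI[of _ ?U]) auto
      qed
    qed
  qed
  have lapc: "laplacian S h p = ell c ?V f (chart_map c p)" if "p \<in> chart_dom c" for p
    unfolding laplacian_ell[OF C2h c that] by (rule ell_cong[OF chart_map_img[OF that] hc])
  show ?thesis
  proof (rule that[OF C2h])
    fix p assume p: "p \<in> chart_dom c" "\<rho> \<le> dist (chart_map c p) x0" "dist (chart_map c p) x0 < R"
    let ?x = "chart_map c p"
    have B: "?x \<in> ?B" using p hp_open_nonneg[OF V chart_map_img[OF p(1)]] by (auto simp:
        half_plane_def dist_commute)
    have qp: "0 < q ?x" using p(3) R(1) by (simp add: q power_strict_mono)
    have "q ?x \<le> R\<^sup>2" by (simp add: q)
    then have "q ?x * \<bar>ell c ?V q ?x\<bar> \<le> R\<^sup>2 * C" using C(2)[OF B] qp by (intro mult_mono) auto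
    also have "\<dots> < real n * \<theta>" using n \<theta>(1) by (simp add: pos_divide_less_eq)
    also have "\<dots> \<le> real (Suc (Suc (Suc n))) * gradsq c ?V q ?x" using \<theta>(2)[OF B] \<theta>(1) by (intro
        mult_mono) auto
    finally have lt: "q ?x * \<bar>ell c ?V q ?x\<bar> < real (Suc (Suc (Suc n))) * gradsq c ?V q ?x" .
    have "0 < q ?x * ell c ?V q ?x + real (Suc (Suc (Suc n))) * gradsq c ?V q ?x"
    proof -
      have "- (q ?x * \<bar>ell c ?V q ?x\<bar>) \<le> q ?x * ell c ?V q ?x"
        using qp mult_left_mono[of "- \<bar>ell c ?V q ?x\<bar>" "ell c ?V q ?x" "q ?x"] by simp
      with lt show ?thesis by linarith
    qed
    then show "0 < laplacian S h p"
      unfolding lapc[OF p(1)] ellf[OF chart_map_img[OF p(1)]] using qp by (intro mult_pos_pos) auto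
  next
    fix p assume p: "p \<in> M" and d: "p \<notin> chart_dom c \<or> R \<le> dist (chart_map c p) x0"
    show "laplacian S h p = 0"
    proof (cases "p \<in> chart_dom c")
      case True
      then have "R \<le> dist (chart_map c p) x0" using d by simp
      then have "q (chart_map c p) \<le> 0" using R(1) by (simp add: q power_mono)
      then show ?thesis unfolding lapc[OF True] ellf[OF chart_map_img[OF True]] by simp
    next
      case False
      obtain c' where c': "c' \<in> \<A>" "p \<in> chart_dom c'" using p atlas_cover by blast
      let ?U = "chart_map c' ` (chart_dom c' - ?Z)"
      have "?Z \<subseteq> chart_dom c" using R(3) by auto
      then have xU: "chart_map c' p \<in> ?U" using False c' by auto
      have "cell c' h (chart_map c' p) = ell c' ?U (h \<circ> chart_inv c') (chart_map c' p)"
        by (rule ell_subset[OF ZU[OF c'(1)] chart_img_open[OF c'(1)] _ xU, symmetric]) auto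
      also have "\<dots> = 0" by (rule ell_zero[OF ZU[OF c'(1)] xU]) (use c' hZ in auto)
      finally show ?thesis unfolding laplacian_ell[OF C2h c'] .
    qed
  qed
qed

definition subharmonic :: "('a \<Rightarrow> real) \<Rightarrow> bool" where
  "subharmonic f \<longleftrightarrow> C2 f \<and> (\<forall>p\<in>M. 0 \<le> laplacian S f p)"

text \<open>The points that some globally defined subharmonic function sees strictly form the union of
  the components of the surface that meet the boundary.\<close>

definition bounded_part :: "'a set" where
  "bounded_part = {p \<in> M. \<exists>f. subharmonic f \<and> 0 < laplacian S f p}"

lemma bounded_part_open: "openin X bounded_part"
proof -
  have "bounded_part = \<Union> {{p \<in> M. 0 < laplacian S f p} | f. subharmonic f}"
    unfolding bounded_part_def by auto
  also have "openin X \<dots>"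
    by (intro openin_Union) (auto simp: subharmonic_def intro: openin_laplacian_greater)
  finally show ?thesis .
qed

text \<open>The bump is centred below the boundary line, so that its core, the only place where
  subharmonicity may fail, does not meet the half plane.\<close>

lemma bdry_bounded_part: "bdry S \<subseteq> bounded_part"
proof
  fix p assume p: "p \<in> bdry S"
  then have pM: "p \<in> M" by (simp add: bdry_def)
  obtain c where c: "c \<in> \<A>" "p \<in> chart_dom c" using pM atlas_cover by blast
  let ?x = "chart_map c p"
  have x2: "?x $ 2 = 0" by (rule boundary_chart[OF p c])
  obtain r where r: "0 < r" "cball ?x r \<inter> half_plane \<subseteq> chart_img c"
    using half_ball_nhd[OF c chart_img_open[OF c(1)] order_refl chart_map_img[OF c(2)]] .
  \<comment> \<open>The centre is \<open>r / 4\<close> below the line: points of the half plane are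
    farther away than \<open>r / 8\<close>, the point \<open>p\<close> itself is nearer than
    \<open>r / 2\<close>, and the ball of radius \<open>r / 2\<close> stays within
    \<open>cball ?x r\<close>.\<close>
  define x0 where "x0 = ?x - (r / 4) *\<^sub>R axis 2 1"
  have d: "dist ?x x0 = r / 4" using r by (simp add: x0_def dist_norm)
  have "cball x0 (r/2) \<subseteq> cball ?x r"
  proof
    fix y assume "y \<in> cball x0 (r/2)"
    then show "y \<in> cball ?x r" using dist_triangle[of ?x y x0] d r(1) by (simp add: dist_commute)
  qed
  then have sub: "cball x0 (r/2) \<inter> half_plane \<subseteq> chart_img c" using r(2) by blast
  have far: "r / 8 \<le> dist y x0" if "0 \<le> y $ 2" for y
  proof -
    have "r / 4 \<le> y $ 2 - x0 $ 2" using that x2 by (simp add: x0_def)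
    also have "\<dots> \<le> dist y x0" using component_le_norm_cart[of "y - x0" 2] by (simp add: dist_norm)
    finally show ?thesis using r(1) by simp
  qed
  have r28: "0 < r / 2" "0 < r / 8" using r(1) by auto
  obtain h where h: "C2 h"
    "\<And>p. p \<in> chart_dom c \<Longrightarrow> r/8 \<le> dist (chart_map c p) x0 \<Longrightarrow> dist (chart_map c p) x0 < r/2 \<Longrightarrow> 0 <
        laplacian S h p"
    "\<And>p. p \<in> M \<Longrightarrow> p \<notin> chart_dom c \<or> r/2 \<le> dist (chart_map c p) x0 \<Longrightarrow> laplacian S h p = 0"
    using bump_function[OF c(1) r28 sub] by metis
  have pos: "0 < laplacian S h q" if "q \<in> chart_dom c" "dist (chart_map c q) x0 < r/2" for q
    by (rule h(2)[OF that(1) far[OF hp_open_nonneg[OF chart_img_open[OF c(1)] chart_map_img[OF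
        that(1)]]] that(2)])
  have "subharmonic h" unfolding subharmonic_def
  proof (intro conjI h(1) ballI)
    fix q assume q: "q \<in> M"
    show "0 \<le> laplacian S h q"
    proof (cases "q \<in> chart_dom c \<and> dist (chart_map c q) x0 < r/2")
      case True then show ?thesis using pos[of q] by simp
    next
      case False then show ?thesis using h(3)[OF q] by auto
    qed
  qed
  moreover have "0 < laplacian S h p" by (rule pos[OF c(2)]) (use d r in simp)
  ultimately show "p \<in> bounded_part" using pM by (auto simp: bounded_part_def)
qed

text \<open>Near a limit point \<open>p\<close> there is \<open>p1\<close> at which some subharmonic
  \<open>f\<close> is strict. A bump centred at \<open>p1\<close> has positive Laplacian on an
  annulus that reaches beyond \<open>p\<close>; in the small ball that is left out, a large multiple
  of \<open>f\<close> compensates.\<close>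

lemma bounded_part_closed: "closedin X bounded_part"
proof -
  have "X closure_of bounded_part \<subseteq> bounded_part"
  proof
    fix p assume p: "p \<in> X closure_of bounded_part"
    then have pM: "p \<in> M" by (simp add: in_closure_of)
    obtain c where c: "c \<in> \<A>" "p \<in> chart_dom c" using pM atlas_cover by blast
    let ?x = "chart_map c p"
    note V = chart_img_open[OF c(1)]
    obtain r where r: "0 < r" "cball ?x r \<inter> half_plane \<subseteq> chart_img c"
      using half_ball_nhd[OF c V order_refl chart_map_img[OF c(2)]] .
    \<comment> \<open>With radius \<open>r / 3\<close> the bump of radius \<open>r / 2\<close>
      around \<open>p1\<close> contains \<open>p\<close> and stays inside
      \<open>cball ?x r\<close>.\<close>
    let ?N = "chart_inv c ` (ball ?x (r/3) \<inter> half_plane)"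
    have Nsub: "ball ?x (r/3) \<inter> half_plane \<subseteq> chart_img c" using r by (intro order_trans[OF _ r(2)])
        auto
    have oN: "openin X ?N" by (rule openin_chart_preimage[OF c(1) openin_half_plane_ball Nsub])
    have "?x \<in> half_plane" using hp_open_nonneg[OF V chart_map_img[OF c(2)]] by (simp add:
        half_plane_def)
    then have pN: "p \<in> ?N" using r(1) c by (intro image_eqI[of _ _ ?x]) auto
    have "\<forall>T. p \<in> T \<and> openin X T \<longrightarrow> (\<exists>y. y \<in> bounded_part \<and> y \<in> T)" using p by (simp add:
        in_closure_of)
    from this[rule_format, OF conjI[OF pN oN]]
    obtain p1 where p1: "p1 \<in> bounded_part" "p1 \<in> ?N" by (elim exE conjE) (rule that)
    obtain f where f: "subharmonic f" "0 < laplacian S f p1" using p1(1) by (auto simp: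
        bounded_part_def)
    have fC: "C2 f" using f(1) by (simp add: subharmonic_def)
    define x0 where "x0 = chart_map c p1"
    have p1c: "p1 \<in> chart_dom c" and d: "dist ?x x0 < r/3" 
      using p1(2) Nsub by (auto simp: x0_def subset_iff)
    have "cball x0 (r/2) \<subseteq> cball ?x r"
    proof
      fix y assume "y \<in> cball x0 (r/2)"
      then show "y \<in> cball ?x r" using dist_triangle[of ?x y x0] d r(1) by (simp add: dist_commute)
    qed
    then have sub: "cball x0 (r/2) \<inter> half_plane \<subseteq> chart_img c" using r(2) by blast
    let ?W = "{x \<in> chart_img c. 0 < cell c f x}"
    have fc: "Ck_on 2 (chart_img c) (f \<circ> chart_inv c)" using fC c by (auto simp: C2_def)
    have W: "hp_open ?W" by (intro openin_continuous_preimage_greaterThan V continuous_ell c(1)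
        order_refl fc)
    have x0W: "x0 \<in> ?W" using f(2) p1c unfolding laplacian_ell[OF fC c(1) p1c] by (simp add: x0_def)
    have Ws: "?W \<subseteq> chart_img c" by auto
    obtain \<rho> where \<rho>: "0 < \<rho>" "cball x0 \<rho> \<inter> half_plane \<subseteq> ?W"
      using half_ball_nhd[OF c(1) p1c W Ws] x0W unfolding x0_def by blast
    have r2: "0 < r/2" using r by simp
    obtain h where h: "C2 h"
      "\<And>p. p \<in> chart_dom c \<Longrightarrow> \<rho> \<le> dist (chart_map c p) x0 \<Longrightarrow> dist (chart_map c p) x0 < r/2 \<Longrightarrow> 0 <
          laplacian S h p"
      "\<And>p. p \<in> M \<Longrightarrow> p \<notin> chart_dom c \<or> r/2 \<le> dist (chart_map c p) x0 \<Longrightarrow> laplacian S h p = 0"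
      using bump_function[OF c(1) r2 \<rho>(1) sub] by metis
    have hc: "Ck_on 2 (chart_img c) (h \<circ> chart_inv c)" using h(1) c by (auto simp: C2_def)
    let ?B = "cball x0 \<rho> \<inter> half_plane"
    have B: "compact ?B" "?B \<subseteq> chart_img c" using \<rho>(2) compact_half_ball by auto
    obtain \<theta> where \<theta>: "0 < \<theta>" "\<And>x. x \<in> ?B \<Longrightarrow> \<theta> \<le> cell c f x"
      using compact_lower_bound[where f = "cell c f", OF B(1) continuous_on_subset[OF
          continuous_ell[OF c(1) V order_refl fc] B(2)]] \<rho>(2) by blast
    obtain C where C: "0 \<le> C" "\<And>x. x \<in> ?B \<Longrightarrow> \<bar>cell c h x\<bar> \<le> C"
      using compact_abs_bound[where f = "cell c h", OF B(1) continuous_on_subset[OF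
          continuous_ell[OF c(1) V order_refl hc] B(2)]] by blast
    \<comment> \<open>Makes \<open>L * \<theta>\<close> exceed the bound \<open>C\<close> for the
      Laplacian of the bump by 1 on the small ball.\<close>
    define L where "L = (C + 1) / \<theta>"
    have L: "0 \<le> L" "L * \<theta> = C + 1" using C(1) \<theta>(1) by (auto simp: L_def)
    define F where "F = (\<lambda>p. L * f p + 1 * h p)"
    have FC: "C2 F" unfolding F_def by (rule C2_linear[OF fC h(1)])
    have lF: "laplacian S F q = L * laplacian S f q + laplacian S h q" if "q \<in> M" for q
      unfolding F_def laplacian_linear[OF fC h(1) that] by simp
    have core: "0 < laplacian S F q" if q: "q \<in> chart_dom c" "dist (chart_map c q) x0 < \<rho>" for q
    proof -
      have qM: "q \<in> M" using q chart_dom_subset[OF c(1)] by auto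
      have "chart_map c q \<in> ?B" using q hp_open_nonneg[OF V chart_map_img[OF q(1)]] by (auto simp:
          half_plane_def dist_commute)
      then have "\<theta> \<le> laplacian S f q" "\<bar>laplacian S h q\<bar> \<le> C"
        using \<theta>(2) C(2) laplacian_ell[OF fC c(1) q(1)] laplacian_ell[OF h(1) c(1) q(1)] by auto
      moreover from this(1) have "L * \<theta> \<le> L * laplacian S f q" using L(1) by (intro mult_left_mono)
      ultimately show ?thesis unfolding lF[OF qM] using L(2) by linarith
    qed
    have fpos: "0 \<le> L * laplacian S f q" if "q \<in> M" for q using f(1) L(1) that by (simp add:
        subharmonic_def)
    have "subharmonic F" unfolding subharmonic_def
    proof (intro conjI FC ballI)
      fix q assume q: "q \<in> M"
      show "0 \<le> laplacian S F q"
      proof (cases "q \<in> chart_dom c \<and> dist (chart_map c q) x0 < \<rho>")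
        case True then show ?thesis using core by (simp add: less_imp_le)
      next
        case False
        have "0 \<le> laplacian S h q"
        proof (cases "q \<in> chart_dom c \<and> dist (chart_map c q) x0 < r/2")
          case True then show ?thesis using h(2)[of q] False by simp
        next
          case False then show ?thesis using h(3)[OF q] by auto
        qed
        then show ?thesis unfolding lF[OF q] using fpos[OF q] by simp
      qed
    qed
    moreover have "0 < laplacian S F p"
    proof (cases "dist ?x x0 < \<rho>")
      case True then show ?thesis using core c by simp
    next
      case False
      then have "0 < laplacian S h p" using h(2)[OF c(2)] d r(1) by simp
      then show ?thesis unfolding lF[OF pM] using fpos[OF pM] by simp
    qed
    ultimately show "p \<in> bounded_part" using pM by (auto simp: bounded_part_def)
  qed
  then show ?thesis using closure_of_subset_eq[of bounded_part X] openin_subset[OF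
      bounded_part_open] by simp
qed

text \<open>Subharmonic functions may be added without losing strictness anywhere, so a finite cover
  of the compact set gives one function. A second compactness argument makes its lower bound
  uniform.\<close>

lemma strictly_subharmonic:
  obtains f \<theta> where "subharmonic f" "0 < \<theta>" "\<And>p. p \<in> bounded_part \<Longrightarrow> \<theta> \<le> laplacian S f p"
proof -
  have "\<forall>p\<in>bounded_part. \<exists>f. subharmonic f \<and> 0 < laplacian S f p" by (simp add: bounded_part_def)
  then have "\<exists>w. \<forall>p\<in>bounded_part. subharmonic (w p) \<and> 0 < laplacian S (w p) p" by (rule bchoice)
  then obtain w where w: "\<And>p. p \<in> bounded_part \<Longrightarrow> subharmonic (w p) \<and> 0 < laplacian S (w p) p" by
      blast
  define N where "N = (\<lambda>p. {q \<in> M. 0 < laplacian S (w p) q})"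
  have N: "openin X (N p)" "p \<in> N p" if "p \<in> bounded_part" for p
    using w[OF that] that unfolding N_def bounded_part_def by (auto simp: subharmonic_def intro:
        openin_laplacian_greater)
  obtain H where H: "finite H" "H \<subseteq> bounded_part" "bounded_part \<subseteq> \<Union> (N ` H)"
    using finite_subcover[OF bounded_part_closed N] .
  have "\<exists>f. subharmonic f \<and> (\<forall>p\<in>H. \<forall>q\<in>N p. 0 < laplacian S f q)"
    using H(1,2)
  proof (induction H)
    case empty
    have "C2 (\<lambda>p. 0)" using chart_img_open by (auto simp: C2_def o_def)
    moreover have "laplacian S (\<lambda>p. 0) p = 0" if "p \<in> M" for p
      using laplacian_linear[OF calculation calculation that, of 0 0] by simp
    ultimately show ?case by (auto simp: subharmonic_def)
  next
    case (insert p H)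
    have "H \<subseteq> bounded_part" "p \<in> bounded_part" using insert.prems by auto
    then obtain f where f: "subharmonic f" "\<forall>p\<in>H. \<forall>q\<in>N p. 0 < laplacian S f q" using insert.IH by
        blast
    have wp: "subharmonic (w p)" using w[OF \<open>p \<in> bounded_part\<close>] by simp
    have l: "laplacian S (\<lambda>q. 1 * f q + 1 * w p q) q = laplacian S f q + laplacian S (w p) q" if "q
        \<in> M" for q
      using laplacian_linear[of f "w p" q 1 1] f(1) wp that by (simp add: subharmonic_def)
    have NM: "N p' \<subseteq> M" for p' by (auto simp: N_def)
    show ?case
    proof (intro exI[of _ "\<lambda>q. 1 * f q + 1 * w p q"] conjI ballI)
      show "subharmonic (\<lambda>q. 1 * f q + 1 * w p q)"
        using f(1) wp C2_linear[of f "w p" 1 1] l by (auto simp: subharmonic_def)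
      fix p' q assume p': "p' \<in> insert p H" and q: "q \<in> N p'"
      have qM: "q \<in> M" using q NM by auto
      have "0 \<le> laplacian S f q" "0 \<le> laplacian S (w p) q" using f(1) wp qM by (auto simp:
          subharmonic_def)
      moreover have "0 < laplacian S f q \<or> 0 < laplacian S (w p) q" using p' q f(2) by (auto simp:
          N_def)
      ultimately show "0 < laplacian S (\<lambda>q. 1 * f q + 1 * w p q) q" unfolding l[OF qM] by linarith
    qed
  qed
  then obtain f where f: "subharmonic f" "\<And>q. q \<in> bounded_part \<Longrightarrow> 0 < laplacian S f q" using H(3) by
      blast
  \<comment> \<open>\<open>compact_uniform\<close> asks for a property monotone in \<open>C\<close>,
    so the lower bound is sought as a reciprocal, and positivity of the Laplacian is carried along
    to have monotonicity.\<close>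
  have "\<exists>C. \<forall>q\<in>bounded_part. 0 < laplacian S f q \<and> 1 \<le> C * laplacian S f q"
  proof (rule compact_uniform[OF bounded_part_closed])
    fix p assume p: "p \<in> bounded_part"
    let ?l = "laplacian S f p"
    have l: "0 < ?l" using f p by blast
    show "\<exists>N. openin X N \<and> p \<in> N \<and> (\<exists>C. \<forall>q\<in>N \<inter> bounded_part. 0 < laplacian S f q \<and> 1 \<le> C * laplacian
        S f q)"
    proof (intro exI conjI ballI)
      show "openin X {q \<in> M. ?l / 2 < laplacian S f q}" using f(1) by (intro
          openin_laplacian_greater) (simp add: subharmonic_def)
      show "p \<in> {q \<in> M. ?l / 2 < laplacian S f q}" using p l by (auto simp: bounded_part_def)
      fix q assume q: "q \<in> {q \<in> M. ?l / 2 < laplacian S f q} \<inter> bounded_part"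
      then show "0 < laplacian S f q" using l by auto
      show "1 \<le> (2 / ?l) * laplacian S f q" using q l by (simp add: field_simps)
    qed
  next
    fix C C' :: real and q assume le: "C \<le> C'" and *: "0 < laplacian S f q \<and> 1 \<le> C * laplacian S f
        q"
    then show "0 < laplacian S f q \<and> 1 \<le> C' * laplacian S f q"
      using mult_right_mono[OF le less_imp_le[OF conjunct1[OF *]]] by linarith
  qed
  then obtain C where C: "\<And>q. q \<in> bounded_part \<Longrightarrow> 1 \<le> C * laplacian S f q" by blast
  have "1 / (\<bar>C\<bar> + 1) \<le> laplacian S f q" if "q \<in> bounded_part" for q
  proof -
    have "1 \<le> (\<bar>C\<bar> + 1) * laplacian S f q"
      using C[OF that] f(2)[OF that] mult_right_mono[of C "\<bar>C\<bar> + 1" "laplacian S f q"] by linarith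
    then show ?thesis by (simp add: pos_divide_le_eq mult.commute)
  qed
  moreover have "0 < 1 / (\<bar>C\<bar> + 1)" by simp
  ultimately show ?thesis using that f(1) by blast
qed

end

section \<open>A lower bound for the solution, uniform in time\<close>

context flow
begin

text \<open>At a minimum of \<open>u - A * f\<close> where \<open>u\<close> is below
  \<open>d\<close>, the Laplacian of \<open>u\<close> minus the curvature is at least 1 and
  \<open>exp (- 2 * u)\<close> exceeds 1, so \<open>u\<close> would be strictly increasing in time;
  but a minimum over earlier times forbids that.\<close>

lemma u_lower_bound:
  assumes t0: "T3 < t0" "\<forall>t\<ge>t0. 0 \<le> deriv \<psi> t"
  shows "\<exists>m. \<forall>p\<in>bounded_part. \<forall>t\<ge>t0. m \<le> u p t"
proof -
  have t00: "0 < t0" using t0 T3 by simp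
  obtain f \<theta> where f: "subharmonic f" and \<theta>: "0 < \<theta>" "\<And>p. p \<in> bounded_part \<Longrightarrow> \<theta> \<le> laplacian S f p"
    using strictly_subharmonic by blast
  have fC: "C2 f" using f by (simp add: subharmonic_def)
  have Gne: "bounded_part \<noteq> {}" using bdry_nonempty bdry_bounded_part by blast
  note G = bounded_part_closed bounded_part_open Gne
  have cf: "continuous_on (chart_img c \<times> {a..b}) (\<lambda>(x, t). k * f (chart_inv c x))" if "c \<in> \<A>" for c
      k and a b :: real
  proof -
    have "continuous_on (chart_img c) (\<lambda>x. f (chart_inv c x))"
      using fC that Ck_on_imp_continuous by (force simp: C2_def o_def)
    then have "continuous_on (chart_img c \<times> {a..b}) (\<lambda>z. f (chart_inv c (fst z)))"
      by (rule continuous_on_compose2) (auto intro!: continuous_intros)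
    then show ?thesis by (simp add: case_prod_unfold continuous_on_mult_left)
  qed
  obtain B where B: "\<And>p. p \<in> bounded_part \<Longrightarrow> f p \<le> B"
    using attains_min[where a = 0 and b = 0 and f = "\<lambda>p t. - 1 * f p", OF G order_refl cf] by force
  obtain B' where B': "\<And>p. p \<in> bounded_part \<Longrightarrow> B' \<le> f p"
    using attains_min[where a = 0 and b = 0 and f = "\<lambda>p t. 1 * f p", OF G order_refl cf] by force
  obtain m where m: "\<And>p. p \<in> bounded_part \<Longrightarrow> m \<le> u p t0"
    using attains_min[where a = t0 and b = t0 and f = u, OF G order_refl continuous_u[OF _
        less_imp_le[OF t00]]] by force
  obtain C where C: "\<And>p. p \<in> inter S \<Longrightarrow> \<bar>K p\<bar> \<le> C" using curvature_bounded inter_in_M by blast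
  \<comment> \<open>The Laplacian of \<open>A * f\<close> exceeds the curvature bound by at least
    1.\<close>
  define A where "A = (\<bar>C\<bar> + 1) / \<theta>"
  have A: "0 \<le> A" "A * \<theta> = \<bar>C\<bar> + 1" using \<theta>(1) by (auto simp: A_def)
  \<comment> \<open>At most the initial values, the boundary values and -1, the last so that
    \<open>exp (- 2 * u)\<close> exceeds 1 below \<open>d\<close>; the shift \<open>k\<close> then
    keeps \<open>A * f + k\<close> from exceeding \<open>d\<close>.\<close>
  define d where "d = min (min (-1) m) (\<psi> t0)"
  define k where "k = d - A * B"
  have W: "A * f p + k \<le> d" if "p \<in> bounded_part" for p
    using mult_left_mono[OF B[OF that] A(1)] by (simp add: k_def)
  have key: "A * f p + k \<le> u p t" if p: "p \<in> bounded_part" and t: "t0 \<le> t" for p t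
  proof (rule ccontr)
    assume neg: "\<not> A * f p + k \<le> u p t"
    have cont: "continuous_on (chart_img c \<times> {t0..t}) (\<lambda>(x, s). u (chart_inv c x) s - A * f
        (chart_inv c x))" if "c \<in> \<A>" for c
      using continuous_on_diff[OF continuous_u[OF that less_imp_le[OF t00], of t] cf[OF that, of t0
          t A]]
      by (simp add: case_prod_unfold)
    obtain q s where q: "q \<in> bounded_part" "s \<in> {t0..t}"
      and min: "\<forall>q'\<in>bounded_part. \<forall>s'\<in>{t0..t}. u q s - A * f q \<le> u q' s' - A * f q'"
      using attains_min[where f = "\<lambda>p t. u p t - A * f p", OF G t cont] by blast
    have low: "u q s < A * f q + k" using min p t neg by force
    then have ud: "u q s < d" using W[OF q(1)] by linarith
    have s: "t0 < s" using m[OF q(1)] ud q(2) by (cases "s = t0") (auto simp: d_def)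
    have qM: "q \<in> M" using q(1) by (simp add: bounded_part_def)
    have "q \<notin> bdry S"
    proof
      assume "q \<in> bdry S"
      then have "u q s = \<psi> s" using u_bdry t0 s by simp
      moreover have "\<psi> t0 \<le> \<psi> s" using \<psi>_mono[OF t0] s by auto
      ultimately show False using ud by (simp add: d_def)
    qed
    then have qi: "q \<in> inter S" using qM by (simp add: inter_def)
    obtain c where c: "c \<in> \<A>" "q \<in> chart_dom c" using qM atlas_cover by blast
    have s0: "0 \<le> s" using s t00 by simp
    let ?x = "chart_map c q" and ?v = "\<lambda>x. u (chart_inv c x) s" and ?f = "f \<circ> chart_inv c"
    \<comment> \<open>Minimality is known on \<open>bounded_part\<close> only. That set is open, so
      its image in the chart is relatively open and the second-order condition applies
      there.\<close>
    define V where "V = chart_map c ` (bounded_part \<inter> chart_dom c)"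
    have V: "hp_open V" "V \<subseteq> chart_img c" "?x \<in> V"
      unfolding V_def using c q(1) by (auto intro!: openin_chart_image openin_Int bounded_part_open
          chart_dom_open)
    have "ut q s \<le> 0"
      by (rule derivative_nonpos_at_left_min[OF u_has_derivative[OF qM] s]) (use min q s t00 in
          force)+
    have fc: "Ck_on 2 (chart_img c) ?f" using fC c by (auto simp: C2_def)
    have v2: "Ck_on 2 V ?v" "Ck_on 2 V ?f"
      using Ck_on_subset[OF V(1) chart_img_open[OF c(1)] V(2)] Ck_on_u[OF c(1) s0] fc by auto
    have "0 \<le> ell c V (\<lambda>x. 1 * ?v x + (- A) * ?f x) ?x"
    proof (rule chart_min[OF c V(1,2,3) qi _ zero_less_one])
      show "Ck_on 2 V (\<lambda>x. 1 * ?v x + (- A) * ?f x)" by (intro Ck_on_add Ck_on_cmult V v2)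
      fix y assume "y \<in> V"
      then have "chart_inv c y \<in> bounded_part" using c(1) by (auto simp: V_def)
      then show "1 * ?v ?x + - A * ?f ?x \<le> 1 * ?v y + - A * ?f y" using min q(2) c by auto
    qed
    then have "A * ell c (chart_img c) ?f ?x \<le> ell c (chart_img c) ?v ?x"
      unfolding ell_linear[OF V(1,3) v2] ell_subset[OF V(1) chart_img_open[OF c(1)] V(2,3)] by simp
    moreover have "A * \<theta> \<le> A * ell c (chart_img c) ?f ?x"
      using \<theta>(2)[OF q(1)] A(1) unfolding laplacian_ell[OF fC c] by (intro mult_left_mono)
    ultimately have "1 \<le> ell c (chart_img c) ?v ?x - K q" using A(2) C[OF qi] by linarith
    then have "exp (- 2 * u q s) * 1 \<le> exp (- 2 * u q s) * (ell c (chart_img c) ?v ?x - K q)" by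
        (intro mult_left_mono) auto
    moreover have "1 < exp (- 2 * u q s)" using ud by (simp add: d_def)
    moreover have "ut q s = exp (- 2 * u q s) * (ell c (chart_img c) ?v ?x - K q) - 1" by (rule
        flow_equation[OF qi s0 c])
    ultimately show False using \<open>ut q s \<le> 0\<close> by linarith
  qed
  show ?thesis
  proof (intro exI[of _ "A * B' + k"] ballI allI impI)
    fix p t assume "p \<in> bounded_part" "t0 \<le> t"
    then show "A * B' + k \<le> u p t" using key[of p t] mult_left_mono[OF B' A(1), of p] by linarith
  qed
qed

end

section \<open>Boundary barriers\<close>

text \<open>For constant coefficients the functions \<open>-ln (l + \<sigma> Q / \<delta>)\<close> are hyperbolic metrics
  of discs and of complements of discs tangent to the boundary line, which gives the exact identity
  that starts the proof.\<close>

lemma barrier_estimate: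
  fixes A11 A12 A22 :: real
  assumes inv: "A11 * g11 + A12 * g12 = 1" "A11 * g12 + A12 * g22 = 0" "A12 * g11 + A22 * g12 = 0"
      "A12 * g12 + A22 * g22 = 1"
    and m: "m * m * A22 = 1" "0 \<le> m" "m \<le> \<Gamma>" and \<sigma>: "\<sigma> * \<sigma> = 1"
    and a: "\<bar>a11 - A11\<bar> \<le> \<omega>" "\<bar>a12 - A12\<bar> \<le> \<omega>" "\<bar>a22 - A22\<bar> \<le> \<omega>"
      "\<bar>a11\<bar> \<le> \<Gamma>" "\<bar>a12\<bar> \<le> \<Gamma>" "\<bar>a22\<bar> \<le> \<Gamma>"
    and b: "\<bar>b1\<bar> \<le> \<Gamma>" "\<bar>b2\<bar> \<le> \<Gamma>" and g: "\<bar>g11\<bar> \<le> \<Gamma>" "\<bar>g12\<bar> \<le> \<Gamma>" "\<bar>g22\<bar> \<le> \<Gamma>"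
    and k: "0 \<le> k" "k \<le> 2" and vw: "\<bar>v\<bar> \<le> R" "\<bar>w\<bar> \<le> R" and \<delta>: "0 < \<delta>" "\<delta> \<le> 1" and e: "0 \<le> e"
  defines "P1 \<equiv> k * \<sigma> * (2 * g11 * v + 2 * g12 * w)" and "P2 \<equiv> k * (m + \<sigma> * (2 * g12 * v + 2 * g22 *
      w))"
    and "H \<equiv> k * (m * w + \<sigma> * (g11 * v * v + 2 * g12 * v * w + g22 * w * w))"
    and "Pm \<equiv> 2 * \<Gamma> * (1 + 4 * R)" and "Hm \<equiv> 2 * (\<Gamma> * R + 4 * \<Gamma> * R * R)"
  shows "\<bar>a11 * P1 * P1 + 2 * a12 * P1 * P2 + a22 * P2 * P2
     - (e + \<delta> * H) * ((2 * k * \<sigma> / \<delta>) * (a11 * g11 + 2 * a12 * g12 + a22 * g22) + b1 * P1 + b2 * P2)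
         - k * k\<bar>
     \<le> (4 * Pm * Pm + 16 * \<Gamma> * Hm + 16 * \<Gamma> * \<Gamma> + 2 * \<Gamma> * Pm * (1 + Hm)) * (\<omega> + e / \<delta> + \<delta>)" (is "\<bar>?L\<bar>
         \<le> _")
    and "\<bar>H\<bar> \<le> Hm"
proof -
  have pos: "0 \<le> \<Gamma>" "0 \<le> R" "0 \<le> \<omega>" using m vw a by linarith+
  then have pm: "0 \<le> Pm" "0 \<le> Hm" by (simp_all add: Pm_def Hm_def)
  have gz: "\<bar>2 * gi * v + 2 * gj * w\<bar> \<le> 4 * \<Gamma> * R" if "\<bar>gi\<bar> \<le> \<Gamma>" "\<bar>gj\<bar> \<le> \<Gamma>" for gi gj
  proof -
    have "\<bar>gi * v\<bar> \<le> \<Gamma> * R" "\<bar>gj * w\<bar> \<le> \<Gamma> * R" using that vw pos by (auto simp: abs_mult intro!: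
        mult_mono)
    then show ?thesis by (simp add: abs_le_iff)
  qed
  have \<sigma>1: "\<bar>\<sigma>\<bar> = 1" using \<sigma> by (metis abs_mult abs_one abs_mult_self_eq power2_eq_square
      power2_eq_1_iff abs_minus_cancel)
  have P1: "\<bar>P1\<bar> \<le> Pm"
  proof -
    have "\<bar>P1\<bar> = k * \<bar>2 * g11 * v + 2 * g12 * w\<bar>" using k \<sigma>1 by (simp add: P1_def abs_mult)
    also have "\<dots> \<le> 2 * (4 * \<Gamma> * R)" using k gz[OF g(1,2)] by (intro mult_mono) auto
    also have "\<dots> \<le> Pm" using pos by (simp add: Pm_def algebra_simps)
    finally show ?thesis .
  qed
  have P2: "\<bar>P2\<bar> \<le> Pm"
  proof -
    have "\<bar>m + \<sigma> * (2 * g12 * v + 2 * g22 * w)\<bar> \<le> \<bar>m\<bar> + \<bar>\<sigma> * (2 * g12 * v + 2 * g22 * w)\<bar>" by (rule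
        abs_triangle_ineq)
    also have "\<dots> \<le> \<Gamma> + 4 * \<Gamma> * R" using m gz[OF g(2,3)] \<sigma>1 by (simp add: abs_mult)
    finally have "\<bar>P2\<bar> \<le> 2 * (\<Gamma> + 4 * \<Gamma> * R)" unfolding P2_def abs_mult using k by (intro mult_mono)
        auto
    then show ?thesis by (simp add: Pm_def algebra_simps)
  qed
  show H: "\<bar>H\<bar> \<le> Hm"
  proof -
    have q1: "\<bar>gi * s * t\<bar> \<le> \<Gamma> * R * R" if "\<bar>gi\<bar> \<le> \<Gamma>" "\<bar>s\<bar> \<le> R" "\<bar>t\<bar> \<le> R" for gi s t
      using that pos by (auto simp: abs_mult intro!: mult_mono)
    have "\<bar>g11 * v * v + 2 * g12 * v * w + g22 * w * w\<bar> \<le> 4 * \<Gamma> * R * R"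
      using q1[OF g(1) vw(1) vw(1)] q1[OF g(2) vw] q1[OF g(3) vw(2) vw(2)] by (simp add: abs_le_iff)
    moreover have "\<bar>m * w\<bar> \<le> \<Gamma> * R" using m vw pos by (auto simp: abs_mult intro!: mult_mono)
    moreover have "\<bar>m * w + \<sigma> * (g11 * v * v + 2 * g12 * v * w + g22 * w * w)\<bar> \<le> \<bar>m * w\<bar> + \<bar>g11 * v
        * v + 2 * g12 * v * w + g22 * w * w\<bar>"
      using abs_triangle_ineq[of "m * w" "\<sigma> * (g11 * v * v + 2 * g12 * v * w + g22 * w * w)"] \<sigma>1 by
          (simp add: abs_mult)
    ultimately have "\<bar>m * w + \<sigma> * (g11 * v * v + 2 * g12 * v * w + g22 * w * w)\<bar> \<le> \<Gamma> * R + 4 * \<Gamma> * R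
        * R" by linarith
    then have "\<bar>H\<bar> \<le> 2 * (\<Gamma> * R + 4 * \<Gamma> * R * R)" unfolding H_def abs_mult using k by (intro
        mult_mono) auto
    then show ?thesis by (simp add: Hm_def)
  qed
  \<comment> \<open>The matrices \<open>A\<close> and \<open>g\<close> are inverse to each other, so
    the trace of their product is 2 and \<open>A\<close> maps the gradient \<open>(z1, z2)\<close>
    of the quadratic form to \<open>2 * (v, w)\<close>. With \<open>m * m * A22 = 1\<close> and
    \<open>\<sigma> * \<sigma> = 1\<close> everything except \<open>k * k\<close> cancels.\<close>
  have id: "A11 * P1 * P1 + 2 * A12 * P1 * P2 + A22 * P2 * P2
      - H * (2 * k * \<sigma>) * (A11 * g11 + 2 * A12 * g12 + A22 * g22) = k * k"
  proof -
    have t: "A11 * g11 + 2 * A12 * g12 + A22 * g22 = 2" using inv by linarith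
    define z1 z2 where "z1 = 2 * g11 * v + 2 * g12 * w" and "z2 = 2 * g12 * v + 2 * g22 * w"
    have "A11 * z1 + A12 * z2 = 2 * v * (A11 * g11 + A12 * g12) + 2 * w * (A11 * g12 + A12 * g22)"
      by (simp add: z1_def z2_def algebra_simps)
    then have z1: "A11 * z1 + A12 * z2 = 2 * v" by (simp only: inv)
    have "A12 * z1 + A22 * z2 = 2 * v * (A12 * g11 + A22 * g12) + 2 * w * (A12 * g12 + A22 * g22)"
      by (simp add: z1_def z2_def algebra_simps)
    then have z2: "A12 * z1 + A22 * z2 = 2 * w" by (simp only: inv)
    have "A11 * P1 * P1 + 2 * A12 * P1 * P2 + A22 * P2 * P2
        = k * k * (m * m * A22 + 2 * \<sigma> * m * (A12 * z1 + A22 * z2) + (\<sigma> * \<sigma>) * (z1 * (A11 * z1 + A12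
            * z2) + z2 * (A12 * z1 + A22 * z2)))"
      unfolding P1_def P2_def z1_def[symmetric] z2_def[symmetric] by (simp add: algebra_simps)
    also have "\<dots> = k * k * (1 + 4 * \<sigma> * m * w + 2 * (z1 * v + z2 * w))" unfolding z1 z2 m(1) \<sigma> by
        (simp add: algebra_simps)
    finally have f: "A11 * P1 * P1 + 2 * A12 * P1 * P2 + A22 * P2 * P2 = k * k * (1 + 4 * \<sigma> * m * w
        + 2 * (z1 * v + z2 * w))" .
    have "H * (2 * k * \<sigma>) * 2 = k * k * (4 * \<sigma> * m * w + 4 * (\<sigma> * \<sigma>) * (g11 * v * v + 2 * g12 * v *
        w + g22 * w * w))"
      by (simp add: H_def algebra_simps)
    then show ?thesis unfolding f t \<sigma> by (simp add: z1_def z2_def algebra_simps)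
  qed
  define T1 where "T1 = (a11 - A11) * (P1 * P1) + 2 * ((a12 - A12) * (P1 * P2)) + (a22 - A22) * (P2
      * P2)"
  define G1 where "G1 = (a11 - A11) * g11 + 2 * ((a12 - A12) * g12) + (a22 - A22) * g22"
  define G2 where "G2 = a11 * g11 + 2 * (a12 * g12) + a22 * g22"
  define bP where "bP = b1 * P1 + b2 * P2"
  \<comment> \<open>Subtracting the exact identity leaves the freezing errors \<open>T1\<close> and
    \<open>G1\<close>, both proportional to \<open>\<omega>\<close>, the effect \<open>G2\<close> of
    the shift \<open>e\<close>, and the first-order coefficients in \<open>bP\<close>, which come
    with the small factor \<open>e + \<delta> * H\<close>.\<close>
  have L: "?L = T1 - H * (2 * k * \<sigma>) * G1 - (e / \<delta>) * (2 * k * \<sigma>) * G2 - (e + \<delta> * H) * bP"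
    using id \<delta> by (simp add: T1_def G1_def G2_def bP_def field_simps)
  have prod: "\<bar>x * y\<bar> \<le> X * Y" if "\<bar>x\<bar> \<le> X" "\<bar>y\<bar> \<le> Y" for x y X Y :: real
    unfolding abs_mult using that by (intro mult_mono) auto
  have T1: "\<bar>T1\<bar> \<le> 4 * \<omega> * (Pm * Pm)"
    using prod[OF a(1) prod[OF P1 P1]] prod[OF a(2) prod[OF P1 P2]] prod[OF a(3) prod[OF P2 P2]]
    unfolding T1_def by (simp add: abs_le_iff)
  have G1: "\<bar>G1\<bar> \<le> 4 * \<omega> * \<Gamma>"
    using prod[OF a(1) g(1)] prod[OF a(2) g(2)] prod[OF a(3) g(3)] unfolding G1_def by (simp add:
        abs_le_iff)
  have G2: "\<bar>G2\<bar> \<le> 4 * \<Gamma> * \<Gamma>"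
    using prod[OF a(4) g(1)] prod[OF a(5) g(2)] prod[OF a(6) g(3)] unfolding G2_def by (simp add:
        abs_le_iff)
  have bP: "\<bar>bP\<bar> \<le> 2 * \<Gamma> * Pm" using prod[OF b(1) P1] prod[OF b(2) P2] unfolding bP_def by (simp
      add: abs_le_iff)
  have k\<sigma>: "\<bar>2 * k * \<sigma>\<bar> \<le> 4" using k \<sigma>1 by (simp add: abs_mult)
  have e\<delta>: "0 \<le> e / \<delta>" "e \<le> e / \<delta>" using e \<delta> mult_left_le_one_le[of e \<delta>] by (auto simp:
      pos_le_divide_eq mult.commute)
  have "\<bar>H * (2 * k * \<sigma>) * G1\<bar> \<le> (Hm * 4) * (4 * \<omega> * \<Gamma>)" by (rule prod[OF prod[OF H k\<sigma>] G1])
  moreover have "\<bar>(e / \<delta>) * (2 * k * \<sigma>) * G2\<bar> \<le> ((e / \<delta>) * 4) * (4 * \<Gamma> * \<Gamma>)" by (rule prod[OF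
      prod[OF _ k\<sigma>] G2]) (use e\<delta> in simp)
  moreover have "\<bar>(e + \<delta> * H) * bP\<bar> \<le> (e / \<delta> + \<delta> * Hm) * (2 * \<Gamma> * Pm)"
  proof (rule prod[OF _ bP])
    have "\<bar>\<delta> * H\<bar> \<le> \<delta> * Hm" by (rule prod[OF _ H]) (use \<delta> in simp)
    then show "\<bar>e + \<delta> * H\<bar> \<le> e / \<delta> + \<delta> * Hm" using e e\<delta> by linarith
  qed
  ultimately have "\<bar>?L\<bar> \<le> 4 * \<omega> * (Pm * Pm) + (Hm * 4) * (4 * \<omega> * \<Gamma>) + ((e / \<delta>) * 4) * (4 * \<Gamma> * \<Gamma>) +
      (e / \<delta> + \<delta> * Hm) * (2 * \<Gamma> * Pm)"
    unfolding L using T1 by linarith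
  also have "\<dots> \<le> (4 * Pm * Pm + 16 * \<Gamma> * Hm + 16 * \<Gamma> * \<Gamma> + 2 * \<Gamma> * Pm * (1 + Hm)) * (\<omega> + e / \<delta> + \<delta>)"
  proof -
    \<comment> \<open>These are exactly the terms by which the product on the right exceeds the
      estimate collected so far.\<close>
    have nn: "0 \<le> \<omega> * (16 * \<Gamma> * \<Gamma> + 2 * \<Gamma> * Pm * (1 + Hm))" "0 \<le> (e / \<delta>) * (4 * Pm * Pm + 16 * \<Gamma> *
        Hm + 2 * \<Gamma> * Pm * Hm)"
       "0 \<le> \<delta> * (4 * Pm * Pm + 16 * \<Gamma> * Hm + 16 * \<Gamma> * \<Gamma> + 2 * \<Gamma> * Pm)" 
      by (intro mult_nonneg_nonneg add_nonneg_nonneg pos pm e\<delta>(1) zero_le_numeral less_imp_le[OF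
          \<delta>(1)] zero_le_one)+
    define e' where "e' = e / \<delta>"
    show ?thesis using nn unfolding e'_def[symmetric] by (simp add: algebra_simps)
  qed
  finally show "\<bar>?L\<bar> \<le> (4 * Pm * Pm + 16 * \<Gamma> * Hm + 16 * \<Gamma> * \<Gamma> + 2 * \<Gamma> * Pm * (1 + Hm)) * (\<omega> + e / \<delta>
      + \<delta>)" .
qed

section \<open>The comparison principle and the slope at the contact point\<close>

context flow
begin

text \<open>\<open>\<sigma> = 1\<close> is the lower and \<open>\<sigma> = -1\<close> the upper
  barrier; both comparisons then read \<open>0 \<le> \<sigma> * (u - barrier)\<close> and share one
  proof.\<close>

definition barrier :: "real \<Rightarrow> real \<Rightarrow> (real^2 \<Rightarrow> real) \<Rightarrow> (real^2 \<Rightarrow> real) \<Rightarrow> real^2 \<Rightarrow> real \<Rightarrow> real" where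
  "barrier \<sigma> B h F x t = - ln (exp (- \<psi> t) + h x) + \<sigma> * B * F x"

text \<open>With \<open>s = exp (- \<psi> t) + h\<close>, the Laplacian of \<open>- ln s\<close> is
  the quotient of \<open>gradsq h - s * ell h\<close> by \<open>s * s\<close>, and its numerator is
  what the estimates on \<open>h\<close> control. Since \<open>\<sigma> * \<sigma> = 1\<close>, the
  corrector enters with the same sign for both barriers.\<close>

lemma Ck_on_barrier_diff:
  assumes c: "c \<in> \<A>" and W: "hp_open W" "W \<subseteq> chart_img c" and t: "0 \<le> t"
    and h: "Ck_on 2 W h" "\<forall>x\<in>W. 0 < exp (- \<psi> t) + h x" and F: "Ck_on 2 W F" and \<sigma>: "\<sigma> * \<sigma> = 1"
  shows "Ck_on 2 W (\<lambda>x. \<sigma> * (u (chart_inv c x) t - barrier \<sigma> B h F x t))"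
    and "x \<in> W \<Longrightarrow> ell c W (\<lambda>x. \<sigma> * (u (chart_inv c x) t - barrier \<sigma> B h F x t)) x =
      \<sigma> * ell c W (\<lambda>x. u (chart_inv c x) t) x - B * ell c W F x
      - \<sigma> * (gradsq c W h x - (exp (- \<psi> t) + h x) * ell c W h x) / (exp (- \<psi> t) + h x)\<^sup>2"
    and "x \<in> W \<Longrightarrow> pdi W 2 (\<lambda>x. \<sigma> * (u (chart_inv c x) t - barrier \<sigma> B h F x t)) x =
      \<sigma> * pdi W 2 (\<lambda>x. u (chart_inv c x) t) x - B * pdi W 2 F x + \<sigma> * pdi W 2 h x / (exp (- \<psi> t) + h
          x)"
proof -
  define e where "e = exp (- \<psi> t)"
  let ?v = "\<lambda>x. u (chart_inv c x) t"
  have v: "Ck_on 2 W ?v" by (rule Ck_on_subset[OF W(1) chart_img_open[OF c] W(2) Ck_on_u[OF c t]])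
  have d1: "((\<lambda>s. ln (e + s)) has_real_derivative inverse (e + h y)) (at (h y))"
    and d2: "((\<lambda>s. inverse (e + s)) has_real_derivative - (inverse (e + h y) * inverse (e + h y)))
        (at (h y))" if "y \<in> W" for y
    using bspec[OF h(2) that] by (auto intro!: derivative_eq_intros simp: e_def inverse_eq_divide)
  have cont: "continuous_on W (\<lambda>y. - (inverse (e + h y) * inverse (e + h y)))"
    by (intro continuous_intros Ck_on_imp_continuous[OF h(1)]) (auto simp: e_def dest: bspec[OF
        h(2)])
  note L = ell_compose[where \<phi> = "\<lambda>s. ln (e + s)" and \<phi>' = "\<lambda>s. inverse (e + s)"
      and \<phi>'' = "\<lambda>s. - (inverse (e + s) * inverse (e + s))"]
  have L1: "ell c W (\<lambda>y. ln (e + h y)) x = inverse (e + h x) * ell c W h x + - (inverse (e + h x) *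
      inverse (e + h x)) * gradsq c W h x" if x: "x \<in> W" for x
    by (rule L(1)[OF W(1) x h(1) d1 d2 cont])
  have L2: "Ck_on 2 W (\<lambda>y. ln (e + h y))" if x: "x \<in> W" for x
    by (rule L(2)[OF W(1) x h(1) d1 d2 cont])
  have eq: "(\<lambda>x. \<sigma> * (?v x - barrier \<sigma> B h F x t)) = (\<lambda>x. 1 * (\<sigma> * ?v x + \<sigma> * ln (e + h x)) + (- B)
      * F x)"
  proof
    fix x
    have "\<sigma> * (\<sigma> * B * F x) = B * F x" using \<sigma> by (metis mult.assoc mult_1)
    then show "\<sigma> * (?v x - barrier \<sigma> B h F x t) = 1 * (\<sigma> * ?v x + \<sigma> * ln (e + h x)) + (- B) * F x"
      unfolding barrier_def e_def by (simp add: algebra_simps)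
  qed
  have ln2: "Ck_on 2 W (\<lambda>x. ln (e + h x))"
  proof (cases "W = {}")
    case True then show ?thesis unfolding Ck_on_2 by (simp add: Ck_on.simps(2))
  next
    case False then show ?thesis using L2 by blast
  qed
  have sum2: "Ck_on 2 W (\<lambda>x. \<sigma> * ?v x + \<sigma> * ln (e + h x))" by (intro Ck_on_add Ck_on_cmult W v ln2)
  show "Ck_on 2 W (\<lambda>x. \<sigma> * (?v x - barrier \<sigma> B h F x t))"
    unfolding eq by (intro Ck_on_add Ck_on_cmult W sum2 F)
  assume x: "x \<in> W"
  define s where "s = e + h x"
  have s: "0 < s" using bspec[OF h(2) x] by (simp add: s_def e_def)
  have aux: "inverse s * E + - (inverse s * inverse s) * G = - ((G - s * E) / s\<^sup>2)" for E G :: real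
    using s by (simp add: field_simps power2_eq_square)
  have lnell: "ell c W (\<lambda>x. ln (e + h x)) x = - ((gradsq c W h x - s * ell c W h x) / s\<^sup>2)"
    unfolding L1[OF x] s_def[symmetric] by (rule aux)
  show "ell c W (\<lambda>x. \<sigma> * (?v x - barrier \<sigma> B h F x t)) x =
      \<sigma> * ell c W ?v x - B * ell c W F x - \<sigma> * (gradsq c W h x - (exp (- \<psi> t) + h x) * ell c W h x)
          / (exp (- \<psi> t) + h x)\<^sup>2"
    unfolding eq ell_linear[OF W(1) x sum2 F] ell_linear[OF W(1) x v ln2] lnell s_def
        e_def[symmetric] by simp
  have h2: "Ck_on (Suc (Suc 0)) W h" using h(1) by (simp add: Ck_on_2)
  have lnpd: "pdi W 2 (\<lambda>x. ln (e + h x)) x = pdi W 2 h x / s"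
    using pdi_real_compose[OF W(1) x h2 d1[OF x]] by (simp add: s_def divide_inverse mult.commute)
  show "pdi W 2 (\<lambda>x. \<sigma> * (?v x - barrier \<sigma> B h F x t)) x =
      \<sigma> * pdi W 2 ?v x - B * pdi W 2 F x + \<sigma> * pdi W 2 h x / (exp (- \<psi> t) + h x)"
    unfolding eq pdi_pdi_linear(2)[OF W(1) x sum2 F] pdi_pdi_linear(2)[OF W(1) x v ln2] lnpd s_def
        e_def[symmetric] by simp
qed

text \<open>At a negative minimum of the signed difference, \<open>F \<le> 0\<close> yields a
  comparison of \<open>u\<close> with \<open>- ln s\<close>, hence of \<open>exp (- 2 * u)\<close>
  with \<open>s * s\<close>, while the second-order condition compares the Laplacians. Together with
  the flow equation this contradicts the sign of the time derivative. The initial and lateral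
  hypotheses keep the minimum off the parabolic boundary.\<close>

lemma barrier_comparison:
  assumes c: "c \<in> \<A>" and \<sigma>: "\<sigma> = 1 \<or> \<sigma> = -1" and t0: "T3 < t0" and \<rho>: "0 < \<rho>"
    and D: "cball y \<rho> \<inter> half_plane \<subseteq> chart_img c"
    and h: "\<And>W. hp_open W \<Longrightarrow> Ck_on 2 W h" "continuous_on UNIV h"
    and F: "\<And>W. hp_open W \<Longrightarrow> Ck_on 2 W F" "continuous_on UNIV F" and B: "0 \<le> B"
    and \<psi>': "\<And>t. t0 \<le> t \<Longrightarrow> 0 \<le> deriv \<psi> t \<and> deriv \<psi> t < \<eta>"
    and C: "\<And>p. p \<in> inter S \<Longrightarrow> \<bar>K p\<bar> \<le> C"
    and Fle: "\<And>x. x \<in> cball y \<rho> \<inter> half_plane \<Longrightarrow> F x \<le> 0 \<and> 0 \<le> ell c (chart_img c) F x"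
    and E: "\<And>x t s. x \<in> cball y \<rho> \<inter> half_plane \<Longrightarrow> t0 \<le> t \<Longrightarrow> 0 < h x \<Longrightarrow> s = exp (- \<psi> t) + h x \<Longrightarrow>
       (\<sigma> = 1 \<longrightarrow> 1 + \<eta> \<le> gradsq c (chart_img c) h x - s * ell c (chart_img c) h x - s\<^sup>2 * C) \<and>
       (\<sigma> = -1 \<longrightarrow> gradsq c (chart_img c) h x - s * ell c (chart_img c) h x + s\<^sup>2 * C < 1)"
    and initial: "\<And>x. x \<in> cball y \<rho> \<inter> half_plane \<Longrightarrow> 0 \<le> h x \<Longrightarrow> 0 \<le> \<sigma> * (u (chart_inv c x) t0 - barrier
        \<sigma> B h F x t0)"
    and lateral: "\<And>x t. x \<in> cball y \<rho> \<inter> half_plane \<Longrightarrow> 0 \<le> h x \<Longrightarrow> t0 \<le> t \<Longrightarrow> dist x y = \<rho> \<or> h x = 0 \<or> x $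
        2 = 0 \<Longrightarrow>
       0 \<le> \<sigma> * (u (chart_inv c x) t - barrier \<sigma> B h F x t)"
    and x1: "x1 \<in> cball y \<rho> \<inter> half_plane" "0 \<le> h x1" and t1: "t0 \<le> t1"
  shows "0 \<le> \<sigma> * (u (chart_inv c x1) t1 - barrier \<sigma> B h F x1 t1)"
proof (rule ccontr)
  assume neg: "\<not> 0 \<le> \<sigma> * (u (chart_inv c x1) t1 - barrier \<sigma> B h F x1 t1)"
  have \<sigma>2: "\<sigma> * \<sigma> = 1" using \<sigma> by auto
  have t00: "0 < t0" using t0 T3 by simp
  define f where "f = (\<lambda>x t. \<sigma> * (u (chart_inv c x) t - barrier \<sigma> B h F x t))"
  \<comment> \<open>For the upper barrier \<open>h\<close> changes sign. On the part with
    \<open>h \<ge> 0\<close> the logarithm is defined at all times, and points with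
    \<open>h = 0\<close> count as lateral boundary.\<close>
  define Q where "Q = cball y \<rho> \<inter> half_plane \<inter> {x. 0 \<le> h x}"
  have Qc: "compact Q" unfolding Q_def
    by (intro compact_Int_closed compact_half_ball closed_Collect_le continuous_on_const h(2))
  have Qimg: "Q \<subseteq> chart_img c" using D by (auto simp: Q_def)
  have c\<psi>: "continuous_on {t0..t1} \<psi>"
    using t0 by (intro continuous_at_imp_continuous_on ballI DERIV_isCont[OF \<psi>_derivative(1)]) auto
  have cu: "continuous_on (Q \<times> {t0..t1}) (\<lambda>(x, t). u (chart_inv c x) t)"
    by (rule continuous_on_subset[OF continuous_u[OF c less_imp_le[OF t00]]]) (use Qimg in auto)
  have pos: "0 < exp (- \<psi> t) + h x" if "x \<in> Q" for x t
    using that by (auto simp: Q_def intro: add_pos_nonneg)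
  have "continuous_on (Q \<times> {t0..t1}) (\<lambda>z. \<sigma> * (u (chart_inv c (fst z)) (snd z) - (- ln (exp (- \<psi>
      (snd z)) + h (fst z)) + \<sigma> * B * F (fst z))))"
  proof (intro continuous_intros)
    show "continuous_on (Q \<times> {t0..t1}) (\<lambda>z. u (chart_inv c (fst z)) (snd z))" using cu by (simp add:
        case_prod_unfold)
    show "continuous_on (Q \<times> {t0..t1}) (\<lambda>z. \<psi> (snd z))"
      by (rule continuous_on_compose2[OF c\<psi>]) (auto intro!: continuous_intros)
    show "continuous_on (Q \<times> {t0..t1}) (\<lambda>z. h (fst z))"
      by (rule continuous_on_compose2[OF h(2)]) (auto intro!: continuous_intros)
    show "continuous_on (Q \<times> {t0..t1}) (\<lambda>z. F (fst z))"
      by (rule continuous_on_compose2[OF F(2)]) (auto intro!: continuous_intros)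
    show "\<forall>z\<in>Q \<times> {t0..t1}. exp (- \<psi> (snd z)) + h (fst z) \<noteq> 0"
    proof
      fix z assume "z \<in> Q \<times> {t0..t1}"
      then have "fst z \<in> Q" by auto
      then show "exp (- \<psi> (snd z)) + h (fst z) \<noteq> 0" using pos[of "fst z" "snd z"] by simp
    qed
  qed
  then have cf: "continuous_on (Q \<times> {t0..t1}) (\<lambda>z. f (fst z) (snd z))" by (simp add: f_def
      barrier_def)
  have "x1 \<in> Q" using x1 by (simp add: Q_def)
  then have ne: "Q \<times> {t0..t1} \<noteq> {}" using t1 by auto
  obtain z where z: "z \<in> Q \<times> {t0..t1}" "\<forall>z'\<in>Q \<times> {t0..t1}. f (fst z) (snd z) \<le> f (fst z') (snd z')"
    using continuous_attains_inf[OF compact_Times[OF Qc compact_Icc] ne cf] by blast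
  define x t where "x = fst z" and "t = snd z"
  have xt: "x \<in> Q" "t0 \<le> t" "t \<le> t1" using z(1) by (auto simp: x_def t_def)
  have min: "f x t \<le> f x' t'" if "x' \<in> Q" "t0 \<le> t'" "t' \<le> t1" for x' t'
  proof -
    have "(x', t') \<in> Q \<times> {t0..t1}" using that by auto
    from z(2)[rule_format, OF this] show ?thesis by (simp add: x_def t_def)
  qed
  have fneg: "f x t < 0" using min[OF \<open>x1 \<in> Q\<close> t1 order_refl] neg by (simp add: f_def)
  have xB: "x \<in> cball y \<rho> \<inter> half_plane" "0 \<le> h x" using xt(1) by (auto simp: Q_def)
  have tt: "t0 < t" using initial[OF xB] fneg xt(2) by (cases "t = t0") (auto simp: f_def)
  have tpos: "0 < t" using tt t00 by simp
  have "\<not> (dist x y = \<rho> \<or> h x = 0 \<or> x $ 2 = 0)"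
    using lateral[OF xB xt(2)] fneg by (fastforce simp: f_def)
  then have in_x: "dist x y < \<rho>" "0 < h x" "0 < x $ 2"
    using xB by (auto simp: half_plane_def dist_commute)
  define W where "W = {x \<in> ball y \<rho> \<inter> half_plane. 0 < h x}"
  have W: "hp_open W" unfolding W_def
    by (rule openin_continuous_preimage_greaterThan[OF openin_half_plane_ball
        continuous_on_subset[OF h(2)]]) simp
  have WQ: "W \<subseteq> Q" by (auto simp: W_def Q_def)
  have Wimg: "W \<subseteq> chart_img c" using WQ Qimg by blast
  have xW: "x \<in> W" using in_x xB by (auto simp: W_def dist_commute)
  have ximg: "x \<in> chart_img c" using xW Wimg by blast
  define p where "p = chart_inv c x"
  have p: "p \<in> chart_dom c" "chart_map c p = x" using ximg by (auto simp: p_def)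
  have pM: "p \<in> M" using p(1) chart_dom_subset[OF c] by blast
  have "p \<notin> bdry S" using boundary_chart[OF _ c p(1)] p(2) in_x(3) by auto
  then have pi: "p \<in> inter S" using pM by (simp add: inter_def)
  let ?v = "\<lambda>x. u (chart_inv c x) t"
  define s where "s = exp (- \<psi> t) + h x"
  have s: "0 < s" using in_x(2) by (simp add: s_def add_pos_pos)
  define e where "e = gradsq c (chart_img c) h x - s * ell c (chart_img c) h x"
  have W2: "Ck_on 2 W h" "\<forall>x\<in>W. 0 < exp (- \<psi> t) + h x" "Ck_on 2 W F" using h F W WQ pos by auto
  note bar = Ck_on_barrier_diff[OF c W Wimg less_imp_le[OF tpos] W2 \<sigma>2]
  have sub: "ell c W k x = ell c (chart_img c) k x" "pdi W i k x = pdi (chart_img c) i k x" for k i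
    using ell_subset[OF W chart_img_open[OF c] Wimg xW] pd_hp_open(2)[OF W chart_img_open[OF c] Wimg
        xW] by auto
  have gsub: "gradsq c W h x = gradsq c (chart_img c) h x" unfolding gradsq_def sub by simp
  have "0 \<le> ell c W (\<lambda>x. f x t) (chart_map c p)"
    unfolding f_def
  proof (rule chart_min[OF c p(1) W Wimg _ pi bar(1) zero_less_one])
    show "chart_map c p \<in> W" using xW p by simp
    fix x' assume "x' \<in> W"
    then show "\<sigma> * (u (chart_inv c (chart_map c p)) t - barrier \<sigma> B h F (chart_map c p) t) \<le> \<sigma> * (u
        (chart_inv c x') t - barrier \<sigma> B h F x' t)"
      using min[of x' t] WQ xt unfolding p f_def by auto
  qed
  from this[unfolded f_def p(2) bar(2)[OF xW]]
  have "0 \<le> \<sigma> * ell c (chart_img c) ?v x - B * ell c (chart_img c) F x - \<sigma> * e / s\<^sup>2"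
    unfolding sub gsub e_def s_def .
  moreover have "0 \<le> B * ell c (chart_img c) F x" using B Fle[OF xB(1)] by simp
  ultimately have ell: "\<sigma> * e / s\<^sup>2 \<le> \<sigma> * ell c (chart_img c) ?v x" by linarith
  have ds: "((\<lambda>t. \<sigma> * (u p t - barrier \<sigma> B h F x t)) has_real_derivative
      \<sigma> * (ut p t - deriv \<psi> t * exp (- \<psi> t) / s)) (at t)"
    unfolding barrier_def using s
    by (auto intro!: derivative_eq_intros u_has_derivative[OF pM tpos] \<psi>_derivative(1) simp: s_def)
        (use t0 tt in auto)
  have dle: "\<sigma> * (ut p t - deriv \<psi> t * exp (- \<psi> t) / s) \<le> 0"
    by (rule derivative_nonpos_at_left_min[OF ds tt]) (use min[OF xt(1)] xt(3) in \<open>auto simp: f_def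
        p_def\<close>)
  have \<psi>t: "0 \<le> deriv \<psi> t" "deriv \<psi> t < \<eta>" using \<psi>'[OF xt(2)] by auto
  \<comment> \<open>The time derivative of the barrier. The case of the lower barrier relies on its
    upper bound, that of the upper barrier on its sign.\<close>
  have frac: "0 \<le> deriv \<psi> t * exp (- \<psi> t) / s" "deriv \<psi> t * exp (- \<psi> t) / s < \<eta>"
  proof -
    show "0 \<le> deriv \<psi> t * exp (- \<psi> t) / s" using \<psi>t s by simp
    have "exp (- \<psi> t) / s \<le> 1" using s in_x(2) by (simp add: s_def)
    then have "deriv \<psi> t * (exp (- \<psi> t) / s) \<le> deriv \<psi> t" using \<psi>t(1) by (intro mult_left_le)
    then show "deriv \<psi> t * exp (- \<psi> t) / s < \<eta>" using \<psi>t by simp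
  qed
  have eqn: "ut p t = exp (- 2 * u p t) * (ell c (chart_img c) ?v x - K p) - 1"
    using flow_equation[OF pi less_imp_le[OF tpos] c p(1)] p(2) by simp
  have sexp: "s\<^sup>2 = exp (2 * ln s)" 
  proof -
    have "2 * ln s = ln s + ln s" by simp
    then show ?thesis by (simp only: exp_add exp_ln[OF s] power2_eq_square)
  qed
  have BF: "B * F x \<le> 0" using B Fle[OF xB(1)] by (simp add: mult_nonneg_nonpos)
  note Kp = C[OF pi]
  from \<sigma> show False
  proof
    assume 1: "\<sigma> = 1"
    have "u p t < - ln s" using fneg BF 1 by (simp add: f_def barrier_def p_def s_def)
    then have es: "s\<^sup>2 \<le> exp (- 2 * u p t)" unfolding sexp by simp
    have e1: "1 + \<eta> \<le> e - s\<^sup>2 * C" using E[OF xB(1) xt(2) in_x(2) s_def] 1 by (simp add: e_def)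
    have "e / s\<^sup>2 - C \<le> ell c (chart_img c) ?v x - K p" using ell 1 Kp by (simp add: abs_le_iff)
    moreover have "s\<^sup>2 * (e / s\<^sup>2 - C) = e - s\<^sup>2 * C" using s by (simp add: right_diff_distrib)
    ultimately have "1 + \<eta> \<le> s\<^sup>2 * (ell c (chart_img c) ?v x - K p)"
      using e1 mult_left_mono[of "e / s\<^sup>2 - C" "ell c (chart_img c) ?v x - K p" "s\<^sup>2"] by simp
    moreover have "0 \<le> \<eta>" using \<psi>t by simp
    ultimately have "0 < s\<^sup>2 * (ell c (chart_img c) ?v x - K p)" by linarith
    \<comment> \<open>Positivity has to come first: only for a positive factor may the square of
      \<open>s\<close> be replaced by the larger \<open>exp (- 2 * u)\<close>.\<close>
    then have "0 < ell c (chart_img c) ?v x - K p" by (rule zero_less_mult_pos) (use s in simp)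
    then have "s\<^sup>2 * (ell c (chart_img c) ?v x - K p) \<le> exp (- 2 * u p t) * (ell c (chart_img c) ?v
        x - K p)"
      using es by (intro mult_right_mono) auto
    then have "\<eta> \<le> ut p t" using eqn \<open>1 + \<eta> \<le> s\<^sup>2 * _\<close> by linarith
    then show False using dle 1 frac by simp
  next
    assume 1: "\<sigma> = -1"
    have "- ln s < u p t" using fneg BF 1 by (simp add: f_def barrier_def p_def s_def)
    then have es: "exp (- 2 * u p t) \<le> s\<^sup>2" unfolding sexp by simp
    have e1: "e + s\<^sup>2 * C < 1" using E[OF xB(1) xt(2) in_x(2) s_def] 1 by (simp add: e_def)
    \<comment> \<open>The barrier does not decrease in time, so neither does \<open>u\<close> at
      this point; positivity of the elliptic term then follows from the flow equation.\<close>
    have ut0: "0 \<le> ut p t" using dle 1 frac by simp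
    then have "1 \<le> exp (- 2 * u p t) * (ell c (chart_img c) ?v x - K p)" using eqn by simp
    then have "0 < exp (- 2 * u p t) * (ell c (chart_img c) ?v x - K p)" by linarith
    then have "0 < ell c (chart_img c) ?v x - K p" by (rule zero_less_mult_pos) simp
    then have "exp (- 2 * u p t) * (ell c (chart_img c) ?v x - K p) \<le> s\<^sup>2 * (ell c (chart_img c) ?v
        x - K p)"
      using es by (intro mult_right_mono) auto
    also have "\<dots> \<le> s\<^sup>2 * (e / s\<^sup>2 + C)" using ell 1 Kp by (intro mult_left_mono) (auto simp:
        abs_le_iff)
    also have "\<dots> = e + s\<^sup>2 * C" using s by (simp add: distrib_left)
    finally show False using e1 ut0 eqn by linarith
  qed
qed

text \<open>The signed difference vanishes at \<open>y\<close> and is non-negative just above it, so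
  its inward derivative is non-negative. As \<open>h\<close> vanishes at \<open>y\<close>, the
  logarithm contributes the slope of \<open>h\<close> divided by
  \<open>exp (- \<psi> t)\<close>.\<close>

lemma barrier_slope:
  assumes c: "c \<in> \<A>" and \<sigma>: "\<sigma> = 1 \<or> \<sigma> = -1" and t: "T3 < t" and \<rho>: "0 < \<rho>"
    and p: "p \<in> bdry S" "p \<in> chart_dom c" and y: "y = chart_map c p"
    and D: "cball y \<rho> \<inter> half_plane \<subseteq> chart_img c"
    and h: "\<And>W. hp_open W \<Longrightarrow> Ck_on 2 W h" "continuous_on UNIV h" "h y = 0" "0 < pdi (chart_img c) 2 h
        y"
    and F: "\<And>W. hp_open W \<Longrightarrow> Ck_on 2 W F" "F y = 0"
    and cmp: "\<And>x. x \<in> cball y \<rho> \<inter> half_plane \<Longrightarrow> 0 \<le> h x \<Longrightarrow> 0 \<le> \<sigma> * (u (chart_inv c x) t - barrier \<sigma> B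
        h F x t)"
  shows "0 \<le> \<sigma> * pdi (chart_img c) 2 (\<lambda>x. u (chart_inv c x) t) y - B * pdi (chart_img c) 2 F y + \<sigma> *
      pdi (chart_img c) 2 h y * exp (\<psi> t)"
proof -
  have \<sigma>2: "\<sigma> * \<sigma> = 1" using \<sigma> by auto
  have t0: "0 \<le> t" using t T3 by simp
  have yimg: "y \<in> chart_img c" using p y by simp
  note V = chart_img_open[OF c]
  \<comment> \<open>Near \<open>y\<close> the polynomial \<open>h\<close> may be negative; the
    logarithm still makes sense on this neighbourhood because \<open>exp (- \<psi> t)\<close> is
    positive.\<close>
  define W where "W = {x \<in> chart_img c. 0 < h x + exp (- \<psi> t)}"
  have W: "hp_open W" "W \<subseteq> chart_img c" "y \<in> W" unfolding W_def
    using yimg h(3) by (auto intro!: openin_continuous_preimage_greaterThan V continuous_intros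
        continuous_on_subset[OF h(2)])
  have W2: "Ck_on 2 W h" "\<forall>x\<in>W. 0 < exp (- \<psi> t) + h x" "Ck_on 2 W F" using h F W by (auto simp:
      W_def add.commute)
  note bar = Ck_on_barrier_diff[OF c W(1,2) t0 W2 \<sigma>2]
  have sub: "pdi W i k y = pdi (chart_img c) i k y" for k i using pd_hp_open(2)[OF W(1) V W(2,3)] .
  have y2: "y $ 2 = 0" using boundary_chart[OF p(1) c p(2)] y by simp
  have "((\<lambda>s. h (y + s *\<^sub>R axis 2 1)) has_real_derivative pdi (chart_img c) 2 h y) (at 0 within {s.
      y + s *\<^sub>R axis 2 1 \<in> chart_img c})"
    using Ck_on_line_derivative[OF V h(1)[OF V, unfolded Ck_on_2], of y 0 "axis 2 1"] yimg by simp
  \<comment> \<open>The comparison is available only where \<open>h \<ge> 0\<close>; the positive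
    slope of \<open>h\<close> puts an initial piece of the inward coordinate line into that
    set.\<close>
  from has_real_derivative_pos_inc_right[OF this h(4)]
  obtain d where d: "0 < d" "\<forall>s>0. 0 + s \<in> {s. y + s *\<^sub>R axis 2 1 \<in> chart_img c} \<longrightarrow> s < d \<longrightarrow>
      h (y + 0 *\<^sub>R axis 2 1) < h (y + (0 + s) *\<^sub>R axis 2 1)" by blast
  have "0 \<le> pdi W 2 (\<lambda>x. \<sigma> * (u (chart_inv c x) t - barrier \<sigma> B h F x t)) y"
  proof (rule pdi_normal_nonneg[OF W(1,3) bar(1)[unfolded Ck_on_2]])
    show "0 < min d \<rho>" using d \<rho> by simp
    fix s assume s: "0 < s" "s < min d \<rho>" "y + s *\<^sub>R axis 2 1 \<in> W"
    have "0 \<le> \<sigma> * (u (chart_inv c (y + s *\<^sub>R axis 2 1)) t - barrier \<sigma> B h F (y + s *\<^sub>R axis 2 1) t)"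
    proof (rule cmp)
      show "y + s *\<^sub>R axis 2 1 \<in> cball y \<rho> \<inter> half_plane" using s y2 by (auto simp: dist_norm
          half_plane_def)
      show "0 \<le> h (y + s *\<^sub>R axis 2 1)" using d(2)[rule_format, of s] s W(2) h(3) by auto
    qed
    moreover have "\<sigma> * (u (chart_inv c y) t - barrier \<sigma> B h F y t) = 0"
      using u_bdry[OF p(1), of t] t c p by (simp add: y barrier_def h(3)[unfolded y] F(2)[unfolded
          y])
    ultimately show "\<sigma> * (u (chart_inv c y) t - barrier \<sigma> B h F y t) \<le> \<sigma> * (u (chart_inv c (y + s
        *\<^sub>R axis 2 1)) t - barrier \<sigma> B h F (y + s *\<^sub>R axis 2 1) t)"
      by linarith
  qed
  from this[unfolded bar(3)[OF W(3)]] show ?thesis unfolding sub h(3) by (simp add: exp_minus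
      divide_inverse)
qed

end

section \<open>Frozen-coefficient polynomials and local bounds on the metric\<close>

lemma eventually_small_multiple: "0 < b \<Longrightarrow> \<forall>\<^sub>F d in at_right (0::real). a * d < b"
proof -
  assume b: "0 < b"
  have "((\<lambda>d. a * d) \<longlongrightarrow> a * 0) (at_right 0)" by (intro tendsto_intros)
  then show ?thesis by (rule order_tendstoD(2)) (use b in simp)
qed

text \<open>By Cayley-Hamilton, trace times \<open>g\<close> minus determinant times the identity is
  the square of \<open>g\<close>, hence positive semidefinite. This gives the ellipticity constant
  without eigenvalues.\<close>

lemma quadratic_form_lower_bound:
  fixes g11 g12 g22 v w :: real
  assumes "0 < g11 * g22 - g12 * g12" "0 < g11" and tr: "(g11 + g22) / (g11 * g22 - g12 * g12) \<le> \<Gamma>"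
  shows "v * v + w * w \<le> \<Gamma> * (g11 * v * v + 2 * g12 * v * w + g22 * w * w)"
    "0 \<le> g11 * v * v + 2 * g12 * v * w + g22 * w * w"
proof -
  define d where "d = g11 * g22 - g12 * g12"
  define q where "q = g11 * v * v + 2 * g12 * v * w + g22 * w * w"
  have d: "0 < d" using assms(1) by (simp add: d_def)
  have "g11 * q = (g11 * v + g12 * w)\<^sup>2 + d * w\<^sup>2" by (simp add: q_def d_def power2_eq_square
      algebra_simps)
  then have "0 \<le> g11 * q" using d by simp
  then have q: "0 \<le> q" using assms(2) by (simp add: zero_le_mult_iff)
  then show "0 \<le> g11 * v * v + 2 * g12 * v * w + g22 * w * w" by (simp add: q_def)
  have "q * (g11 + g22) - d * (v * v + w * w) = (g11 * v + g12 * w)\<^sup>2 + (g12 * v + g22 * w)\<^sup>2"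
    by (simp add: q_def d_def power2_eq_square algebra_simps)
  then have "d * (v * v + w * w) \<le> q * (g11 + g22)" by (smt (verit) zero_le_power2)
  then have "v * v + w * w \<le> q * ((g11 + g22) / d)" using d by (simp add: pos_le_divide_eq
      mult.commute)
  also have "\<dots> \<le> q * \<Gamma>" using tr q unfolding d_def by (rule mult_left_mono)
  finally show "v * v + w * w \<le> \<Gamma> * (g11 * v * v + 2 * g12 * v * w + g22 * w * w)" by (simp add:
      q_def mult.commute)
qed

context riemannian_surface
begin

definition hyp_quad :: "'a chart \<Rightarrow> real^2 \<Rightarrow> real \<Rightarrow> real \<Rightarrow> real \<Rightarrow> real^2 \<Rightarrow> real" where
  "hyp_quad c y k \<sigma> \<delta> = quad y 0 0 (k / sqrt (metric_inv S c y $ 2 $ 2))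
     (k * \<sigma> * g c y $ 1 $ 1 / \<delta>) (2 * k * \<sigma> * g c y $ 1 $ 2 / \<delta>) (k * \<sigma> * g c y $ 2 $ 2 / \<delta>)"

lemma metric_inv_inverse:
  assumes c: "c \<in> \<A>" "y \<in> chart_img c"
  shows "metric_inv S c y $ 1 $ 1 * g c y $ 1 $ 1 + metric_inv S c y $ 1 $ 2 * g c y $ 1 $ 2 = 1"
    "metric_inv S c y $ 1 $ 1 * g c y $ 1 $ 2 + metric_inv S c y $ 1 $ 2 * g c y $ 2 $ 2 = 0"
    "metric_inv S c y $ 1 $ 2 * g c y $ 1 $ 1 + metric_inv S c y $ 2 $ 2 * g c y $ 1 $ 2 = 0"
    "metric_inv S c y $ 1 $ 2 * g c y $ 1 $ 2 + metric_inv S c y $ 2 $ 2 * g c y $ 2 $ 2 = 1"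
proof -
  define D where "D = det (g c y)"
  have D: "g c y $ 1 $ 1 * g c y $ 2 $ 2 - g c y $ 1 $ 2 * g c y $ 1 $ 2 = D" "D \<noteq> 0"
    using det_metric[OF c] metric_pos[OF c] by (auto simp: D_def)
  show "metric_inv S c y $ 1 $ 1 * g c y $ 1 $ 1 + metric_inv S c y $ 1 $ 2 * g c y $ 1 $ 2 = 1"
    "metric_inv S c y $ 1 $ 1 * g c y $ 1 $ 2 + metric_inv S c y $ 1 $ 2 * g c y $ 2 $ 2 = 0"
    "metric_inv S c y $ 1 $ 2 * g c y $ 1 $ 1 + metric_inv S c y $ 2 $ 2 * g c y $ 1 $ 2 = 0"
    "metric_inv S c y $ 1 $ 2 * g c y $ 1 $ 2 + metric_inv S c y $ 2 $ 2 * g c y $ 2 $ 2 = 1"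
    unfolding metric_inv_2[OF c] D_def[symmetric] using D
    by (simp_all add: diff_divide_distrib[symmetric] mult.commute)
qed

lemma hyp_quad_eq:
  assumes "0 < \<delta>" "x $ 1 - y $ 1 = \<delta> * v" "x $ 2 - y $ 2 = \<delta> * w"
  shows "hyp_quad c y k \<sigma> \<delta> x = \<delta> * (k * (1 / sqrt (metric_inv S c y $ 2 $ 2) * w
     + \<sigma> * (g c y $ 1 $ 1 * v * v + 2 * g c y $ 1 $ 2 * v * w + g c y $ 2 $ 2 * w * w)))"
  unfolding hyp_quad_def quad_def assms(2,3) using assms(1) by (simp add: field_simps
      power2_eq_square)

lemma hyp_quad_estimate:
  assumes c: "c \<in> \<A>" "x \<in> chart_img c" "y \<in> chart_img c" and \<sigma>: "\<sigma> * \<sigma> = 1"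
    and \<omega>: "\<bar>metric_inv S c x $ 1 $ 1 - metric_inv S c y $ 1 $ 1\<bar> \<le> \<omega>" "\<bar>metric_inv S c x $ 1 $ 2 -
        metric_inv S c y $ 1 $ 2\<bar> \<le> \<omega>"
      "\<bar>metric_inv S c x $ 2 $ 2 - metric_inv S c y $ 2 $ 2\<bar> \<le> \<omega>"
    and \<Gamma>: "\<bar>metric_inv S c x $ 1 $ 1\<bar> \<le> \<Gamma>" "\<bar>metric_inv S c x $ 1 $ 2\<bar> \<le> \<Gamma>" "\<bar>metric_inv S c x $ 2
        $ 2\<bar> \<le> \<Gamma>"
      "\<bar>lap_coeff c 1 x\<bar> \<le> \<Gamma>" "\<bar>lap_coeff c 2 x\<bar> \<le> \<Gamma>"
      "\<bar>g c y $ 1 $ 1\<bar> \<le> \<Gamma>" "\<bar>g c y $ 1 $ 2\<bar> \<le> \<Gamma>" "\<bar>g c y $ 2 $ 2\<bar> \<le> \<Gamma>" "1 / sqrt (metric_inv S c y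
          $ 2 $ 2) \<le> \<Gamma>"
    and k: "0 \<le> k" "k \<le> 2" and \<delta>: "0 < \<delta>" "\<delta> \<le> 1" and e: "0 \<le> e" and xy: "dist x y \<le> R * \<delta>"
  defines "Pm \<equiv> 2 * \<Gamma> * (1 + 4 * R)" and "Hm \<equiv> 2 * (\<Gamma> * R + 4 * \<Gamma> * R * R)"
  shows "\<bar>gradsq c (chart_img c) (hyp_quad c y k \<sigma> \<delta>) x - (e + hyp_quad c y k \<sigma> \<delta> x) * ell c
      (chart_img c) (hyp_quad c y k \<sigma> \<delta>) x - k * k\<bar>
     \<le> (4 * Pm * Pm + 16 * \<Gamma> * Hm + 16 * \<Gamma> * \<Gamma> + 2 * \<Gamma> * Pm * (1 + Hm)) * (\<omega> + e / \<delta> + \<delta>)"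
    and "\<bar>hyp_quad c y k \<sigma> \<delta> x\<bar> \<le> \<delta> * Hm"
proof -
  define v w where "v = (x $ 1 - y $ 1) / \<delta>" and "w = (x $ 2 - y $ 2) / \<delta>"
  have vw: "x $ 1 - y $ 1 = \<delta> * v" "x $ 2 - y $ 2 = \<delta> * w" using \<delta> by (auto simp: v_def w_def)
  have comp: "\<bar>(x - y) $ i\<bar> / \<delta> \<le> R" for i
    using component_le_norm_cart[of "x - y" i] xy \<delta> by (simp add: dist_norm pos_divide_le_eq)
  have vwR: "\<bar>v\<bar> \<le> R" "\<bar>w\<bar> \<le> R" using comp[of 1] comp[of 2] \<delta> by (simp_all add: v_def w_def
      abs_divide)
  define m where "m = 1 / sqrt (metric_inv S c y $ 2 $ 2)"
  have A22: "0 < metric_inv S c y $ 2 $ 2" by (rule metric_inv_pos(2)[OF c(1,3)])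
  have m: "m * m * metric_inv S c y $ 2 $ 2 = 1" "0 \<le> m" "m \<le> \<Gamma>"
    using A22 \<Gamma>(9) by (simp_all add: m_def real_sqrt_mult_self abs_of_pos)
  define g11 g12 g22 where "g11 = g c y $ 1 $ 1" and "g12 = g c y $ 1 $ 2" and "g22 = g c y $ 2 $ 2"
  define H where "H = k * (m * w + \<sigma> * (g11 * v * v + 2 * g12 * v * w + g22 * w * w))"
  define P1 P2 where "P1 = k * \<sigma> * (2 * g11 * v + 2 * g12 * w)" and "P2 = k * (m + \<sigma> * (2 * g12 * v
      + 2 * g22 * w))"
  have hH: "hyp_quad c y k \<sigma> \<delta> x = \<delta> * H"
    unfolding hyp_quad_eq[OF \<delta>(1) vw] H_def m_def g11_def g12_def g22_def ..
  have hq: "hyp_quad c y k \<sigma> \<delta> = quad y 0 0 (k * m) (k * \<sigma> * g11 / \<delta>) (2 * k * \<sigma> * g12 / \<delta>) (k * \<sigma> *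
      g22 / \<delta>)"
    by (simp add: hyp_quad_def m_def g11_def g12_def g22_def)
  note V = chart_img_open[OF c(1)] c(2)
  have P: "0 + 2 * (k * \<sigma> * g11 / \<delta>) * (\<delta> * v) + 2 * k * \<sigma> * g12 / \<delta> * (\<delta> * w) = P1"
    "k * m + 2 * k * \<sigma> * g12 / \<delta> * (\<delta> * v) + 2 * (k * \<sigma> * g22 / \<delta>) * (\<delta> * w) = P2"
    using \<delta>(1) by (simp_all add: P1_def P2_def algebra_simps)
  have gr: "gradsq c (chart_img c) (hyp_quad c y k \<sigma> \<delta>) x = metric_inv S c x $ 1 $ 1 * P1 * P1 + 2 *
      metric_inv S c x $ 1 $ 2 * P1 * P2 + metric_inv S c x $ 2 $ 2 * P2 * P2"
    unfolding gradsq_def hq pdi_quad[OF V] vw P by (simp add: power2_eq_square algebra_simps)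
  have el: "ell c (chart_img c) (hyp_quad c y k \<sigma> \<delta>) x = (2 * k * \<sigma> / \<delta>) * (metric_inv S c x $ 1 $ 1
      * g11 + 2 * metric_inv S c x $ 1 $ 2 * g12 + metric_inv S c x $ 2 $ 2 * g22)
      + lap_coeff c 1 x * P1 + lap_coeff c 2 x * P2"
    unfolding hq ell_quad[OF V] vw P using \<delta>(1) by (simp add: field_simps)
  note inv = metric_inv_inverse[OF c(1,3), folded g11_def g12_def g22_def]
  note est = barrier_estimate[OF inv m \<sigma> \<omega> \<Gamma>(1-5) \<Gamma>(6-8)[folded g11_def g12_def g22_def] k vwR \<delta> e,
      folded H_def P1_def P2_def Pm_def Hm_def]
  show "\<bar>gradsq c (chart_img c) (hyp_quad c y k \<sigma> \<delta>) x - (e + hyp_quad c y k \<sigma> \<delta> x) * ell c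
      (chart_img c) (hyp_quad c y k \<sigma> \<delta>) x - k * k\<bar>
     \<le> (4 * Pm * Pm + 16 * \<Gamma> * Hm + 16 * \<Gamma> * \<Gamma> + 2 * \<Gamma> * Pm * (1 + Hm)) * (\<omega> + e / \<delta> + \<delta>)"
    unfolding gr el hH using est(1) unfolding Pm_def Hm_def .
  show "\<bar>hyp_quad c y k \<sigma> \<delta> x\<bar> \<le> \<delta> * Hm"
    unfolding hH using est(2) \<delta>(1) unfolding Hm_def by (simp add: abs_mult)
qed

text \<open>One constant for all quantities met near a boundary point. Trace over determinant serves
  \<open>quadratic_form_lower_bound\<close>, the reciprocal of the inverse metric entry 22 serves
  the corrector, and its root the passage to the normal derivative.\<close>

definition coeff_bound :: "'a chart \<Rightarrow> real \<Rightarrow> real^2 \<Rightarrow> bool" where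
  "coeff_bound c \<Gamma> x \<longleftrightarrow>
     \<bar>metric_inv S c x $ 1 $ 1\<bar> \<le> \<Gamma> \<and> \<bar>metric_inv S c x $ 1 $ 2\<bar> \<le> \<Gamma> \<and> \<bar>metric_inv S c x $ 2 $ 2\<bar> \<le>
         \<Gamma> \<and>
     \<bar>lap_coeff c 1 x\<bar> \<le> \<Gamma> \<and> \<bar>lap_coeff c 2 x\<bar> \<le> \<Gamma> \<and>
     \<bar>g c x $ 1 $ 1\<bar> \<le> \<Gamma> \<and> \<bar>g c x $ 1 $ 2\<bar> \<le> \<Gamma> \<and> \<bar>g c x $ 2 $ 2\<bar> \<le> \<Gamma> \<and>
     1 / sqrt (metric_inv S c x $ 2 $ 2) \<le> \<Gamma> \<and> sqrt (metric_inv S c x $ 2 $ 2) \<le> \<Gamma> \<and>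
     1 / metric_inv S c x $ 2 $ 2 \<le> \<Gamma> \<and>
     (g c x $ 1 $ 1 + g c x $ 2 $ 2) / det (g c x) \<le> \<Gamma> \<and> \<bar>boundary_curvature c x\<bar> \<le> \<Gamma>"

lemma local_coeff_bound:
  assumes c: "c \<in> \<A>" and A: "compact A" "A \<subseteq> chart_img c"
  obtains \<Gamma> where "1 \<le> \<Gamma>" "\<And>x. x \<in> A \<Longrightarrow> coeff_bound c \<Gamma> x"
proof -
  let ?a = "\<lambda>x. metric_inv S c x $ 2 $ 2"
  note cont = Ck_on_imp_continuous[OF Ck_on_metric_inv[OF c]] Ck_on_imp_continuous[OF
      smooth_metric[OF c]]
    continuous_lap_coeff[OF c] continuous_boundary_curvature[OF c] Ck_on_imp_continuous[OF
        Ck_on_det[OF c]]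
  have pos: "0 < ?a x" "0 < det (g c x)" if "x \<in> chart_img c" for x
    using metric_inv_pos(2)[OF c that] metric_pos(2)[OF c that] .
  have bound: "\<exists>C. \<forall>x\<in>A. \<bar>f x\<bar> \<le> C" if "continuous_on (chart_img c) f" for f :: "real^2 \<Rightarrow> real"
    by (rule compact_abs_bound[OF A(1) continuous_on_subset[OF that A(2)]]) blast
  have nz: "\<forall>x\<in>chart_img c. sqrt (?a x) \<noteq> 0" "\<forall>x\<in>chart_img c. ?a x \<noteq> 0" "\<forall>x\<in>chart_img c. det (g c x)
      \<noteq> 0"
    by (auto dest: pos)
  let ?f = "\<lambda>x. \<bar>metric_inv S c x $ 1 $ 1\<bar> + \<bar>metric_inv S c x $ 1 $ 2\<bar> + \<bar>?a x\<bar>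
     + \<bar>lap_coeff c 1 x\<bar> + \<bar>lap_coeff c 2 x\<bar> + \<bar>g c x $ 1 $ 1\<bar> + \<bar>g c x $ 1 $ 2\<bar> + \<bar>g c x $ 2 $ 2\<bar>
     + \<bar>1 / sqrt (?a x)\<bar> + \<bar>sqrt (?a x)\<bar> + \<bar>1 / ?a x\<bar> + \<bar>(g c x $ 1 $ 1 + g c x $ 2 $ 2) / det (g c
         x)\<bar> + \<bar>boundary_curvature c x\<bar>"
  have "continuous_on (chart_img c) ?f" by (intro continuous_intros cont nz)
  from bound[OF this] obtain C where C: "\<And>x. x \<in> A \<Longrightarrow> \<bar>?f x\<bar> \<le> C" by blast
  have aux: "a1 \<le> max 1 C \<and> a2 \<le> max 1 C \<and> a3 \<le> max 1 C \<and> a4 \<le> max 1 C \<and> a5 \<le> max 1 C \<and> a6 \<le> max 1 C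
      \<and> a7 \<le> max 1 C \<and> a8 \<le> max 1 C \<and> a9 \<le> max 1 C \<and> a10 \<le> max 1 C \<and> a11 \<le> max 1 C \<and> a12 \<le> max 1 C \<and>
      a13 \<le> max 1 C"
    if "a1 + a2 + a3 + a4 + a5 + a6 + a7 + a8 + a9 + a10 + a11 + a12 + a13 \<le> C" "0 \<le> a1" "0 \<le> a2" "0
        \<le> a3" "0 \<le> a4" "0 \<le> a5" "0 \<le> a6" "0 \<le> a7" "0 \<le> a8" "0 \<le> a9" "0 \<le> a10" "0 \<le> a11" "0 \<le> a12" "0
        \<le> a13"
    for a1 a2 a3 a4 a5 a6 a7 a8 a9 a10 a11 a12 a13 C :: real
    using that by (intro conjI; linarith)
  show ?thesis
  proof (rule that[of "max 1 C"])
    fix x assume "x \<in> A"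
    from aux[OF order_trans[OF abs_ge_self C[OF this]]]
    show "coeff_bound c (max 1 C) x" unfolding coeff_bound_def
      by (simp only: abs_ge_zero simp_thms) (meson abs_ge_self order_trans)
  qed simp
qed

lemma local_metric_uniform:
  assumes c: "c \<in> \<A>" and A: "compact A" "A \<subseteq> chart_img c" and \<omega>: "0 < \<omega>"
  obtains d where "0 < d" "\<And>x y i j. x \<in> A \<Longrightarrow> y \<in> A \<Longrightarrow> dist x y < d \<Longrightarrow> \<bar>metric_inv S c x $ i $ j -
      metric_inv S c y $ i $ j\<bar> \<le> \<omega>"
proof -
  have "\<exists>d>0. \<forall>x\<in>A. \<forall>y\<in>A. dist x y < d \<longrightarrow> \<bar>metric_inv S c x $ i $ j - metric_inv S c y $ i $ j\<bar> \<le> \<omega>"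
      for i j
  proof -
    have "uniformly_continuous_on A (\<lambda>x. metric_inv S c x $ i $ j)"
      by (intro compact_uniformly_continuous A continuous_on_subset[OF Ck_on_imp_continuous[OF
          Ck_on_metric_inv[OF c]] A(2)])
    then obtain d where "d > 0" "\<forall>x\<in>A. \<forall>x'\<in>A. dist x' x < d \<longrightarrow> dist (metric_inv S c x' $ i $ j)
        (metric_inv S c x $ i $ j) < \<omega>"
      unfolding uniformly_continuous_on_def using \<omega> by blast
    then show ?thesis by (intro exI[of _ d]) (auto simp: dist_real_def intro: less_imp_le)
  qed
  then obtain d where d: "\<And>i j. d i j > 0" "\<And>i j x y. x \<in> A \<Longrightarrow> y \<in> A \<Longrightarrow> dist x y < d i j \<Longrightarrow> \<bar>metric_inv
      S c x $ i $ j - metric_inv S c y $ i $ j\<bar> \<le> \<omega>"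
    by metis
  show ?thesis
  proof (rule that[of "min (min (d 1 1) (d 1 2)) (min (d 2 1) (d 2 2))"])
    fix x y :: "real^2" and i j :: 2
    assume "x \<in> A" "y \<in> A" and l: "dist x y < min (min (d 1 1) (d 1 2)) (min (d 2 1) (d 2 2))"
    moreover from l have "dist x y < d i j" using exhaust_2[of i] exhaust_2[of j] by auto
    ultimately show "\<bar>metric_inv S c x $ i $ j - metric_inv S c y $ i $ j\<bar> \<le> \<omega>" by (intro d(2))
  qed (use d(1) in simp)
qed

text \<open>The convex term contributes at least \<open>6 * \<Gamma>\<close> to the Laplacian,
  against at most \<open>2 * \<Gamma>\<close> from the concave term and \<open>3 * \<Gamma>\<close>
  from the first-order terms. For small \<open>\<rho>\<close> it costs no more than half of
  \<open>x $ 2\<close>, so both upper bounds survive: the linear one is meant for the initial time,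
  the quadratic one for the outer circle.\<close>

lemma corrector:
  assumes c: "c \<in> \<A>" "x \<in> chart_img c" and y: "y $ 2 = 0" and x: "x \<in> cball y \<rho> \<inter> half_plane"
    and \<rho>: "\<rho> \<le> 1" "3 * \<Gamma> * \<Gamma> * \<rho> \<le> 1/2" and \<Gamma>: "1 \<le> \<Gamma>" "coeff_bound c \<Gamma> x"
  shows "quad y 0 0 (- 1) (- 1) 0 (3 * \<Gamma> * \<Gamma>) x \<le> - (x $ 2 / 2)"
    "quad y 0 0 (- 1) (- 1) 0 (3 * \<Gamma> * \<Gamma>) x \<le> - ((dist x y)\<^sup>2 / 2)"
    "0 \<le> ell c (chart_img c) (quad y 0 0 (- 1) (- 1) 0 (3 * \<Gamma> * \<Gamma>)) x"
proof -
  define N where "N = 3 * \<Gamma> * \<Gamma>"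
  have N: "0 \<le> N" using \<Gamma>(1) by (simp add: N_def)
  define d1 where "d1 = x $ 1 - y $ 1"
  have x2: "0 \<le> x $ 2" using x by (simp add: half_plane_def)
  have dist: "dist x y \<le> \<rho>" using x by (simp add: dist_commute)
  have cmp: "\<bar>d1\<bar> \<le> \<rho>" "x $ 2 \<le> \<rho>"
    using component_le_norm_cart[of "x - y" 1] component_le_norm_cart[of "x - y" 2] dist y by (auto
        simp: dist_norm d1_def)
  have Nx: "N * x $ 2 \<le> 1/2" using mult_left_mono[OF cmp(2) N] \<rho>(2) by (simp add: N_def)
  then have Nxx: "N * x $ 2 * x $ 2 \<le> x $ 2 / 2" using mult_right_mono[OF Nx x2] by simp
  have F: "quad y 0 0 (- 1) (- 1) 0 N x = - (x $ 2) - d1 * d1 + N * x $ 2 * x $ 2"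
    by (simp add: quad_def y d1_def power2_eq_square)
  show "quad y 0 0 (- 1) (- 1) 0 (3 * \<Gamma> * \<Gamma>) x \<le> - (x $ 2 / 2)"
    using Nxx zero_le_square[of d1] unfolding N_def[symmetric] F by linarith
  have "x $ 2 * x $ 2 \<le> x $ 2 * 1" using cmp(2) \<rho>(1) x2 by (intro mult_left_mono) auto
  moreover have "(dist x y)\<^sup>2 = d1 * d1 + x $ 2 * x $ 2"
    by (simp add: dist_vec_def L2_set_def sum_2 dist_real_def y d1_def power2_eq_square)
  ultimately show "quad y 0 0 (- 1) (- 1) 0 (3 * \<Gamma> * \<Gamma>) x \<le> - ((dist x y)\<^sup>2 / 2)"
    using Nxx zero_le_square[of d1] unfolding N_def[symmetric] F by linarith
  define a22 where "a22 = metric_inv S c x $ 2 $ 2"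
  have a22: "0 < a22" using metric_inv_pos(2)[OF c] by (simp add: a22_def)
  have bd: "\<bar>metric_inv S c x $ 1 $ 1\<bar> \<le> \<Gamma>" "\<bar>lap_coeff c 1 x\<bar> \<le> \<Gamma>" "\<bar>lap_coeff c 2 x\<bar> \<le> \<Gamma>" "1 / a22
      \<le> \<Gamma>"
    using \<Gamma>(2) by (auto simp: coeff_bound_def a22_def)
  have "1 \<le> \<Gamma> * a22" using bd(4) a22 by (simp add: pos_divide_le_eq)
  then have "6 * \<Gamma> * 1 \<le> 6 * \<Gamma> * (\<Gamma> * a22)" using \<Gamma>(1) by (intro mult_left_mono) auto
  then have t1: "6 * \<Gamma> \<le> 2 * N * a22" by (simp add: N_def algebra_simps)
  have "\<bar>lap_coeff c 1 x * (- 2 * d1)\<bar> \<le> \<Gamma> * 2" unfolding abs_mult using bd(2) cmp(1) \<rho>(1) by (intro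
      mult_mono) auto
  moreover have "\<bar>lap_coeff c 2 x * (- 1 + 2 * N * x $ 2)\<bar> \<le> \<Gamma> * 1"
    unfolding abs_mult
  proof (intro mult_mono bd(3))
    show "\<bar>- 1 + 2 * N * x $ 2\<bar> \<le> 1" using Nx mult_nonneg_nonneg[OF N x2] by linarith
  qed (use \<Gamma>(1) in auto)
  moreover have "ell c (chart_img c) (quad y 0 0 (- 1) (- 1) 0 N) x
      = - 2 * metric_inv S c x $ 1 $ 1 + 2 * N * a22 + lap_coeff c 1 x * (- 2 * d1) + lap_coeff c 2
          x * (- 1 + 2 * N * x $ 2)"
    unfolding ell_quad[OF chart_img_open[OF c(1)] c(2)] by (simp add: y d1_def a22_def)
  ultimately show "0 \<le> ell c (chart_img c) (quad y 0 0 (- 1) (- 1) 0 (3 * \<Gamma> * \<Gamma>)) x"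
    unfolding N_def[symmetric] using t1 bd(1) \<Gamma>(1) by linarith
qed

end

section \<open>Boundary data at the initial time, and the choice of constants\<close>

context flow
begin

text \<open>On the boundary line \<open>u\<close> equals \<open>\<psi> t0\<close>, and vertical
  segments down to the line stay in the half ball because its centre lies on the line; a bound on
  the second partial derivative does the rest.\<close>

lemma initial_lipschitz:
  assumes c: "c \<in> \<A>" and A: "cball x0 r \<inter> half_plane \<subseteq> chart_img c" "x0 $ 2 = 0" and t0: "T3 \<le> t0"
  obtains \<Lambda> where "0 \<le> \<Lambda>" "\<And>x. x \<in> cball x0 r \<inter> half_plane \<Longrightarrow> \<psi> t0 - \<Lambda> * x $ 2 \<le> u (chart_inv c x)
      t0"
proof -
  let ?A = "cball x0 r \<inter> half_plane" and ?v = "\<lambda>x. u (chart_inv c x) t0"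
  have t00: "0 \<le> t0" using t0 T3 by simp
  note V = chart_img_open[OF c]
  have v2: "Ck_on (Suc (Suc 0)) (chart_img c) ?v" using Ck_on_u[OF c t00] by (simp add: Ck_on_2)
  obtain \<Lambda> where \<Lambda>: "0 \<le> \<Lambda>" "\<And>x. x \<in> ?A \<Longrightarrow> \<bar>pdi (chart_img c) 2 ?v x\<bar> \<le> \<Lambda>"
    using compact_abs_bound[OF compact_half_ball continuous_on_subset[OF Ck_on_imp_continuous[OF
        Ck_on_pdi[OF v2]] A(1)]] by blast
  show ?thesis
  proof (rule that[OF \<Lambda>(1)])
    fix x assume x: "x \<in> ?A"
    define z where "z = x - x $ 2 *\<^sub>R axis 2 1"
    have z: "z $ 2 = 0" "z $ 1 = x $ 1" "z + x $ 2 *\<^sub>R axis 2 1 = x" by (simp_all add: z_def)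
    have x2: "0 \<le> x $ 2" using x by (simp add: half_plane_def)
    have seg: "z + s *\<^sub>R axis 2 1 \<in> ?A" if "0 \<le> s" "s \<le> x $ 2" for s
    proof -
      have "(dist (z + s *\<^sub>R axis 2 1) x0)\<^sup>2 \<le> (dist x x0)\<^sup>2"
        using that by (simp add: dist_vec_def L2_set_def sum_2 dist_real_def z A(2) power_mono)
      then have "dist (z + s *\<^sub>R axis 2 1) x0 \<le> dist x x0" by (rule power2_le_imp_le) simp
      then show ?thesis using x that z by (simp add: dist_commute half_plane_def)
    qed
    have "\<exists>s\<in>{0..x $ 2}. ?v (z + x $ 2 *\<^sub>R axis 2 1) - ?v (z + 0 *\<^sub>R axis 2 1) = (x $ 2 - 0) * pdi
        (chart_img c) 2 ?v (z + s *\<^sub>R axis 2 1)"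
    proof (rule mvt_very_simple[OF x2, of "\<lambda>s. ?v (z + s *\<^sub>R axis 2 1)" "\<lambda>s h. h * pdi (chart_img c)
        2 ?v (z + s *\<^sub>R axis 2 1)"])
      fix s assume s: "0 \<le> s" "s \<le> x $ 2"
      have "((\<lambda>s. ?v (z + s *\<^sub>R axis 2 1)) has_real_derivative pdi (chart_img c) 2 ?v (z + s *\<^sub>R
          axis 2 1)) (at s within {s. z + s *\<^sub>R axis 2 1 \<in> chart_img c})"
        using Ck_on_line_derivative[OF V v2, of z s "axis 2 1"] seg[OF s] A(1) by auto
      then have "((\<lambda>s. ?v (z + s *\<^sub>R axis 2 1)) has_real_derivative pdi (chart_img c) 2 ?v (z + s
          *\<^sub>R axis 2 1)) (at s within {0..x $ 2})"
        by (rule has_field_derivative_subset) (use seg A(1) in auto)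
      then show "((\<lambda>s. ?v (z + s *\<^sub>R axis 2 1)) has_derivative (\<lambda>h. h * pdi (chart_img c) 2 ?v (z +
          s *\<^sub>R axis 2 1))) (at s within {0..x $ 2})"
        by (simp add: has_field_derivative_def mult_commute_abs)
    qed
    then obtain s where s: "s \<in> {0..x $ 2}" "?v x - ?v z = x $ 2 * pdi (chart_img c) 2 ?v (z + s *\<^sub>R
        axis 2 1)"
      unfolding z(3) by auto
    have "z \<in> chart_img c" using seg[of 0] x2 A(1) by auto
    then have "chart_inv c z \<in> bdry S" using z(1) c chart_dom_subset[OF c] by (auto simp: bdry_def
        intro!: bexI[of _ c])
    then have "?v z = \<psi> t0" using u_bdry t0 by simp
    moreover have "x $ 2 * - \<Lambda> \<le> x $ 2 * pdi (chart_img c) 2 ?v (z + s *\<^sub>R axis 2 1)"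
      using \<Lambda>(2)[OF seg[of s]] s(1) x2 by (intro mult_left_mono) (auto simp: abs_le_iff)
    ultimately show "\<psi> t0 - \<Lambda> * x $ 2 \<le> ?v x" using s(2) by (simp add: mult.commute)
  qed
qed

text \<open>\<open>u\<close> is constant along the boundary at such times, so only the transversal
  derivative remains, with the factor \<open>a / sqrt (a * D) = sqrt (a / D)\<close>.\<close>

lemma normal_derivative_bdry:
  assumes p: "p \<in> bdry S" and c: "c \<in> \<A>" "p \<in> chart_dom c" and t: "T3 \<le> t"
  shows "normal_derivative S (\<lambda>q. u q t) p = - sqrt (metric_inv S c (chart_map c p) $ 2 $ 2) * pdi
      (chart_img c) 2 (\<lambda>x. u (chart_inv c x) t) (chart_map c p)"
proof -
  define y where "y = chart_map c p"
  have t0: "0 \<le> t" using t T3 by simp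
  have y: "y \<in> chart_img c" using c by (simp add: y_def)
  have y2: "y $ 2 = 0" using boundary_chart[OF p c] by (simp add: y_def)
  have tan: "pdi (chart_img c) 1 (\<lambda>x. u (chart_inv c x) t) y = 0"
  proof (rule pdi_tangential[OF chart_img_open[OF c(1)] y])
    fix z assume z: "z \<in> chart_img c" "z $ 2 = y $ 2"
    then have "chart_inv c z \<in> bdry S" using y2 c chart_dom_subset[OF c(1)] by (auto simp: bdry_def
        intro!: bexI[of _ c])
    then show "u (chart_inv c z) t = \<psi> t" using u_bdry t by simp
  qed
  define a D where "a = g c y $ 1 $ 1" and "D = det (g c y)"
  have aD: "0 < a" "0 < D" using metric_pos[OF c(1) y] by (auto simp: a_def D_def)
  have "a / sqrt (a * D) = sqrt (a / D)" using aD by (simp add: real_sqrt_mult real_sqrt_divide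
      field_simps)
  moreover have "metric_inv S c y $ 2 $ 2 = a / D" using metric_inv_2(4)[OF c(1) y] by (simp add:
      a_def D_def)
  ultimately have r: "a / sqrt (a * D) = sqrt (metric_inv S c y $ 2 $ 2)" by simp
  have "normal_derivative S (\<lambda>q. u q t) p = - (a / sqrt (a * D)) * pdi (chart_img c) 2 (\<lambda>x. u
      (chart_inv c x) t) y"
    using normal_derivative_chart[OF p c, of "\<lambda>q. u q t"] Ck_on_u[OF c(1) t0] tan
    by (simp add: y_def[symmetric] o_def a_def[symmetric] D_def[symmetric])
  then show ?thesis unfolding r y_def .
qed

end

text \<open>Every condition bounds a multiple of \<open>\<delta>\<close> by a positive number, so
  all of them hold together as \<open>\<delta>\<close> tends to 0 from the right.\<close>

lemma small_constants:
  fixes r d0 \<eta> R N E0 E1 :: real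
  assumes "0 < r" "0 < d0" "0 < \<eta>"
  obtains \<delta> where "0 < \<delta>" "\<delta> < 1" "R * \<delta> < r" "R * \<delta> < d0" "R * \<delta> < 1" "N * \<delta> < 1/2" "E0 * \<delta> < \<eta> /
      8" "E1 * \<delta> < \<eta> / 4"
proof -
  have "\<forall>\<^sub>F \<delta> in at_right 0. 0 < \<delta> \<and> 1 * \<delta> < 1 \<and> R * \<delta> < r \<and> R * \<delta> < d0 \<and> R * \<delta> < 1 \<and> N * \<delta> < 1/2 \<and>
      E0 * \<delta> < \<eta> / 8 \<and> E1 * \<delta> < \<eta> / 4"
    by (intro eventually_conj eventually_small_multiple eventually_at_right_less) (use assms in
        auto)
  then obtain \<delta> where "0 < \<delta> \<and> 1 * \<delta> < 1 \<and> R * \<delta> < r \<and> R * \<delta> < d0 \<and> R * \<delta> < 1 \<and> N * \<delta> < 1/2 \<and> E0 * \<delta>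
      < \<eta> / 8 \<and> E1 * \<delta> < \<eta> / 4"
    using eventually_happens'[OF trivial_limit_at_right_real] by blast
  then show ?thesis using that by auto
qed

context flow
begin

lemma large_time:
  assumes "0 < \<eta>" "0 < \<epsilon>"
  obtains t0 where "T \<le> t0" "\<And>t. t0 \<le> t \<Longrightarrow> deriv \<psi> t < \<eta>" "\<And>t. t0 \<le> t \<Longrightarrow> exp (- \<psi> t) \<le> \<epsilon>"
proof -
  have 1: "\<forall>\<^sub>F t in at_top. deriv \<psi> t < \<eta>" using order_tendstoD(2)[OF deriv_\<psi> assms(1)] .
  have 2: "\<forall>\<^sub>F t in at_top. - ln \<epsilon> \<le> \<psi> t" using \<psi>_at_top unfolding filterlim_at_top by blast
  have "\<forall>\<^sub>F t in at_top. T \<le> t \<and> deriv \<psi> t < \<eta> \<and> - ln \<epsilon> \<le> \<psi> t"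
    by (intro eventually_conj 1 2 eventually_ge_at_top)
  then obtain t0 where t0: "\<And>t. t0 \<le> t \<Longrightarrow> T \<le> t \<and> deriv \<psi> t < \<eta> \<and> - ln \<epsilon> \<le> \<psi> t"
    unfolding eventually_at_top_linorder by blast
  show ?thesis
  proof (rule that[of t0])
    fix t assume "t0 \<le> t"
    then have "- \<psi> t \<le> ln \<epsilon>" using t0[of t] by linarith
    then have "exp (- \<psi> t) \<le> exp (ln \<epsilon>)" by simp
    then show "exp (- \<psi> t) \<le> \<epsilon>" using assms(2) by simp
  qed (use t0 in auto)
qed

text \<open>For \<open>\<sigma> = -1\<close> the set \<open>h \<ge> 0\<close> is a lens tangent to the boundary line, and on its
  boundary the barrier is at least \<open>\<psi>\<close>. For \<open>\<sigma> = 1\<close> it is the whole half disc, and \<open>B F\<close> pushes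
  the barrier below the lower bound \<open>m0\<close> of \<open>u\<close> on the circular part of its boundary.\<close>

lemma boundary_barriers:
  assumes c: "c \<in> \<A>" and p: "p \<in> bdry S" "p \<in> chart_dom c" and y: "y = chart_map c p"
    and \<sigma>: "\<sigma> = 1 \<or> \<sigma> = -1" and \<eta>: "0 < \<eta>" "\<eta> \<le> 1/2" and \<delta>: "0 < \<delta>" "\<delta> < 1"
    and \<Gamma>: "1 \<le> \<Gamma>" "R = \<Gamma> * \<Gamma> + 1"
    and bound: "\<And>x. x \<in> cball y (R * \<delta>) \<inter> half_plane \<Longrightarrow> x \<in> chart_img c \<and> coeff_bound c \<Gamma> x \<and>
        chart_inv c x \<in> bounded_part"
    and close: "\<And>x i j. x \<in> cball y (R * \<delta>) \<inter> half_plane \<Longrightarrow> \<bar>metric_inv S c x $ i $ j - metric_inv S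
        c y $ i $ j\<bar> \<le> \<omega>"
    and t0: "T3 < t0" and \<psi>': "\<And>t. t0 \<le> t \<Longrightarrow> 0 \<le> deriv \<psi> t \<and> deriv \<psi> t < \<eta>"
    and upper: "\<And>q t. q \<in> M \<Longrightarrow> t0 \<le> t \<Longrightarrow> u q t \<le> \<psi> t"
    and lower: "\<And>q t. q \<in> bounded_part \<Longrightarrow> t0 \<le> t \<Longrightarrow> m0 \<le> u q t"
    and lip: "\<And>x. x \<in> cball y (R * \<delta>) \<inter> half_plane \<Longrightarrow> \<psi> t0 - \<Lambda> * x $ 2 \<le> u (chart_inv c x) t0"
    and C: "\<And>q. q \<in> inter S \<Longrightarrow> \<bar>K q\<bar> \<le> C" "0 \<le> C"
    and Pm: "Pm = 2 * \<Gamma> * (1 + 4 * R)" and Hm: "Hm = 2 * (\<Gamma> * R + 4 * \<Gamma> * R * R)"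
    and E0: "E0 = 4 * Pm * Pm + 16 * \<Gamma> * Hm + 16 * \<Gamma> * \<Gamma> + 2 * \<Gamma> * Pm * (1 + Hm)"
    and small: "R * \<delta> \<le> 1" "3 * \<Gamma> * \<Gamma> * (R * \<delta>) \<le> 1/2" "E0 * \<delta> \<le> \<eta> / 8" "(1 + Hm) * (1 + Hm) * C * \<delta>
        \<le> \<eta> / 4" "E0 * \<omega> \<le> \<eta> / 8"
    and e: "\<And>t. t0 \<le> t \<Longrightarrow> exp (- \<psi> t) \<le> \<delta>" "\<And>t. t0 \<le> t \<Longrightarrow> E0 * (exp (- \<psi> t) / \<delta>) \<le> \<eta> / 8"
    and B: "2 * \<Lambda> \<le> B" "2 * (- ln (\<delta> * R * R / \<Gamma>) - m0) / (R * \<delta>)\<^sup>2 \<le> B" "4 * \<Gamma> / exp (- \<psi> t0) \<le> B"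
    and t: "t0 \<le> t"
  shows "0 \<le> \<sigma> * pdi (chart_img c) 2 (\<lambda>x. u (chart_inv c x) t) y + B
      + \<sigma> * ((1 + \<sigma> * \<eta>) / sqrt (metric_inv S c y $ 2 $ 2)) * exp (\<psi> t)"
proof -
  define \<rho> where "\<rho> = R * \<delta>"
  have R: "1 < R" "0 < R" using \<Gamma> by (simp_all add: add_pos_pos)
  have \<rho>: "0 < \<rho>" using R \<delta> by (simp add: \<rho>_def)
  define D where "D = cball y \<rho> \<inter> half_plane"
  have Dimg: "D \<subseteq> chart_img c" using bound by (auto simp: D_def \<rho>_def)
  have yimg: "y \<in> chart_img c" using p y by simp
  have y2: "y $ 2 = 0" using boundary_chart[OF p(1) c p(2)] y by simp
  have yD: "y \<in> D" using y2 \<rho> by (simp add: D_def half_plane_def)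
  have cby: "coeff_bound c \<Gamma> y" using bound yD by (simp add: D_def \<rho>_def)
  have \<sigma>2: "\<sigma> * \<sigma> = 1" using \<sigma> by auto
  \<comment> \<open>The bound \<open>\<eta> \<le> 1/2\<close> keeps \<open>k\<close> between 1/2 and
    3/2.\<close>
  define k where "k = 1 + \<sigma> * \<eta>"
  have k: "0 < k" "k \<le> 2" "\<sigma> = 1 \<Longrightarrow> 1 \<le> k" using \<sigma> \<eta> by (auto simp: k_def)
  define m where "m = 1 / sqrt (metric_inv S c y $ 2 $ 2)"
  have A22: "0 < metric_inv S c y $ 2 $ 2" by (rule metric_inv_pos(2)[OF c yimg])
  have m: "0 < m" "m \<le> \<Gamma>" using A22 cby by (auto simp: m_def coeff_bound_def)
  define h where "h = hyp_quad c y k \<sigma> \<delta>"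
  define F where "F = quad y 0 0 (- 1) (- 1) 0 (3 * \<Gamma> * \<Gamma>)"
  have e0: "0 < exp (- \<psi> t0)" by simp
  have Bpos: "0 \<le> B" using B(3) \<Gamma>(1) by (smt (verit) divide_nonneg_pos e0)
  have Fx: "F x \<le> - (x $ 2 / 2)" "F x \<le> - ((dist x y)\<^sup>2 / 2)" "0 \<le> ell c (chart_img c) F x" "0 \<le> x $
      2" "F x \<le> 0" if x: "x \<in> D" for x
  proof -
    have xi: "x \<in> chart_img c" "coeff_bound c \<Gamma> x" using bound x by (auto simp: D_def \<rho>_def)
    note cor = corrector[OF c xi(1) y2 x[unfolded D_def] _ _ \<Gamma>(1) xi(2), folded F_def]
    show f: "F x \<le> - (x $ 2 / 2)" "F x \<le> - ((dist x y)\<^sup>2 / 2)" "0 \<le> ell c (chart_img c) F x"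
      using cor small(1,2) by (simp_all add: \<rho>_def)
    show "0 \<le> x $ 2" using x by (simp add: D_def half_plane_def)
    then show "F x \<le> 0" using f(1) by linarith
  qed
  define g11 g12 g22 where "g11 = g c y $ 1 $ 1" and "g12 = g c y $ 1 $ 2" and "g22 = g c y $ 2 $ 2"
  have dg: "det (g c y) = g11 * g22 - g12 * g12" using det_metric[OF c yimg] by (simp add: g11_def
      g12_def g22_def)
  have gq: "v * v + w * w \<le> \<Gamma> * (g11 * v * v + 2 * g12 * v * w + g22 * w * w)" "0 \<le> g11 * v * v + 2
      * g12 * v * w + g22 * w * w" for v w
    using quadratic_form_lower_bound[of g11 g22 g12 \<Gamma> v w] metric_pos[OF c yimg] cby dg
    by (simp_all add: coeff_bound_def g11_def g22_def)
  have split: "\<exists>w q. x $ 2 = \<delta> * w \<and> 0 \<le> w \<and> w \<le> R \<and> 0 \<le> q \<and> (dist x y)\<^sup>2 \<le> \<delta> * \<delta> * (\<Gamma> * q) \<and> h x =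
      \<delta> * (k * (m * w + \<sigma> * q))" if x: "x \<in> D" for x
  proof -
    define v w where "v = (x $ 1 - y $ 1) / \<delta>" and "w = x $ 2 / \<delta>"
    have vw: "x $ 1 - y $ 1 = \<delta> * v" "x $ 2 - y $ 2 = \<delta> * w" using \<delta> y2 by (auto simp: v_def w_def)
    define q where "q = g11 * v * v + 2 * g12 * v * w + g22 * w * w"
    have hx: "h x = \<delta> * (k * (m * w + \<sigma> * q))"
      unfolding h_def hyp_quad_eq[OF \<delta>(1) vw] m_def q_def g11_def g12_def g22_def ..
    have "(dist x y)\<^sup>2 = (x $ 1 - y $ 1) * (x $ 1 - y $ 1) + (x $ 2 - y $ 2) * (x $ 2 - y $ 2)"
      by (simp add: dist_vec_def L2_set_def sum_2 dist_real_def flip: power2_eq_square)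
    also have "\<dots> = \<delta> * \<delta> * (v * v + w * w)" unfolding vw by (simp add: algebra_simps)
    also have "\<dots> \<le> \<delta> * \<delta> * (\<Gamma> * q)" unfolding q_def using gq(1) by (intro mult_left_mono) auto
    finally have "(dist x y)\<^sup>2 \<le> \<delta> * \<delta> * (\<Gamma> * q)" .
    moreover have "w \<le> R"
    proof -
      have "x $ 2 \<le> dist x y" using component_le_norm_cart[of "x - y" 2] y2 by (simp add: dist_norm)
      also have "\<dots> \<le> R * \<delta>" using x by (simp add: D_def \<rho>_def dist_commute)
      finally show ?thesis using \<delta> by (simp add: w_def pos_divide_le_eq)
    qed
    moreover have "x $ 2 = \<delta> * w" "0 \<le> w" using \<delta> Fx(4)[OF x] by (auto simp: w_def)
    ultimately show ?thesis using hx gq(2)[of v w] unfolding q_def by blast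
  qed
  have ub: "u (chart_inv c x) s = \<psi> s" if "x \<in> D" "x $ 2 = 0" "t0 \<le> s" for x s
  proof -
    have "x \<in> chart_img c" using that Dimg by blast
    then have "chart_inv c x \<in> bdry S" using that c chart_dom_subset[OF c] by (auto simp: bdry_def
        intro!: bexI[of _ c])
    then show ?thesis using u_bdry that t0 by simp
  qed
  have DM: "chart_inv c x \<in> M" if "x \<in> D" for x
    using subsetD[OF chart_dom_subset[OF c] chart_inv_dom[OF subsetD[OF Dimg that]]] .
  have bar1: "barrier \<sigma> B h F x s \<le> \<psi> s + B * F x" if "\<sigma> = 1" "0 \<le> h x" for x s
  proof -
    have "ln (exp (- \<psi> s)) \<le> ln (exp (- \<psi> s) + h x)" using that(2) by (intro ln_mono) (auto intro:
        add_pos_nonneg)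
    then show ?thesis using that(1) by (simp add: barrier_def)
  qed
  have hD: "Ck_on 2 W h" "Ck_on 2 W F" "continuous_on UNIV h" "continuous_on UNIV F" if "hp_open W"
      for W
    unfolding h_def hyp_quad_def F_def by (intro Ck_on_quad that continuous_on_quad)+
  have BF: "B * F x \<le> 0" if "x \<in> D" for x using Bpos Fx(5)[OF that] by (simp add:
      mult_nonneg_nonpos)
  have cmp: "0 \<le> \<sigma> * (u (chart_inv c x) t - barrier \<sigma> B h F x t)" if x: "x \<in> cball y \<rho> \<inter> half_plane"
      "0 \<le> h x" for x
  proof (rule barrier_comparison[where c = c and y = y and \<rho> = \<rho> and h = h and F = F and \<eta> = \<eta> and C
      = C])
    show "c \<in> \<A>" "\<sigma> = 1 \<or> \<sigma> = -1" "T3 < t0" "0 < \<rho>" "cball y \<rho> \<inter> half_plane \<subseteq> chart_img c" "0 \<le> B"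
      by (fact c \<sigma> t0 \<rho> Dimg[unfolded D_def] Bpos)+
    show "x \<in> cball y \<rho> \<inter> half_plane" "0 \<le> h x" "t0 \<le> t" by (fact x t)+
    show "0 \<le> deriv \<psi> s \<and> deriv \<psi> s < \<eta>" if "t0 \<le> s" for s by (rule \<psi>'[OF that])
    show "\<bar>K q\<bar> \<le> C" if "q \<in> inter S" for q by (rule C(1)[OF that])
    show "Ck_on 2 W h" "Ck_on 2 W F" if "hp_open W" for W using hD that by auto
    show "continuous_on UNIV h" "continuous_on UNIV F" unfolding h_def hyp_quad_def F_def by (rule
        continuous_on_quad)+
    show "F x \<le> 0 \<and> 0 \<le> ell c (chart_img c) F x" if "x \<in> cball y \<rho> \<inter> half_plane" for x using Fx that
        by (simp add: D_def)
  next
    fix x t s assume x: "x \<in> cball y \<rho> \<inter> half_plane" and t: "t0 \<le> t" and hp: "0 < h x" and s: "s =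
        exp (- \<psi> t) + h x"
    define E where "E = gradsq c (chart_img c) h x - s * ell c (chart_img c) h x"
    have b: "x \<in> chart_img c" "coeff_bound c \<Gamma> x" and cl: "\<And>i j. \<bar>metric_inv S c x $ i $ j -
        metric_inv S c y $ i $ j\<bar> \<le> \<omega>"
      using bound close x by (auto simp: \<rho>_def)
    have "\<bar>E - k * k\<bar> \<le> E0 * (\<omega> + exp (- \<psi> t) / \<delta> + \<delta>)" and hH: "\<bar>h x\<bar> \<le> \<delta> * Hm"
      unfolding E_def s h_def E0 Pm Hm
      by (rule hyp_quad_estimate[OF c b(1) yimg \<sigma>2 cl cl cl];
          use b(2) cby k \<delta> x in \<open>auto simp: coeff_bound_def \<rho>_def dist_commute\<close>)+
    \<comment> \<open>The freezing error, the shift by \<open>exp (- \<psi> t)\<close> and the size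
      of \<open>\<delta>\<close> each get \<open>\<eta> / 8\<close>; the curvature term below gets
      \<open>\<eta> / 4\<close>.\<close>
    moreover have "E0 * (\<omega> + exp (- \<psi> t) / \<delta> + \<delta>) \<le> \<eta> / 8 + \<eta> / 8 + \<eta> / 8"
      unfolding distrib_left using small(3,5) e(2)[OF t] by linarith
    ultimately have E: "\<bar>E - k * k\<bar> \<le> 3 * \<eta> / 8" by linarith
    have s1: "0 \<le> s" "s \<le> \<delta> * (1 + Hm)" using hp hH e(1)[OF t] unfolding s by (auto simp:
        distrib_left abs_le_iff add_nonneg_nonneg)
    have "s\<^sup>2 \<le> (\<delta> * (1 + Hm))\<^sup>2" using s1 by (intro power_mono)
    also have "\<dots> = \<delta> * (\<delta> * ((1 + Hm) * (1 + Hm)))" by (simp add: power2_eq_square algebra_simps)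
    also have "\<dots> \<le> 1 * (\<delta> * ((1 + Hm) * (1 + Hm)))" using \<delta> by (intro mult_right_mono) auto
    finally have "s\<^sup>2 * C \<le> (\<delta> * ((1 + Hm) * (1 + Hm))) * C" using C(2) by (intro mult_right_mono)
        auto
    also have "\<dots> = (1 + Hm) * (1 + Hm) * C * \<delta>" by (simp add: algebra_simps)
    also have "\<dots> \<le> \<eta> / 4" by (rule small(4))
    finally have sC: "s\<^sup>2 * C \<le> \<eta> / 4" .
    have kk: "k * k = 1 + 2 * \<sigma> * \<eta> + \<eta> * \<eta>"
    proof -
      have "k * k = 1 + 2 * \<sigma> * \<eta> + (\<sigma> * \<sigma>) * (\<eta> * \<eta>)" unfolding k_def by (simp add: algebra_simps)
      then show ?thesis by (simp add: \<sigma>2)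
    qed
    \<comment> \<open>The total error is \<open>5 * \<eta> / 8\<close>. The lower barrier has
      \<open>2 * \<eta>\<close> in reserve and must keep \<open>\<eta>\<close>; the upper one has
      \<open>2 * \<eta> - \<eta> * \<eta>\<close>, at least \<open>3 * \<eta> / 2\<close>, and must
      keep a positive rest.\<close>
    have \<eta>2: "0 \<le> \<eta> * \<eta>" "\<eta> * \<eta> \<le> \<eta> * (1/2)" using \<eta> by (auto intro!: mult_left_mono)
    show "(\<sigma> = 1 \<longrightarrow> 1 + \<eta> \<le> gradsq c (chart_img c) h x - s * ell c (chart_img c) h x - s\<^sup>2 * C) \<and>
       (\<sigma> = -1 \<longrightarrow> gradsq c (chart_img c) h x - s * ell c (chart_img c) h x + s\<^sup>2 * C < 1)"
      unfolding E_def[symmetric]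
    proof (intro conjI impI)
      assume "\<sigma> = 1"
      then have "k * k = 1 + 2 * \<eta> + \<eta> * \<eta>" using kk by simp
      then show "1 + \<eta> \<le> E - s\<^sup>2 * C" using E sC \<eta>2 \<eta>(1) by linarith
    next
      assume "\<sigma> = -1"
      then have "k * k = 1 - 2 * \<eta> + \<eta> * \<eta>" using kk by simp
      then show "E + s\<^sup>2 * C < 1" using E sC \<eta>2 \<eta>(1) by linarith
    qed
  next
    fix x assume "x \<in> cball y \<rho> \<inter> half_plane" and hx: "0 \<le> h x"
    then have x: "x \<in> D" by (simp add: D_def)
    have BFx: "B * F x \<le> - (B * x $ 2 / 2)" using mult_left_mono[OF Fx(1)[OF x] Bpos] by simp
    from \<sigma> show "0 \<le> \<sigma> * (u (chart_inv c x) t0 - barrier \<sigma> B h F x t0)"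
    proof
      assume 1: "\<sigma> = 1"
      \<comment> \<open>Half of \<open>B\<close> times the height absorbs the Lipschitz loss of
        \<open>u\<close> at time \<open>t0\<close>.\<close>
      have "2 * \<Lambda> * x $ 2 \<le> B * x $ 2" using B(1) Fx(4)[OF x] by (intro mult_right_mono)
      moreover have "\<psi> t0 - \<Lambda> * x $ 2 \<le> u (chart_inv c x) t0" using lip x by (simp add: D_def \<rho>_def)
      ultimately show ?thesis using bar1[OF 1 hx, of t0] BFx 1 by simp
    next
      assume 1: "\<sigma> = -1"
      obtain w q where wq: "x $ 2 = \<delta> * w" "0 \<le> w" "0 \<le> q" "h x = \<delta> * (k * (m * w + \<sigma> * q))" using
          split[OF x] by blast
      have "m * w + \<sigma> * q \<le> m * w" using 1 wq by simp
      also have "\<dots> \<le> \<Gamma> * w" using m wq by (intro mult_right_mono)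
      finally have "k * (m * w + \<sigma> * q) \<le> k * (\<Gamma> * w)" using k by (intro mult_left_mono) auto
      also have "\<dots> \<le> 2 * (\<Gamma> * w)" using k wq \<Gamma>(1) by (intro mult_right_mono) auto
      finally have "\<delta> * (k * (m * w + \<sigma> * q)) \<le> \<delta> * (2 * (\<Gamma> * w))" using \<delta>(1) by (intro
          mult_left_mono) auto
      then have hle: "h x \<le> 2 * \<Gamma> * x $ 2" unfolding wq(4) wq(1) by (simp add: algebra_simps)
      \<comment> \<open>The logarithm is estimated by its tangent at \<open>z\<close>. With
        \<open>hle\<close> this loses at most \<open>2 * \<Gamma> * x $ 2 / z\<close>, which
        explains the third lower bound on \<open>B\<close>.\<close>
      define z where "z = exp (- \<psi> t0)"
      have z: "0 < z" "ln z = - \<psi> t0" by (simp_all add: z_def)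
      have zh: "z + h x = z * (1 + h x / z)" using z(1) by (simp add: field_simps)
      have "0 < 1 + h x / z" using z(1) hx by (simp add: add_pos_nonneg)
      then have "ln (z + h x) = ln z + ln (1 + h x / z)" unfolding zh using z(1) by (intro
          ln_mult_pos)
      also have "\<dots> \<le> ln z + h x / z" using hx z(1) by (simp add: ln_add_one_self_le_self)
      also have "h x / z \<le> 2 * \<Gamma> * x $ 2 / z" using hle z(1) by (simp add: divide_right_mono)
      finally have "ln (z + h x) \<le> - \<psi> t0 + 2 * \<Gamma> * x $ 2 / z" using z(2) by simp
      moreover have "4 * \<Gamma> / z * x $ 2 \<le> B * x $ 2" using B(3) Fx(4)[OF x] unfolding z_def by (intro
          mult_right_mono)
      moreover have "4 * \<Gamma> / z * x $ 2 = 2 * (2 * \<Gamma> * x $ 2 / z)" by simp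
      moreover have "u (chart_inv c x) t0 \<le> \<psi> t0" by (rule upper[OF DM[OF x]]) simp
      ultimately have "u (chart_inv c x) t0 \<le> - ln (z + h x) - B * F x" using BFx by linarith
      then show ?thesis using 1 by (simp add: barrier_def z_def)
    qed
  next
    fix x t assume "x \<in> cball y \<rho> \<inter> half_plane" and hx: "0 \<le> h x" and t: "t0 \<le> t" and cases: "dist x
        y = \<rho> \<or> h x = 0 \<or> x $ 2 = 0"
    then have x: "x \<in> D" by (simp add: D_def)
    obtain w q where wq: "x $ 2 = \<delta> * w" "0 \<le> w" "w \<le> R" "0 \<le> q" "(dist x y)\<^sup>2 \<le> \<delta> * \<delta> * (\<Gamma> * q)" "h
        x = \<delta> * (k * (m * w + \<sigma> * q))"
      using split[OF x] by blast
    have far: "R * R \<le> \<Gamma> * q" if "dist x y = \<rho>"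
    proof -
      have "\<delta> * \<delta> * (R * R) \<le> \<delta> * \<delta> * (\<Gamma> * q)" using wq(5) that by (simp add: \<rho>_def power2_eq_square
          algebra_simps)
      moreover have "0 < \<delta> * \<delta>" using \<delta> by simp
      ultimately show ?thesis by (rule mult_left_le_imp_le)
    qed
    have zero: "m * w + \<sigma> * q = 0" if "h x = 0" using that wq(6) \<delta>(1) k(1) by simp
    from \<sigma> show "0 \<le> \<sigma> * (u (chart_inv c x) t - barrier \<sigma> B h F x t)"
    proof
      assume 1: "\<sigma> = 1"
      have tangent: "0 \<le> \<sigma> * (u (chart_inv c x) t - barrier \<sigma> B h F x t)" if "x $ 2 = 0"
        using bar1[OF 1 hx, of t] BF[OF x] ub[OF x that t] 1 by simp
      from cases show ?thesis
      proof (elim disjE)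
        assume d: "dist x y = \<rho>"
        \<comment> \<open>A lower bound for \<open>h\<close> on the outer circle. There the barrier
          is at most \<open>- ln hl - B * \<rho> * \<rho> / 2\<close>, which the second lower bound
          on \<open>B\<close> brings down to \<open>m0\<close>.\<close>
        define hl where "hl = \<delta> * R * R / \<Gamma>"
        have hl: "0 < hl" using \<delta> R \<Gamma> by (simp add: hl_def)
        have "R * R / \<Gamma> \<le> q" using far[OF d] \<Gamma>(1) by (simp add: pos_divide_le_eq mult.commute)
        then have "R * R / \<Gamma> \<le> m * w + q" using m wq(2) by (simp add: add_increasing)
        moreover have "0 \<le> m * w + q" using m wq by simp
        ultimately have "1 * (R * R / \<Gamma>) \<le> k * (m * w + q)" using k(3)[OF 1] R \<Gamma>(1) by (intro
            mult_mono) auto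
        then have "\<delta> * (R * R / \<Gamma>) \<le> \<delta> * (k * (m * w + q))" using \<delta>(1) by (intro mult_left_mono)
            auto
        then have "hl \<le> h x" unfolding wq(6) using 1 by (simp add: hl_def)
        then have "ln hl \<le> ln (exp (- \<psi> t) + h x)" using hl by (intro ln_mono) (auto intro:
            add_increasing add_pos_pos)
        moreover have "B * F x \<le> ln hl + m0"
        proof -
          have \<rho>2: "0 < \<rho>\<^sup>2" using \<rho> by simp
          have "2 * (- ln hl - m0) \<le> B * \<rho>\<^sup>2" using B(2) \<rho>2 unfolding hl_def \<rho>_def[symmetric] by
              (simp only: pos_divide_le_eq)
          moreover have "B * F x \<le> B * - (\<rho>\<^sup>2 / 2)" using Fx(2)[OF x] d Bpos by (intro
              mult_left_mono) auto
          ultimately show ?thesis by simp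
        qed
        moreover have "m0 \<le> u (chart_inv c x) t" using lower bound x t by (simp add: D_def \<rho>_def)
        ultimately show ?thesis using 1 by (simp add: barrier_def)
      next
        assume "h x = 0"
        \<comment> \<open>For the lower barrier both summands are non-negative, so
          \<open>h = 0\<close> happens only on the boundary line.\<close>
        then have "m * w + q = 0" using zero 1 by simp
        moreover have "0 \<le> m * w" using m wq by simp
        ultimately have "m * w = 0" using wq(4) by linarith
        then show ?thesis using tangent wq(1) m by simp
      qed (rule tangent)
    next
      assume 1: "\<sigma> = -1"
      have "0 \<le> k * (m * w + \<sigma> * q)" using hx \<delta>(1) unfolding wq(6) by (simp add: zero_le_mult_iff)
      then have mwq: "q \<le> m * w" using k(1) 1 by (simp add: zero_le_mult_iff)
      have "h x = 0"
        using cases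
      proof (elim disjE)
        \<comment> \<open>On the outer circle \<open>h \<ge> 0\<close> would give
          \<open>R \<le> \<Gamma> * \<Gamma>\<close>; the choice
          \<open>R = \<Gamma> * \<Gamma> + 1\<close> keeps the lens away from it.\<close>
        assume d: "dist x y = \<rho>"
        have "R * R \<le> \<Gamma> * (m * w)" using far[OF d] mult_left_mono[OF mwq, of \<Gamma>] \<Gamma>(1) by linarith
        also have "\<dots> \<le> \<Gamma> * (\<Gamma> * R)" using m wq(2,3) \<Gamma>(1) by (intro mult_left_mono mult_mono) auto
        finally have "R * R \<le> \<Gamma> * \<Gamma> * R" by simp
        then have "R \<le> \<Gamma> * \<Gamma>" using R(2) by (rule mult_right_le_imp_le)
        then show ?thesis using \<Gamma>(2) by simp
      next
        assume "x $ 2 = 0"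
        then have "w = 0" using wq(1) \<delta>(1) by simp
        then show ?thesis using mwq wq(4,6) by simp
      qed
      moreover have "u (chart_inv c x) t \<le> \<psi> t" by (rule upper[OF DM[OF x] t])
      ultimately show ?thesis using 1 BF[OF x] by (simp add: barrier_def)
    qed
  qed
  have hy: "h y = 0" "F y = 0" by (simp_all add: h_def hyp_quad_def F_def quad_def)
  have dh: "pdi (chart_img c) 2 h y = k * m" "pdi (chart_img c) 2 F y = - 1"
    unfolding h_def hyp_quad_def F_def pdi_quad[OF chart_img_open[OF c] yimg] by (simp_all add:
        m_def)
  have "0 \<le> \<sigma> * pdi (chart_img c) 2 (\<lambda>x. u (chart_inv c x) t) y - B * pdi (chart_img c) 2 F y + \<sigma> *
      pdi (chart_img c) 2 h y * exp (\<psi> t)"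
  proof (rule barrier_slope[OF c \<sigma> _ \<rho> p y Dimg[unfolded D_def]])
    show "Ck_on 2 W h" "Ck_on 2 W F" if "hp_open W" for W using hD that by auto
    show "continuous_on UNIV h" unfolding h_def hyp_quad_def by (rule continuous_on_quad)
    show "0 < pdi (chart_img c) 2 h y" unfolding dh using k m by simp
    show "T3 < t" using t t0 by simp
  qed (use hy cmp in auto)
  then show ?thesis unfolding dh by (simp add: k_def m_def)
qed

end

section \<open>The limit of the boundary curvature\<close>

context flow
begin

lemma curvature_formula:
  assumes p: "p \<in> M" and t: "0 \<le> t"
  shows "geodesic_curvature (conformal S (\<lambda>q. u q t)) p =
    exp (- u p t) * (normal_derivative S (\<lambda>q. u q t) p + geodesic_curvature S p)"
  by (rule geodesic_curvature_conformal[OF p]) (use Ck_on_u t in \<open>simp add: o_def\<close>)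

text \<open>The constants are chosen in the order \<open>\<Gamma>\<close>, \<open>\<omega>\<close>,
  \<open>\<delta>\<close>, \<open>t0\<close>, \<open>B\<close>, \<open>T\<close>, and none depends
  on the boundary point \<open>p\<close> in the neighbourhood. \<open>B\<close> depends on
  \<open>t0\<close> and may be huge, but in the end it is multiplied by
  \<open>exp (- \<psi> t)\<close> for later \<open>t\<close>.\<close>

lemma local_limit:
  assumes p0: "p0 \<in> bdry S" and \<eta>: "0 < \<eta>" "\<eta> \<le> 1/2"
  shows "\<exists>N. openin X N \<and> p0 \<in> N \<and> (\<exists>T. \<forall>p\<in>N \<inter> bdry S. \<forall>t\<ge>T.
    \<bar>geodesic_curvature (conformal S (\<lambda>q. u q t)) p - 1\<bar> \<le> 3 * \<eta>)"
proof -
  obtain c where c: "c \<in> \<A>" "p0 \<in> chart_dom c" using bdry_in_M[OF p0] atlas_cover by blast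
  define x0 where "x0 = chart_map c p0"
  have x02: "x0 $ 2 = 0" using boundary_chart[OF p0 c] by (simp add: x0_def)
  note V = chart_img_open[OF c(1)]
  let ?W = "chart_map c ` (bounded_part \<inter> chart_dom c)"
  have W: "hp_open ?W" "?W \<subseteq> chart_img c"
    by (auto intro!: openin_chart_image openin_Int bounded_part_open chart_dom_open c)
  have "chart_map c p0 \<in> ?W" using p0 c bdry_bounded_part by blast
  then obtain r where r: "0 < r" "cball x0 r \<inter> half_plane \<subseteq> ?W" using half_ball_nhd[OF c W]
      unfolding x0_def by blast
  define A where "A = cball x0 r \<inter> half_plane"
  have A: "compact A" "A \<subseteq> chart_img c" using compact_half_ball r(2) W(2) by (auto simp: A_def)
  have Ab: "chart_inv c x \<in> bounded_part" if "x \<in> A" for x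
    using that r(2) c(1) by (auto simp: A_def)
  obtain \<Gamma> where \<Gamma>: "1 \<le> \<Gamma>" "\<And>x. x \<in> A \<Longrightarrow> coeff_bound c \<Gamma> x" using local_coeff_bound[OF c(1) A] by
      blast
  define R where "R = \<Gamma> * \<Gamma> + 1"
  have R: "0 < R" using \<Gamma>(1) by (simp add: R_def add_pos_pos)
  define Pm where "Pm = 2 * \<Gamma> * (1 + 4 * R)"
  define Hm where "Hm = 2 * (\<Gamma> * R + 4 * \<Gamma> * R * R)"
  define E0 where "E0 = 4 * Pm * Pm + 16 * \<Gamma> * Hm + 16 * \<Gamma> * \<Gamma> + 2 * \<Gamma> * Pm * (1 + Hm)"
  have E0: "0 \<le> E0" using \<Gamma>(1) R unfolding E0_def Pm_def Hm_def by simp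
  obtain C' where C': "\<And>q. q \<in> inter S \<Longrightarrow> \<bar>K q\<bar> \<le> C'" using curvature_bounded inter_in_M by blast
  define C where "C = \<bar>C'\<bar>"
  have C: "\<And>q. q \<in> inter S \<Longrightarrow> \<bar>K q\<bar> \<le> C" "0 \<le> C" using order_trans[OF C' abs_ge_self] by (auto simp:
      C_def)
  \<comment> \<open>The \<open>+ 1\<close> only guards against \<open>E0 = 0\<close>.\<close>
  define \<omega> where "\<omega> = \<eta> / (8 * (E0 + 1))"
  have \<omega>: "0 < \<omega>" "E0 * \<omega> \<le> \<eta> / 8" using E0 \<eta>(1) by (simp_all add: \<omega>_def field_simps)
  obtain d0 where d0: "0 < d0" "\<And>x y i j. x \<in> A \<Longrightarrow> y \<in> A \<Longrightarrow> dist x y < d0 \<Longrightarrow> \<bar>metric_inv S c x $ i $ j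
      - metric_inv S c y $ i $ j\<bar> \<le> \<omega>"
    using local_metric_uniform[OF c(1) A \<omega>(1)] by metis
  have r2: "0 < r / 2" using r by simp
  obtain \<delta> where \<delta>: "0 < \<delta>" "\<delta> < 1" "R * \<delta> < r / 2" "R * \<delta> < d0" "R * \<delta> < 1" "(3 * \<Gamma> * \<Gamma> * R) * \<delta> <
      1/2"
      "E0 * \<delta> < \<eta> / 8" "((1 + Hm) * (1 + Hm) * C) * \<delta> < \<eta> / 4"
    using small_constants[OF r2 d0(1) \<eta>(1)] by metis
  \<comment> \<open>Serves both conditions on \<open>exp (- \<psi> t)\<close>: it is at most
    \<open>\<delta>\<close>, and after division by \<open>\<delta>\<close> at most
    \<open>\<omega>\<close>.\<close>
  define \<epsilon> where "\<epsilon> = min \<delta> (\<delta> * \<omega>)"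
  have \<epsilon>: "0 < \<epsilon>" using \<delta>(1) \<omega>(1) by (simp add: \<epsilon>_def)
  obtain T1 where T1: "T3 < T1" "\<forall>t\<ge>T1. 0 \<le> deriv \<psi> t" "\<forall>p\<in>M. \<forall>t\<ge>T1. u p t \<le> \<psi> t" using u_le_\<psi> by
      blast
  obtain m0 where m0: "\<forall>p\<in>bounded_part. \<forall>t\<ge>T1. m0 \<le> u p t" using u_lower_bound[OF T1(1,2)] by blast
  obtain t0 where t0: "T1 \<le> t0" "\<And>t. t0 \<le> t \<Longrightarrow> deriv \<psi> t < \<eta>" "\<And>t. t0 \<le> t \<Longrightarrow> exp (- \<psi> t) \<le> \<epsilon>"
    using large_time[OF \<eta>(1) \<epsilon>] by blast
  have t03: "T3 < t0" using t0(1) T1(1) by simp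
  obtain \<Lambda> where \<Lambda>: "0 \<le> \<Lambda>" "\<And>x. x \<in> A \<Longrightarrow> \<psi> t0 - \<Lambda> * x $ 2 \<le> u (chart_inv c x) t0"
    using initial_lipschitz[OF c(1) A(2)[unfolded A_def] x02 less_imp_le[OF t03]] unfolding A_def by
        blast
  define B where "B = max (2 * \<Lambda>) (max (2 * (- ln (\<delta> * R * R / \<Gamma>) - m0) / (R * \<delta>)\<^sup>2) (4 * \<Gamma> / exp (-
      \<psi> t0)))"
  have B: "2 * \<Lambda> \<le> B" "2 * (- ln (\<delta> * R * R / \<Gamma>) - m0) / (R * \<delta>)\<^sup>2 \<le> B" "4 * \<Gamma> / exp (- \<psi> t0) \<le> B"
      "0 \<le> B"
    using \<Lambda>(1) by (auto simp: B_def)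
  \<comment> \<open>A second, later time: \<open>\<Gamma> * B\<close> bounds the contribution of the
    corrector to the normal derivative and \<open>\<Gamma>\<close> the geodesic curvature of the
    original metric.\<close>
  have "0 < \<eta> / (\<Gamma> * B + \<Gamma>)" using \<eta> \<Gamma>(1) B(4) by (simp add: add_nonneg_pos)
  then obtain T where T: "t0 \<le> T" "\<And>t. T \<le> t \<Longrightarrow> exp (- \<psi> t) \<le> \<eta> / (\<Gamma> * B + \<Gamma>)"
    using large_time[OF \<eta>(1)] by metis
  \<comment> \<open>Half the radius, so that the half disc of radius
    \<open>R * \<delta> < r / 2\<close> around each point of \<open>?U\<close> remains in
    \<open>A\<close>.\<close>
  let ?U = "ball x0 (r/2) \<inter> half_plane"
  have UA: "?U \<subseteq> A" using r by (auto simp: A_def)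
  have "openin X (chart_inv c ` ?U)" using UA A(2) by (intro openin_chart_preimage c
      openin_half_plane_ball) auto
  moreover have "p0 \<in> chart_inv c ` ?U"
  proof (rule image_eqI)
    show "p0 = chart_inv c x0" using c by (simp add: x0_def)
    show "x0 \<in> ?U" using r x02 by (simp add: half_plane_def)
  qed
  moreover have "\<forall>p\<in>chart_inv c ` ?U \<inter> bdry S. \<forall>t\<ge>T. \<bar>geodesic_curvature (conformal S (\<lambda>q. u q t)) p
      - 1\<bar> \<le> 3 * \<eta>"
  proof (intro ballI allI impI)
    fix p t assume p: "p \<in> chart_inv c ` ?U \<inter> bdry S" and t: "T \<le> t"
    have pb: "p \<in> bdry S" using p by simp
    define y where "y = chart_map c p"
    obtain x where x: "x \<in> ?U" "p = chart_inv c x" using p by blast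
    have ximg: "x \<in> chart_img c" using x(1) UA A(2) by blast
    have yx: "y = x" using ximg by (simp add: y_def x(2))
    have pc: "p \<in> chart_dom c" using ximg by (simp add: x(2))
    have yA: "y \<in> A" using x(1) UA yx by blast
    have tt: "t0 \<le> t" using t T(1) by simp
    have near: "z \<in> A" "dist z y < d0" if z: "z \<in> cball y (R * \<delta>) \<inter> half_plane" for z
    proof -
      have zy: "dist z y \<le> R * \<delta>" using z by (simp add: dist_commute)
      have "dist y x0 < r / 2" using x(1) yx by (simp add: dist_commute)
      then have "dist z x0 \<le> r" using dist_triangle[of z x0 y] zy \<delta>(3) by linarith
      then show "z \<in> A" using z by (simp add: A_def dist_commute)
      show "dist z y < d0" using zy \<delta>(4) by simp
    qed
    define a where "a = metric_inv S c y $ 2 $ 2"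
    have a: "0 < a" "sqrt a \<le> \<Gamma>" using metric_inv_pos(2)[OF c(1)] yA A(2) \<Gamma>(2)[OF yA] by (auto simp:
        a_def coeff_bound_def)
    define e where "e = exp (- \<psi> t)"
    have e: "0 < e" "e * exp (\<psi> t) = 1" by (simp_all add: e_def flip: exp_add)
    define X2 where "X2 = pdi (chart_img c) 2 (\<lambda>x. u (chart_inv c x) t) y"
    have slope: "0 \<le> \<sigma> * X2 + B + \<sigma> * ((1 + \<sigma> * \<eta>) / sqrt a) * exp (\<psi> t)" if \<sigma>: "\<sigma> = 1 \<or> \<sigma> = -1" for
        \<sigma>
      unfolding X2_def a_def
    proof (rule boundary_barriers[where p = p and R = R and \<Gamma> = \<Gamma> and \<delta> = \<delta> and \<omega> = \<omega> and ?t0.0 = t0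
        and ?m0.0 = m0 and \<Lambda> = \<Lambda> and C = C and Pm = Pm and Hm = Hm and ?E0.0 = E0])
      show "x \<in> chart_img c \<and> coeff_bound c \<Gamma> x \<and> chart_inv c x \<in> bounded_part" if "x \<in> cball y (R *
          \<delta>) \<inter> half_plane" for x
        using near(1)[OF that] A(2) \<Gamma>(2) Ab by blast
      show "\<bar>metric_inv S c x $ i $ j - metric_inv S c y $ i $ j\<bar> \<le> \<omega>" if "x \<in> cball y (R * \<delta>) \<inter>
          half_plane" for x i j
        by (rule d0(2)[OF near(1)[OF that] yA near(2)[OF that]])
      show "0 \<le> deriv \<psi> s \<and> deriv \<psi> s < \<eta>" if "t0 \<le> s" for s using that t0(1,2) T1(2) by auto
      show "u q s \<le> \<psi> s" if "q \<in> M" "t0 \<le> s" for q s using that t0(1) T1(3) by auto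
      show "m0 \<le> u q s" if "q \<in> bounded_part" "t0 \<le> s" for q s using that t0(1) m0 by auto
      show "\<psi> t0 - \<Lambda> * x $ 2 \<le> u (chart_inv c x) t0" if "x \<in> cball y (R * \<delta>) \<inter> half_plane" for x
        by (rule \<Lambda>(2)[OF near(1)[OF that]])
      show "\<bar>K q\<bar> \<le> C" if "q \<in> inter S" for q by (rule C(1)[OF that])
      show "exp (- \<psi> s) \<le> \<delta>" if "t0 \<le> s" for s using t0(3)[OF that] by (simp add: \<epsilon>_def)
      show "E0 * (exp (- \<psi> s) / \<delta>) \<le> \<eta> / 8" if "t0 \<le> s" for s
      proof -
        have "exp (- \<psi> s) \<le> \<delta> * \<omega>" using t0(3)[OF that] by (simp add: \<epsilon>_def)
        then have "exp (- \<psi> s) / \<delta> \<le> \<omega>" using \<delta>(1) by (simp add: pos_divide_le_eq mult.commute)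
        then have "E0 * (exp (- \<psi> s) / \<delta>) \<le> E0 * \<omega>" using E0 by (rule mult_left_mono)
        then show ?thesis using \<omega>(2) by linarith
      qed
      show "3 * \<Gamma> * \<Gamma> * (R * \<delta>) \<le> 1/2" using \<delta>(6) by (simp add: mult.assoc)
    qed (use c pb pc y_def \<sigma> \<eta> \<delta> \<Gamma>(1) R_def t03 C(2) Pm_def Hm_def E0_def \<omega>(2) B(1-3) tt in
        \<open>simp_all\<close>)
    have nd: "normal_derivative S (\<lambda>q. u q t) p = - sqrt a * X2"
      using normal_derivative_bdry[OF pb c(1) pc] t03 tt by (simp add: y_def X2_def a_def)
    \<comment> \<open>The factor that turns the partial derivative into \<open>exp (- u)\<close>
      times the normal derivative, up to sign, cancels both \<open>sqrt a\<close> and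
      \<open>exp (\<psi> t)\<close> in the slope of the barrier.\<close>
    have scale: "e * sqrt a * (s * (k / sqrt a) * exp (\<psi> t)) = s * k" for s k
      using e(2) a(1) by (simp add: field_simps)
    have scaleB: "e * sqrt a * B \<le> e * (\<Gamma> * B)"
      using a(2) e(1) B(4) by (simp add: mult.assoc mult_left_mono mult_right_mono)
    have small: "e * (\<Gamma> * B + \<Gamma>) \<le> \<eta>"
    proof -
      have "e \<le> \<eta> / (\<Gamma> * B + \<Gamma>)" using T(2)[OF t] by (simp add: e_def)
      then show ?thesis using \<Gamma>(1) B(4) by (simp add: pos_le_divide_eq add_nonneg_pos)
    qed
    have e\<Gamma>: "0 \<le> e * (\<Gamma> * B)" "0 \<le> e * \<Gamma>" using e(1) \<Gamma>(1) B(4) by auto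
    have ea: "0 \<le> e * sqrt a" using e(1) a(1) by simp
    have up: "0 \<le> e * sqrt a * X2 + e * sqrt a * B + (1 + \<eta>)"
      using mult_nonneg_nonneg[OF ea slope[of 1]] scale[of 1 "1 + \<eta>"] by (simp only: distrib_left)
          simp
    have lo: "0 \<le> - (e * sqrt a * X2) + e * sqrt a * B - (1 - \<eta>)"
      using mult_nonneg_nonneg[OF ea slope[of "-1"]] scale[of "-1" "1 - \<eta>"] by (simp only:
          distrib_left) simp
    have k: "\<bar>e * geodesic_curvature S p\<bar> \<le> e * \<Gamma>"
      using geodesic_curvature_chart[OF pb c(1) pc] \<Gamma>(2)[OF yA] e(1) by (simp add: abs_mult
          coeff_bound_def y_def)
    have "u p t = \<psi> t" using u_bdry[OF pb] t03 tt by simp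
    then have "geodesic_curvature (conformal S (\<lambda>q. u q t)) p = - (e * sqrt a * X2) + e *
        geodesic_curvature S p"
      using curvature_formula[OF bdry_in_M[OF pb], of t] T3 t03 tt nd by (simp add: e_def
          algebra_simps)
    \<comment> \<open>One \<open>\<eta>\<close> comes from the slope and one from
      \<open>small\<close>; the third is slack.\<close>
    then show "\<bar>geodesic_curvature (conformal S (\<lambda>q. u q t)) p - 1\<bar> \<le> 3 * \<eta>"
      using up lo k small scaleB e\<Gamma> \<eta>(1) unfolding distrib_left by linarith
  qed
  ultimately show ?thesis by blast
qed

text \<open>\<open>compact_uniform\<close> with the time in the role of \<open>C\<close>: the local
  estimate holds for all later times, so it is monotone in that constant.\<close>

lemma curvature_limit:
  "uniform_limit (bdry S) (\<lambda>t p. geodesic_curvature (conformal S (\<lambda>q. u q t)) p) (\<lambda>_. 1) at_top"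
  unfolding uniform_limit_iff
proof (intro allI impI)
  fix \<epsilon> :: real assume \<epsilon>: "0 < \<epsilon>"
  define \<eta> where "\<eta> = min (\<epsilon> / 4) (1 / 2)"
  have \<eta>: "0 < \<eta>" "\<eta> \<le> 1/2" "3 * \<eta> < \<epsilon>" using \<epsilon> by (auto simp: \<eta>_def min_def)
  have "\<exists>T. \<forall>p\<in>bdry S. \<forall>t\<ge>T. \<bar>geodesic_curvature (conformal S (\<lambda>q. u q t)) p - 1\<bar> \<le> 3 * \<eta>"
    by (rule compact_uniform[OF closedin_bdry local_limit[OF _ \<eta>(1,2)]]) auto
  then obtain T where T: "\<And>p t. p \<in> bdry S \<Longrightarrow> T \<le> t \<Longrightarrow> \<bar>geodesic_curvature (conformal S (\<lambda>q. u q t)) p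
      - 1\<bar> \<le> 3 * \<eta>" by blast
  show "\<forall>\<^sub>F t in at_top. \<forall>p\<in>bdry S. dist (geodesic_curvature (conformal S (\<lambda>q. u q t)) p) 1 < \<epsilon>"
    unfolding eventually_at_top_linorder
  proof (intro exI[of _ T] allI impI ballI)
    fix t p assume "T \<le> t" "p \<in> bdry S"
    then show "dist (geodesic_curvature (conformal S (\<lambda>q. u q t)) p) 1 < \<epsilon>"
      using T[of p t] \<eta>(3) by (simp add: dist_real_def)
  qed
qed

end

theorem theorem1p2:
  fixes S :: "'a surface" and \<alpha> T3 :: real
    and u0 :: "'a \<Rightarrow> real" and \<phi> u :: "'a \<Rightarrow> real \<Rightarrow> real" and \<psi> :: "real \<Rightarrow> real"
  assumes "compact_riemannian_surface S"
    and "0 < \<alpha>" and "\<alpha> < 1"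
    and "admissible_pair S \<alpha> u0 \<phi>"
    and "T3 > 0" and "\<forall>p\<in>bdry S. \<forall>t\<ge>T3. \<phi> p t = \<psi> t"
    and "(deriv \<psi> \<longlongrightarrow> 0) at_top"
    and "cauchy_dirichlet_solution S \<alpha> u0 \<phi> u"
  shows "(\<forall>t\<ge>0. \<forall>p\<in>bdry S.
            geodesic_curvature (conformal S (\<lambda>q. u q t)) p =
              exp (- u p t) * (normal_derivative S (\<lambda>q. u q t) p + geodesic_curvature S p)) \<and>
         uniform_limit (bdry S)
           (\<lambda>t p. geodesic_curvature (conformal S (\<lambda>q. u q t)) p) (\<lambda>_. 1) at_top"
proof (cases "bdry S = {}")
  case True
  then show ?thesis by (simp add: uniform_limit_iff)
next
  case False
  interpret flow S \<alpha> T3 u0 \<phi> u \<psi>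
    by unfold_locales (use assms False in auto)
  show ?thesis using curvature_formula bdry_in_M curvature_limit by blast
qed

end
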